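(* Let $b>1$ be an integer. Given as input a minimal automaton $\mathcal{A}$ over $A_b=\{0,1,\ldots,b-1\}$ with $n$ states, it can be decided in time $O(b\,n)$ whether $\mathcal{A}$ satisfies all of the following conditions, where $CG(\mathcal{A})$ denotes the component graph of $\mathcal{A}$: (UP 0) each state and its successor by the digit $0$ are both final or both non-final; (UP 1) $\mathcal{A}$ is minimal and complete; (UP 2) every type-one strongly connected component of $\mathcal{A}$ is $\mathbb{UP}$-atomic; (UP 3) every type-two strongly connected component has in $CG(\mathcal{A})$ exactly one descendant, and that descendant is a strongly connected component of type one; (UP 4) every type-two strongly connected component is embedded in its descendant in $CG(\mathcal{A})$.
   Context: Automata are deterministic and finite, written $\langle A_b,Q,i,\delta,F\rangle$ (alphabet, states, initial state, transition function, final states); $\delta(s,u)$ is written $s\cdot u$. A minimal automaton is the complete automaton with the least number of states accepting its language. Time is unit-cost RAM time, uniformly in $b$ and $n$. Periodic sets. $S\subseteq\mathbb{N}$ is purely periodic if $S=R+p\mathbb{N}$ for some integer $p\ge 1$ and $R\subseteq\{0,\ldots,p-1\}$; the least such $p$ is the period of $S$. Atomic automata. For $S\subseteq\mathbb{N}$ and $a\in A_b$, let $\Delta(S,a)=\{n\in\mathbb{N}\mid nb+a\in S\}$, extended to words as usual. For a purely periodic $S$, $\mathcal{U}_S$ is the automaton whose states are the sets $\Delta(S,u)$, $u\in A_b^*$ (finitely many), with initial state $S$, transition function the restriction of $\Delta$, and final states those states containing $0$. An automaton is $\mathbb{UP}$-atomic if it is (isomorphic to) $\mathcal{U}_S$ for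 some purely periodic $S$ whose period is coprime with $b$. This property does not depend on which state is taken as initial, so a strongly connected component $C$ is called $\mathbb{UP}$-atomic if $\langle A_b,C,q,\delta_{|C},F\cap C\rangle$ is $\mathbb{UP}$-atomic for some (equivalently, any) $q\in C$. Components. Strongly connected components (s.c.c.'s) are the classes of the relation "mutually reachable". A s.c.c. is trivial if it consists of a single state lying on no circuit. A non-trivial s.c.c. is of type two if it is a simple circuit whose (internal) transitions are all labelled by $0$; it is of type one otherwise, that is, if it has an internal transition labelled by a positive digit. The component graph is the labelled directed acyclic graph obtained by contracting each s.c.c. to a vertex. A s.c.c. $X$ is a descendant of another s.c.c. $Y\neq X$ if $X$ is a successor of $Y$ in the component graph, i.e. there are $y\in Y$, $x\in X$ and a letter $a$ with $y\cdot a=x$. Embedding. A s.c.c. $C$ is embedded in another s.c.c. $D$ if there is a function $f:C\cup D\to D$ such that: (i) $f(s)=s$ for every $s\in D$; (ii) for every $s\in C$ and letter $a$, $s\cdot a$ exists if and only if $f(s)\cdot a$ exists; (iii) for every $s\in C\cup D$ and letter $a$ with $s\cdot a\in C\cup D$, $f(s\cdot a)=f(s)\cdot a$. *)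

theory Defs
  imports Main
begin

text \<open>Transition functions may be partial. The alphabet of \<open>A\<close> is \<open>{..<base A}\<close>.\<close>

record 'q automaton =
  base :: nat
  states :: "'q set"
  initial :: 'q
  delta :: "'q \<Rightarrow> nat \<Rightarrow> 'q option"
  finals :: "'q set"

definition automaton :: "'q automaton \<Rightarrow> bool" where
  "automaton A \<longleftrightarrow>
     finite (states A) \<and> initial A \<in> states A \<and> finals A \<subseteq> states A \<and>
     (\<forall>s a t. delta A s a = Some t \<longrightarrow> s \<in> states A \<and> a < base A \<and> t \<in> states A)"

definition complete :: "'q automaton \<Rightarrow> bool" where
  "complete A \<longleftrightarrow> (\<forall>s\<in>states A. \<forall>a<base A. delta A s a \<noteq> None)"

fun run :: "'q automaton \<Rightarrow> 'q \<Rightarrow> nat list \<Rightarrow> 'q option" where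
  "run A s [] = Some s"
| "run A s (a # u) = (case delta A s a of None \<Rightarrow> None | Some t \<Rightarrow> run A t u)"

definition language :: "'q automaton \<Rightarrow> nat list set" where
  "language A = {u \<in> lists {..<base A}. \<exists>q\<in>finals A. run A (initial A) u = Some q}"

text \<open>Competitors with states in \<^typ>\<open>nat\<close> suffice, as state sets are finite.\<close>

definition minimal :: "'q automaton \<Rightarrow> bool" where
  "minimal A \<longleftrightarrow>
     automaton A \<and> complete A \<and>
     (\<forall>B :: nat automaton.
        automaton B \<and> complete B \<and> base B = base A \<and> language B = language A
        \<longrightarrow> card (states A) \<le> card (states B))"

definition isomorphic :: "'q automaton \<Rightarrow> 'r automaton \<Rightarrow> bool" where
  "isomorphic A B \<longleftrightarrow>
     base A = base B \<and>
     (\<exists>h. bij_betw h (states A) (states B) \<and>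
          h (initial A) = initial B \<and>
          (\<forall>s\<in>states A. \<forall>a<base A. delta B (h s) a = map_option h (delta A s a)) \<and>
          (\<forall>s\<in>states A. s \<in> finals A \<longleftrightarrow> h s \<in> finals B))"

definition has_pure_period :: "nat set \<Rightarrow> nat \<Rightarrow> bool" where
  "has_pure_period S p \<longleftrightarrow>
     p \<ge> 1 \<and> (\<exists>R \<subseteq> {..<p}. S = {r + p * k | r k. r \<in> R})"

definition purely_periodic :: "nat set \<Rightarrow> bool" where
  "purely_periodic S \<longleftrightarrow> (\<exists>p. has_pure_period S p)"

definition period :: "nat set \<Rightarrow> nat" where
  "period S = (LEAST p. has_pure_period S p)"

definition Delta :: "nat \<Rightarrow> nat set \<Rightarrow> nat \<Rightarrow> nat set" where
  "Delta b S a = {n. n * b + a \<in> S}"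

definition Delta_word :: "nat \<Rightarrow> nat set \<Rightarrow> nat list \<Rightarrow> nat set" where
  "Delta_word b S u = foldl (Delta b) S u"

definition atomic_automaton :: "nat \<Rightarrow> nat set \<Rightarrow> nat set automaton" where
  "atomic_automaton b S =
     (let Q = {Delta_word b S u | u. u \<in> lists {..<b}} in
      \<lparr> base = b,
        states = Q,
        initial = S,
        delta = (\<lambda>X a. if X \<in> Q \<and> a < b then Some (Delta b X a) else None),
        finals = {X \<in> Q. 0 \<in> X} \<rparr>)"

definition UP_atomic :: "'q automaton \<Rightarrow> bool" where
  "UP_atomic A \<longleftrightarrow>
     (\<exists>S. purely_periodic S \<and> coprime (period S) (base A) \<and>
          isomorphic A (atomic_automaton (base A) S))"

definition edges :: "'q automaton \<Rightarrow> ('q \<times> 'q) set" where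
  "edges A = {(s, t). \<exists>a. delta A s a = Some t}"

definition mutually_reachable :: "'q automaton \<Rightarrow> ('q \<times> 'q) set" where
  "mutually_reachable A =
     {(s, t). s \<in> states A \<and> t \<in> states A \<and> (s, t) \<in> (edges A)\<^sup>* \<and> (t, s) \<in> (edges A)\<^sup>*}"

definition sccs :: "'q automaton \<Rightarrow> 'q set set" where
  "sccs A = states A // mutually_reachable A"

definition trivial_scc :: "'q automaton \<Rightarrow> 'q set \<Rightarrow> bool" where
  "trivial_scc A C \<longleftrightarrow> C \<in> sccs A \<and> (\<exists>s. C = {s} \<and> (s, s) \<notin> (edges A)\<^sup>+)"

definition internal_transitions :: "'q automaton \<Rightarrow> 'q set \<Rightarrow> ('q \<times> nat \<times> 'q) set" where
  "internal_transitions A C = {(s, a, t). s \<in> C \<and> t \<in> C \<and> delta A s a = Some t}"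

text \<open>The list \<open>xs\<close> enumerates the simple circuit; a loop is a circuit of length one.\<close>

definition type_two :: "'q automaton \<Rightarrow> 'q set \<Rightarrow> bool" where
  "type_two A C \<longleftrightarrow>
     C \<in> sccs A \<and> \<not> trivial_scc A C \<and>
     (\<exists>xs. xs \<noteq> [] \<and> distinct xs \<and> set xs = C \<and>
           internal_transitions A C =
             {(xs ! i, 0, xs ! (Suc i mod length xs)) | i. i < length xs})"

definition type_one :: "'q automaton \<Rightarrow> 'q set \<Rightarrow> bool" where
  "type_one A C \<longleftrightarrow> C \<in> sccs A \<and> \<not> trivial_scc A C \<and> \<not> type_two A C"

definition restrict_to :: "'q automaton \<Rightarrow> 'q set \<Rightarrow> 'q \<Rightarrow> 'q automaton" where
  "restrict_to A C q =
     \<lparr> base = base A,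
       states = C,
       initial = q,
       delta = (\<lambda>s a. if (\<exists>t. (s, a, t) \<in> internal_transitions A C) then delta A s a else None),
       finals = finals A \<inter> C \<rparr>"

definition UP_atomic_scc :: "'q automaton \<Rightarrow> 'q set \<Rightarrow> bool" where
  "UP_atomic_scc A C \<longleftrightarrow> (\<exists>q\<in>C. UP_atomic (restrict_to A C q))"

text \<open>The labelled edges of the component graph, whose vertices are \<^term>\<open>sccs A\<close>.\<close>

definition component_graph :: "'q automaton \<Rightarrow> ('q set \<times> nat \<times> 'q set) set" where
  "component_graph A =
     {(Y, a, X). Y \<in> sccs A \<and> X \<in> sccs A \<and> X \<noteq> Y \<and> (\<exists>y\<in>Y. \<exists>x\<in>X. delta A y a = Some x)}"

definition descendants :: "'q automaton \<Rightarrow> 'q set \<Rightarrow> 'q set set" where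
  "descendants A Y = {X. \<exists>a. (Y, a, X) \<in> component_graph A}"

definition embedded :: "'q automaton \<Rightarrow> 'q set \<Rightarrow> 'q set \<Rightarrow> bool" where
  "embedded A C D \<longleftrightarrow>
     (\<exists>f. f ` (C \<union> D) \<subseteq> D \<and>
          (\<forall>s\<in>D. f s = s) \<and>
          (\<forall>s\<in>C. \<forall>a<base A. delta A s a \<noteq> None \<longleftrightarrow> delta A (f s) a \<noteq> None) \<and>
          (\<forall>s\<in>C \<union> D. \<forall>a<base A. \<forall>t\<in>C \<union> D.
             delta A s a = Some t \<longrightarrow> delta A (f s) a = Some (f t)))"

definition UP0 :: "'q automaton \<Rightarrow> bool" where
  "UP0 A \<longleftrightarrow>
     (\<forall>s\<in>states A. \<forall>t. delta A s 0 = Some t \<longrightarrow> (s \<in> finals A \<longleftrightarrow> t \<in> finals A))"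

definition UP1 :: "'q automaton \<Rightarrow> bool" where
  "UP1 A \<longleftrightarrow> minimal A \<and> complete A"

definition UP2 :: "'q automaton \<Rightarrow> bool" where
  "UP2 A \<longleftrightarrow> (\<forall>C. type_one A C \<longrightarrow> UP_atomic_scc A C)"

definition UP3 :: "'q automaton \<Rightarrow> bool" where
  "UP3 A \<longleftrightarrow> (\<forall>C. type_two A C \<longrightarrow> (\<exists>D. descendants A C = {D} \<and> type_one A D))"

text \<open>Uniqueness of the descendant is asserted by \<^const>\<open>UP3\<close>, together with which this is used.\<close>

definition UP4 :: "'q automaton \<Rightarrow> bool" where
  "UP4 A \<longleftrightarrow> (\<forall>C. type_two A C \<longrightarrow> (\<forall>D\<in>descendants A C. embedded A C D))"

text \<open>
  A program is a fixed list of instructions acting on registers (of which it mentions only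
  finitely many) and on an indirectly addressed memory, all holding natural numbers. The only
  arithmetic is addition and truncated subtraction, so that the unit-cost measure cannot
  exploit fast multiplication. Jump targets are absolute; the machine halts when the program
  counter leaves the program.
\<close>

datatype instr =
    Const nat nat
  | Add nat nat nat
  | Sub nat nat nat
  | Load nat nat
  | Store nat nat
  | Jump nat
  | JumpZero nat nat

type_synonym program = "instr list"

record config =
  pc :: nat
  regs :: "nat \<Rightarrow> nat"
  mem :: "nat \<Rightarrow> nat"

fun exec_instr :: "instr \<Rightarrow> config \<Rightarrow> config" where
  "exec_instr (Const r k) c = c\<lparr>pc := pc c + 1, regs := (regs c)(r := k)\<rparr>"
| "exec_instr (Add r s t) c = c\<lparr>pc := pc c + 1, regs := (regs c)(r := regs c s + regs c t)\<rparr>"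
| "exec_instr (Sub r s t) c = c\<lparr>pc := pc c + 1, regs := (regs c)(r := regs c s - regs c t)\<rparr>"
| "exec_instr (Load r s) c = c\<lparr>pc := pc c + 1, regs := (regs c)(r := mem c (regs c s))\<rparr>"
| "exec_instr (Store r s) c = c\<lparr>pc := pc c + 1, mem := (mem c)(regs c r := regs c s)\<rparr>"
| "exec_instr (Jump l) c = c\<lparr>pc := l\<rparr>"
| "exec_instr (JumpZero r l) c = c\<lparr>pc := (if regs c r = 0 then l else pc c + 1)\<rparr>"

definition halted :: "program \<Rightarrow> config \<Rightarrow> bool" where
  "halted P c \<longleftrightarrow> pc c \<ge> length P"

definition step :: "program \<Rightarrow> config \<Rightarrow> config" where
  "step P c = (if halted P c then c else exec_instr (P ! pc c) c)"

definition start :: "nat list \<Rightarrow> config" where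
  "start input =
     \<lparr> pc = 0,
       regs = (\<lambda>_. 0),
       mem = (\<lambda>i. if i < length input then input ! i else 0) \<rparr>"

text \<open>On \<open>input\<close>, \<open>P\<close> halts after at most \<open>T\<close> steps with the truth value of \<open>\<phi>\<close> in register 0.\<close>

definition decides_within :: "program \<Rightarrow> nat list \<Rightarrow> nat \<Rightarrow> bool \<Rightarrow> bool" where
  "decides_within P input T \<phi> \<longleftrightarrow>
     (\<exists>t\<le>T. let c = (step P ^^ t) (start input) in
              halted P c \<and> regs c 0 = (if \<phi> then 1 else 0))"

text \<open>
  Input format, for an automaton with states \<open>{..<n}\<close>: base, number of states, initial state,
  finality flags, then the transition table row by row, with \<open>n\<close> marking a missing transition.
\<close>

definition encode :: "nat automaton \<Rightarrow> nat list" where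
  "encode A =
     (let b = base A; n = card (states A) in
      [b, n, initial A]
      @ map (\<lambda>q. if q \<in> finals A then 1 else 0) [0..<n]
      @ concat (map (\<lambda>q. map (\<lambda>a. case delta A q a of None \<Rightarrow> n | Some t \<Rightarrow> t) [0..<b]) [0..<n]))"

end

(*
  Reading 0 permutes every non-trivial component admitted by (UP 2)-(UP 4). Let K be the set of
  states reachable from a circuit. Under these conditions K is the union of the non-trivial
  components, reading 0 is a bijection of K, and tau q := 0^{-1}(q.1) is a shift operator on K
  satisfying
    q.a = (tau^a q).0   and   tau (q.0) = (tau^b q).0,
  because these identities hold in the atomic automata and are carried over to type-two circuits by
  the embedding. Moreover tau is injective on tau(K). Conversely, suppose that these properties
  hold. Then all letters permute tau(K), and the orbits of this action are the type-one components.
  As finality is invariant under reading 0, a state s of tau(K) accepts the numbers n with tau^n s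
  final, a purely periodic set whose period divides the order of tau, which is prime to b. By
  minimality this set determines s, so the component is atomic. A state s of K outside tau(K) lies
  on a 0-circuit all of whose other transitions enter tau(K), and s is embedded by sending it to
  the unique state of tau(K) having the same image under tau.

  Thus it suffices to compute K by repeatedly removing states without predecessors
  (Kahn's algorithm), to invert the digit 0 on K, to tabulate tau, and to check the identities row
  by row; no general algorithm for strongly connected components is needed.
*)
theory Submission
  imports Defs "HOL-Library.FuncSet" "HOL-Number_Theory.Cong"
begin

section \<open>Pure periods\<close>

text \<open>The obstacle is that (UP 2) speaks of an unknown set S with an unknown period. The
  operator tau eliminates S. If the words accepted from q, least significant digit first, have the
  values S, then tau q is meant to accept S - 1, and the two identities of the overview become
  arithmetic: Delta(S - a, 0) = Delta(S, a), and Delta(S, 0) - 1 = Delta(S - b, 0), the carry n b +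
  b = (n + 1) b. Both mention states only, and walking along q, tau q, ..., tau^b q tests them for
  one q in b rounds; this is the source of the bound O(b n). Coprimality with b is not tested at
  all: it follows from the carry identity, since reading 0 permutes tau(K) and conjugates tau^b to
  tau there. Injectivity of tau is demanded on tau(K) and not on K because a type-two state and the
  state it is embedded into have the same image under tau. The equivalence with (UP 2)-(UP 4) is
  proved under (UP 0); if (UP 0) fails, the program and the conjunction both say no. As the machine
  cannot multiply, row addresses are collected during one walk through the table and stored.\<close>

lemma bij_betw_funpow_eq_id:
  assumes "finite I" "bij_betw f I I"
  shows "\<exists>m>0. \<forall>s\<in>I. (f ^^ m) s = s"
proof -
  \<comment> \<open>The pigeonhole principle is applied to whole restricted iterates rather than to
    orbits of points, so that a single exponent serves all of \<open>I\<close>; injectivity then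
    cancels the smaller power.\<close>
  let ?r = "\<lambda>k. restrict (f ^^ k) I"
  have bij: "bij_betw (f ^^ k) I I" for k
    using assms(2) by (rule bij_betw_funpow)
  have "range ?r \<subseteq> I \<rightarrow>\<^sub>E I"
    using bij bij_betwE by fastforce
  then have "finite (range ?r)"
    using finite_PiE[OF assms(1), of "\<lambda>_. I"] assms(1) finite_subset by blast
  then have "\<not> inj ?r"
    using finite_imageD by blast
  then obtain i j where ij: "i < j" "?r i = ?r j"
    unfolding inj_def by (metis linorder_neqE_nat)
  have "(f ^^ (j - i)) s = s" if "s \<in> I" for s
  proof -
    have in_I: "(f ^^ (j - i)) s \<in> I" using bij that bij_betwE by blast
    have "(f ^^ i) ((f ^^ (j - i)) s) = (f ^^ j) s"
      using funpow_add[of i "j - i" f] ij(1) by (metis comp_apply le_add_diff_inverse less_imp_le)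
    also have "\<dots> = (f ^^ i) s"
      using fun_cong[OF ij(2), of s] that by simp
    finally show ?thesis
      using bij[of i] in_I that by (auto simp: bij_betw_def inj_on_def)
  qed
  then show ?thesis using ij(1) by (intro exI[of _ "j - i"]) auto
qed

text \<open>Invariance under translation in both directions is the form in which periods are used
  below; the residue set is recovered as the part of \<open>S\<close> below
  \<open>p\<close>.\<close>

lemma has_pure_period_iff:
  "has_pure_period S p \<longleftrightarrow> 1 \<le> p \<and> (\<forall>n. n + p \<in> S \<longleftrightarrow> n \<in> S)"
proof (intro iffI conjI)
  assume "has_pure_period S p"
  then obtain R where p: "1 \<le> p" and R: "R \<subseteq> {..<p}" "S = {r + p * k | r k. r \<in> R}"
    unfolding has_pure_period_def by blast
  have mem: "n \<in> S \<longleftrightarrow> n mod p \<in> R" for n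
  proof
    assume "n \<in> S"
    then obtain r k where "r \<in> R" "n = r + p * k" using R(2) by blast
    moreover have "r < p" using R(1) \<open>r \<in> R\<close> by blast
    ultimately show "n mod p \<in> R" by simp
  next
    assume "n mod p \<in> R"
    moreover have "n = n mod p + p * (n div p)" by simp
    ultimately show "n \<in> S" using R(2) by blast
  qed
  show "1 \<le> p" "\<forall>n. n + p \<in> S \<longleftrightarrow> n \<in> S" using p mem by simp_all
next
  assume *: "1 \<le> p \<and> (\<forall>n. n + p \<in> S \<longleftrightarrow> n \<in> S)"
  have shift: "n + p * k \<in> S \<longleftrightarrow> n \<in> S" for n k
  proof (induction k)
    case (Suc k)
    have "n + p * Suc k = n + p * k + p" by simp
    then show ?case using Suc * by metis
  qed simp
  have "S = {r + p * k | r k. r \<in> S \<inter> {..<p}}"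
  proof (intro set_eqI iffI)
    fix n assume "n \<in> S"
    then have "n mod p \<in> S \<inter> {..<p}" using shift[of "n mod p" "n div p"] * by simp
    moreover have "n = n mod p + p * (n div p)" by simp
    ultimately show "n \<in> {r + p * k | r k. r \<in> S \<inter> {..<p}}" by blast
  next
    fix n assume "n \<in> {r + p * k | r k. r \<in> S \<inter> {..<p}}"
    then show "n \<in> S" using shift by blast
  qed
  moreover have "S \<inter> {..<p} \<subseteq> {..<p}" by simp
  ultimately show "has_pure_period S p"
    unfolding has_pure_period_def using *
    by (intro conjI exI[of _ "S \<inter> {..<p}"]) (assumption | blast)+
qed

lemma pure_period_add_mult:
  assumes "has_pure_period S p"
  shows "n + p * k \<in> S \<longleftrightarrow> n \<in> S"
proof (induction k)
  case (Suc k)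
  have "n + p * Suc k = n + p * k + p" by simp
  then show ?case using Suc assms unfolding has_pure_period_iff by metis
qed simp

lemma has_pure_period_period:
  "has_pure_period S p \<Longrightarrow> has_pure_period S (period S)"
  unfolding period_def by (rule LeastI)

text \<open>A non-zero remainder of \<open>d\<close> modulo the least period would be a smaller
  period. This lets the least period inherit coprimality with \<open>b\<close> from the order of
  tau.\<close>

lemma period_dvd:
  assumes "has_pure_period S d"
  shows "period S dvd d"
proof (rule ccontr)
  let ?p = "period S"
  assume "\<not> ?p dvd d"
  then have r: "1 \<le> d mod ?p" by (simp add: dvd_eq_mod_eq_0 Suc_le_eq)
  have per: "has_pure_period S ?p" using has_pure_period_period assms .
  then have "d mod ?p < ?p" by (simp add: has_pure_period_iff)
  moreover have "has_pure_period S (d mod ?p)"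
    unfolding has_pure_period_iff
  proof (intro conjI allI r)
    fix n
    have "n + d mod ?p \<in> S \<longleftrightarrow> n + d mod ?p + ?p * (d div ?p) \<in> S"
      by (rule pure_period_add_mult[OF per, symmetric])
    also have "n + d mod ?p + ?p * (d div ?p) = n + d" by (simp add: add.assoc)
    also have "n + d \<in> S \<longleftrightarrow> n \<in> S" using assms by (simp add: has_pure_period_iff)
    finally show "n + d mod ?p \<in> S \<longleftrightarrow> n \<in> S" .
  qed
  ultimately show False using not_less_Least unfolding period_def by blast
qed

text \<open>Replacing n by n + p moves n b + a by p b, a multiple of \<open>p\<close>. The period
  \<open>p\<close> is kept, though it may cease to be the least one; a common period for all states
  is what matters later.\<close>

lemma has_pure_period_Delta:
  assumes "has_pure_period S p"
  shows "has_pure_period (Delta b S a) p"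
proof -
  have "(n + p) * b + a = n * b + a + p * b" for n by (simp add: algebra_simps)
  moreover have "n * b + a + p * b \<in> S \<longleftrightarrow> n * b + a \<in> S" for n
    by (rule pure_period_add_mult[OF assms])
  ultimately show ?thesis
    using assms unfolding has_pure_period_iff Delta_def mem_Collect_eq by metis
qed

lemma has_pure_period_Delta_word:
  assumes "has_pure_period S p"
  shows "has_pure_period (Delta_word b S u) p"
  using assms unfolding Delta_word_def
  by (induction u arbitrary: S) (auto intro: has_pure_period_Delta)

text \<open>The counterpart of \<open>tau ^^ k\<close> on sets: X - k, cut off at 0.\<close>

definition shift :: "nat \<Rightarrow> nat set \<Rightarrow> nat set" where
  "shift k X = {n. n + k \<in> X}"

lemma has_pure_period_shift: "has_pure_period X p \<Longrightarrow> has_pure_period (shift k X) p"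
  unfolding has_pure_period_iff shift_def mem_Collect_eq
  by (metis add.assoc add.commute)

text \<open>The shift forgets the elements below \<open>k\<close>, but periodicity repeats each of
  them at distance p k, which is at least \<open>k\<close>.\<close>

lemma shift_inject:
  assumes "has_pure_period X p" "has_pure_period Y p" "shift k X = shift k Y"
  shows "X = Y"
proof (rule set_eqI)
  fix n
  have "1 * k \<le> p * k" using assms(1) unfolding has_pure_period_iff by (intro mult_le_mono1) simp
  then have "n + p * k = n + (p * k - k) + k" by linarith
  then have "n + p * k \<in> X \<longleftrightarrow> n + p * k \<in> Y"
    using assms(3) unfolding shift_def by (metis mem_Collect_eq)
  then show "n \<in> X \<longleftrightarrow> n \<in> Y"
    using pure_period_add_mult assms(1,2) by blast
qed

text \<open>With c an inverse of \<open>b\<close> modulo \<open>p\<close>, membership of n can be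
  read off at c n, because c n b is congruent to n. Coprimality supplies c.\<close>

lemma Delta_0_inject:
  assumes "has_pure_period X p" "has_pure_period Y p" "coprime p b" "Delta b X 0 = Delta b Y 0"
  shows "X = Y"
proof -
  have p: "1 \<le> p" using assms(1) by (simp add: has_pure_period_iff)
  obtain c where c: "[b * c = 1] (mod p)"
    using cong_solve_coprime_nat[of b p] assms(3) by (auto simp: coprime_commute)
  have *: "n \<in> Z \<longleftrightarrow> c * n \<in> Delta b Z 0" if "has_pure_period Z p" for Z n
  proof -
    have "[c * n * b = n] (mod p)"
      using cong_scalar_right[OF c, of n] by (simp add: ac_simps)
    then have "(c * n * b) mod p = n mod p" by (simp add: cong_def)
    moreover have "m \<in> Z \<longleftrightarrow> m mod p \<in> Z" for m
      using pure_period_add_mult[OF that, of "m mod p" "m div p"] by simp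
    ultimately show ?thesis unfolding Delta_def by (metis add_0_right mem_Collect_eq)
  qed
  show ?thesis using *[OF assms(1)] *[OF assms(2)] assms(4) by auto
qed

section \<open>Strongly connected components\<close>

locale dfa =
  fixes A :: "'q automaton" and b :: nat
  assumes automaton: "automaton A" and complete: "complete A" and base: "base A = b" and b: "1 < b"
begin

definition d :: "'q \<Rightarrow> nat \<Rightarrow> 'q" where
  "d q a = the (delta A q a)"

lemma delta_eq: "delta A q a = (if q \<in> states A \<and> a < b then Some (d q a) else None)"
proof (cases "delta A q a")
  case None
  then show ?thesis using complete base unfolding complete_def by metis
next
  case (Some t)
  then show ?thesis using automaton base unfolding automaton_def d_def by auto
qed

lemma d_in_states [simp]: "q \<in> states A \<Longrightarrow> a < b \<Longrightarrow> d q a \<in> states A"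
  using automaton delta_eq[of q a] unfolding automaton_def by auto

lemma finite_states: "finite (states A)"
  using automaton by (simp add: automaton_def)

abbreviation E where "E \<equiv> edges A"

lemma edges_iff: "(s, t) \<in> E \<longleftrightarrow> s \<in> states A \<and> (\<exists>a<b. t = d s a)"
  by (auto simp: edges_def delta_eq split: if_splits)

lemma edge_in_states: "(s, t) \<in> E \<Longrightarrow> s \<in> states A \<and> t \<in> states A"
  by (auto simp: edges_iff)

lemma rtrancl_in_states: "(s, t) \<in> E\<^sup>* \<Longrightarrow> s \<in> states A \<Longrightarrow> t \<in> states A"
  by (induction rule: rtrancl_induct) (auto dest: edge_in_states)

lemma trancl_in_states: "(s, t) \<in> E\<^sup>+ \<Longrightarrow> s \<in> states A \<and> t \<in> states A"
  by (induction rule: trancl_induct) (auto dest: edge_in_states)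

definition scc :: "'q \<Rightarrow> 'q set" where
  "scc q = {t. (q, t) \<in> E\<^sup>* \<and> (t, q) \<in> E\<^sup>*}"

lemma scc_eq_image: "q \<in> states A \<Longrightarrow> mutually_reachable A `` {q} = scc q"
  by (auto simp: mutually_reachable_def scc_def dest: rtrancl_in_states)

lemma sccs_iff: "C \<in> sccs A \<longleftrightarrow> (\<exists>q\<in>states A. C = scc q)"
  unfolding sccs_def quotient_def using scc_eq_image by auto

lemma scc_refl [simp]: "q \<in> scc q"
  by (simp add: scc_def)

lemma scc_eqI: "t \<in> scc q \<Longrightarrow> scc t = scc q"
  by (auto simp: scc_def dest: rtrancl_trans)

lemma scc_in_sccs [simp]: "q \<in> states A \<Longrightarrow> scc q \<in> sccs A"
  by (auto simp: sccs_iff)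

lemma sccs_mem: "C \<in> sccs A \<Longrightarrow> q \<in> C \<Longrightarrow> C = scc q \<and> q \<in> states A"
  unfolding sccs_iff by (metis (no_types, lifting) mem_Collect_eq rtrancl_in_states scc_def scc_eqI)

lemma sccs_subset: "C \<in> sccs A \<Longrightarrow> C \<subseteq> states A"
  by (blast dest: sccs_mem)

lemma sccs_nonempty: "C \<in> sccs A \<Longrightarrow> \<exists>q. q \<in> C"
  using scc_refl sccs_iff by blast

text \<open>By \<open>nontrivial_subset_cyclic\<close> and \<open>cyclic_scc_nontrivial\<close>,
  this is the union of the non-trivial components.\<close>

definition cyclic :: "'q set" where
  "cyclic = {q. (q, q) \<in> E\<^sup>+}"

lemma nontrivial_subset_cyclic:
  assumes "C \<in> sccs A" "\<not> trivial_scc A C"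
  shows "C \<subseteq> cyclic"
proof
  fix q assume q: "q \<in> C"
  show "q \<in> cyclic"
  proof (cases "C = {q}")
    case True
    then show ?thesis using assms by (auto simp: trivial_scc_def cyclic_def)
  next
    case False
    then obtain t where t: "t \<in> C" "t \<noteq> q" using q by blast
    have C: "C = scc q" using sccs_mem[OF assms(1) q] by simp
    have "(q, t) \<in> E\<^sup>*" "(t, q) \<in> E\<^sup>*" using t(1) by (auto simp: scc_def C)
    then have "(q, t) \<in> E\<^sup>+" using t(2) by (metis rtranclD)
    then have "(q, q) \<in> E\<^sup>+" using \<open>(t, q) \<in> E\<^sup>*\<close> by simp
    then show ?thesis by (simp add: cyclic_def)
  qed
qed

lemma cyclic_scc_nontrivial: "q \<in> cyclic \<Longrightarrow> scc q \<in> sccs A \<and> \<not> trivial_scc A (scc q)"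
  using scc_refl[of q] unfolding trivial_scc_def cyclic_def
  by (metis mem_Collect_eq scc_in_sccs singletonD trancl_in_states)

lemma cyclic_successor:
  assumes "q \<in> cyclic" obtains a where "a < b" "d q a \<in> scc q"
proof -
  obtain t where "(q, t) \<in> E" "(t, q) \<in> E\<^sup>*"
    using assms unfolding cyclic_def by (meson mem_Collect_eq tranclD)
  moreover from this have "t \<in> scc q" unfolding scc_def by blast
  ultimately show ?thesis using that unfolding edges_iff by blast
qed

lemma cyclic_predecessor:
  assumes "q \<in> cyclic" obtains a t where "t \<in> scc q" "a < b" "d t a = q"
proof -
  obtain t where "(t, q) \<in> E" "(q, t) \<in> E\<^sup>*"
    using assms unfolding cyclic_def by (meson mem_Collect_eq tranclD2)
  moreover from this have "t \<in> scc q" unfolding scc_def by blast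
  ultimately show ?thesis using that unfolding edges_iff by blast
qed

lemma internal_transitions_iff:
  assumes "C \<in> sccs A"
  shows "internal_transitions A C = {(s, a, d s a) | s a. s \<in> C \<and> a < b \<and> d s a \<in> C}"
  using sccs_mem[OF assms] by (auto simp: internal_transitions_def delta_eq split: if_splits)

text \<open>A path between two members of a component never leaves the component, so here each of
  its steps reads 0.\<close>

lemma zero_circuit_eq_orbit:
  assumes C: "C \<in> sccs A" "\<not> trivial_scc A C"
    and only0: "\<forall>s\<in>C. \<forall>a<b. d s a \<in> C \<longrightarrow> a = 0" and q: "q \<in> C"
  shows "C = range (\<lambda>k. ((\<lambda>s. d s 0) ^^ k) q)"
proof -
  have z: "d s 0 \<in> C" if "s \<in> C" for s
    using that cyclic_successor[of s] nontrivial_subset_cyclic[OF C] sccs_mem[OF C(1) that] only0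
    by (metis subsetD)
  have in_C: "((\<lambda>s. d s 0) ^^ k) q \<in> C" for k
    by (induction k) (auto simp: z q)
  have "t \<in> range (\<lambda>k. ((\<lambda>s. d s 0) ^^ k) q)" if "t \<in> C" for t
  proof -
    have "(q, t) \<in> E\<^sup>*" using sccs_mem[OF C(1) q] that by (auto simp: scc_def)
    then show ?thesis using that
    proof (induction rule: rtrancl_induct)
      case base
      have "q = ((\<lambda>s. d s 0) ^^ 0) q" by simp
      then show ?case by blast
    next
      case (step y t)
      have t: "t \<in> scc q" using step.prems sccs_mem[OF C(1) q] by simp
      have "y \<in> scc q"
        using step.hyps t unfolding scc_def by (auto intro: converse_rtrancl_into_rtrancl)
      then have y: "y \<in> C" using sccs_mem[OF C(1) q] by simp
      then obtain k where "y = ((\<lambda>s. d s 0) ^^ k) q" using step.IH by blast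
      moreover have "t = d y 0" using step y only0 by (metis edges_iff)
      ultimately have "t = ((\<lambda>s. d s 0) ^^ Suc k) q" by simp
      then show ?case by blast
    qed
  qed
  then show ?thesis using in_C by blast
qed

text \<open>That the component is a simple circuit comes for free: determinism gives each state at
  most one 0-transition, the orbit of \<open>q\<close> under 0 exhausts \<open>C\<close>, and
  listing it up to the first return to \<open>q\<close> gives distinct states.\<close>

lemma type_two_iff:
  "type_two A C \<longleftrightarrow>
     C \<in> sccs A \<and> \<not> trivial_scc A C \<and> (\<forall>s\<in>C. \<forall>a<b. d s a \<in> C \<longrightarrow> a = 0)"
proof (intro iffI conjI; (elim conjE)?)
  assume *: "type_two A C"
  then show "C \<in> sccs A" "\<not> trivial_scc A C" by (auto simp: type_two_def)
  then show "\<forall>s\<in>C. \<forall>a<b. d s a \<in> C \<longrightarrow> a = 0"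
    using * internal_transitions_iff[of C] unfolding type_two_def by blast
next
  assume C: "C \<in> sccs A" "\<not> trivial_scc A C"
    and only0: "\<forall>s\<in>C. \<forall>a<b. d s a \<in> C \<longrightarrow> a = 0"
  obtain q where q: "q \<in> C" using sccs_nonempty[OF C(1)] by blast
  let ?z = "\<lambda>s. d s 0"
  have orbit: "C = range (\<lambda>k. (?z ^^ k) s)" if "s \<in> C" for s
    using zero_circuit_eq_orbit[OF C only0 that] .
  have z: "?z s \<in> C" if "s \<in> C" for s
  proof -
    have "(?z ^^ Suc 0) s \<in> range (\<lambda>k. (?z ^^ k) s)" by blast
    then show ?thesis using orbit[OF that] by simp
  qed
  \<comment> \<open>The orbit of the successor of \<open>q\<close> is all of \<open>C\<close> too,
    hence contains \<open>q\<close>.\<close>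
  have "\<exists>k>0. (?z ^^ k) q = q"
  proof -
    have "q \<in> range (\<lambda>k. (?z ^^ k) (?z q))" using orbit[OF z[OF q]] q by simp
    then obtain k where "q = (?z ^^ k) (?z q)" by blast
    then have "(?z ^^ Suc k) q = q" by (metis comp_apply funpow_Suc_right)
    then show ?thesis by blast
  qed
  then obtain m where m: "0 < m" "(?z ^^ m) q = q"
    and least: "\<And>k. 0 < k \<Longrightarrow> (?z ^^ k) q = q \<Longrightarrow> m \<le> k"
    using LeastI_ex[of "\<lambda>k. 0 < k \<and> (?z ^^ k) q = q"] Least_le[of "\<lambda>k. 0 < k \<and> (?z ^^ k) q = q"]
    by blast
  let ?xs = "map (\<lambda>i. (?z ^^ i) q) [0..<m]"
  have mod: "(?z ^^ (k mod m)) q = (?z ^^ k) q" for k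
    using m(2) by (rule funpow_mod_eq)
  have set: "set ?xs = C"
  proof -
    have "(?z ^^ k) q \<in> set ?xs" for k
      using m(1) mod[of k] by (auto intro!: image_eqI[of _ _ "k mod m"])
    then show ?thesis using orbit[OF q] by auto
  qed
  \<comment> \<open>A repetition at i < j would bring \<open>q\<close> back after m - j + i < m
    steps.\<close>
  have "(?z ^^ i) q \<noteq> (?z ^^ j) q" if "i < j" "j < m" for i j
  proof
    assume eq: "(?z ^^ i) q = (?z ^^ j) q"
    have "(?z ^^ (m - j + i)) q = (?z ^^ (m - j)) ((?z ^^ j) q)"
      by (simp add: funpow_add eq)
    also have "\<dots> = (?z ^^ (m - j + j)) q" by (simp only: funpow_add comp_apply)
    also have "\<dots> = q" using m that by simp
    finally have "m \<le> m - j + i" using least that by simp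
    then show False using that by simp
  qed
  then have "inj_on (\<lambda>i. (?z ^^ i) q) {0..<m}"
    by (intro linorder_inj_onI') auto
  then have distinct: "distinct ?xs" by (simp add: distinct_map)
  have nth: "?xs ! (Suc i mod m) = ?z (?xs ! i)" if "i < m" for i
    using that m(1) mod[of "Suc i"] by simp
  have "internal_transitions A C = {(?xs ! i, 0, ?xs ! (Suc i mod length ?xs)) | i. i < length ?xs}"
  proof -
    have only0': "\<And>s a. s \<in> C \<Longrightarrow> a < b \<Longrightarrow> d s a \<in> C \<Longrightarrow> a = 0" using only0 by blast
    have "internal_transitions A C = {(s, 0, ?z s) | s. s \<in> set ?xs}"
      unfolding internal_transitions_iff[OF C(1)] set
    proof (rule Collect_cong)
      fix u :: "'q \<times> nat \<times> 'q"
      show "(\<exists>s a. u = (s, a, d s a) \<and> s \<in> C \<and> a < b \<and> d s a \<in> C) \<longleftrightarrow> (\<exists>s. u = (s, 0, ?z s) \<and> s \<in> C)"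
        using b by (cases u) (auto dest: only0' intro: z)
    qed
    also have "\<dots> = {(?xs ! i, 0, ?z (?xs ! i)) | i. i < m}"
      unfolding set_conv_nth by auto
    also have "\<dots> = {(?xs ! i, 0, ?xs ! (Suc i mod length ?xs)) | i. i < length ?xs}"
      using nth by (auto simp del: nth_map)
    finally show ?thesis .
  qed
  moreover have "?xs \<noteq> []" using m(1) by simp
  ultimately show "type_two A C" using C distinct set unfolding type_two_def by blast
qed

lemma type_one_iff:
  "type_one A C \<longleftrightarrow>
     C \<in> sccs A \<and> \<not> trivial_scc A C \<and> (\<exists>s\<in>C. \<exists>a<b. d s a \<in> C \<and> a \<noteq> 0)"
  unfolding type_one_def type_two_iff by blast

text \<open>Each state of the component has an internal predecessor, necessarily by 0; so reading 0
  is onto, and finiteness does the rest.\<close>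

lemma type_two_zero:
  assumes "type_two A C"
  shows "bij_betw (\<lambda>s. d s 0) C C"
proof -
  have C: "C \<in> sccs A" "\<not> trivial_scc A C" "\<forall>s\<in>C. \<forall>a<b. d s a \<in> C \<longrightarrow> a = 0"
    using assms type_two_iff by blast+
  have "finite C"
    using sccs_subset[OF C(1)] finite_states by (rule finite_subset)
  have "d s 0 \<in> C" if "s \<in> C" for s
    using that cyclic_successor[of s] nontrivial_subset_cyclic[OF C(1,2)] sccs_mem[OF C(1) that] C(3)
    by (metis subsetD)
  moreover have "s \<in> (\<lambda>s. d s 0) ` C" if "s \<in> C" for s
    using that cyclic_predecessor[of s] nontrivial_subset_cyclic[OF C(1,2)] sccs_mem[OF C(1) that] C(3)
    by (metis subsetD image_eqI)
  ultimately have "(\<lambda>s. d s 0) ` C = C" by blast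
  then show ?thesis using \<open>finite C\<close> finite_surj_inj[of C] by (metis bij_betw_def order_refl)
qed

text \<open>Completeness makes all transitions exist, which allows passing from the partial
  \<open>delta\<close> to the total \<open>d\<close>.\<close>

lemma embedded_iff:
  assumes "C \<subseteq> states A" "D \<subseteq> states A"
  shows "embedded A C D \<longleftrightarrow>
    (\<exists>f. f ` (C \<union> D) \<subseteq> D \<and> (\<forall>s\<in>D. f s = s) \<and>
      (\<forall>s\<in>C \<union> D. \<forall>a<b. d s a \<in> C \<union> D \<longrightarrow> d (f s) a = f (d s a)))"
  unfolding embedded_def base
proof (rule ex_cong1, rule conj_cong[OF refl], rule conj_cong[OF refl])
  fix f assume f: "f ` (C \<union> D) \<subseteq> D"
  have Q: "s \<in> states A" "f s \<in> states A" if "s \<in> C \<union> D" for s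
    using that f assms by auto
  have "(\<forall>t\<in>C \<union> D. delta A s a = Some t \<longrightarrow> delta A (f s) a = Some (f t)) \<longleftrightarrow>
      (d s a \<in> C \<union> D \<longrightarrow> d (f s) a = f (d s a))" if "s \<in> C \<union> D" "a < b" for s a
    using Q[OF that(1)] that(2) by (auto simp: delta_eq)
  moreover have "delta A s a \<noteq> None \<and> delta A (f s) a \<noteq> None" if "s \<in> C" "a < b" for s a
    using Q[of s] that by (simp add: delta_eq)
  ultimately show "((\<forall>s\<in>C. \<forall>a<b. (delta A s a \<noteq> None) = (delta A (f s) a \<noteq> None)) \<and>
      (\<forall>s\<in>C \<union> D. \<forall>a<b. \<forall>t\<in>C \<union> D. delta A s a = Some t \<longrightarrow> delta A (f s) a = Some (f t))) =
      (\<forall>s\<in>C \<union> D. \<forall>a<b. d s a \<in> C \<union> D \<longrightarrow> d (f s) a = f (d s a))"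
    by simp
qed

lemma descendants_iff:
  assumes "C \<in> sccs A"
  shows "descendants A C = {scc (d s a) | s a. s \<in> C \<and> a < b \<and> d s a \<notin> C}"
proof (intro set_eqI iffI)
  fix X assume "X \<in> descendants A C"
  then obtain y a x where X: "X \<in> sccs A" "X \<noteq> C" "y \<in> C" "x \<in> X" "delta A y a = Some x"
    unfolding descendants_def component_graph_def by blast
  then have "a < b" "x = d y a" by (auto simp: delta_eq split: if_splits)
  moreover have "X = scc x" using sccs_mem X by blast
  moreover have "x \<notin> C" using sccs_mem[OF assms, of x] sccs_mem[OF X(1), of x] X by blast
  ultimately show "X \<in> {scc (d s a) | s a. s \<in> C \<and> a < b \<and> d s a \<notin> C}" using X by blast
next
  fix X assume "X \<in> {scc (d s a) | s a. s \<in> C \<and> a < b \<and> d s a \<notin> C}"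
  then obtain s a where s: "X = scc (d s a)" "s \<in> C" "a < b" "d s a \<notin> C" by blast
  have Q: "s \<in> states A" using sccs_mem[OF assms] s by blast
  have "X \<in> sccs A" "X \<noteq> C" using s Q scc_refl[of "d s a"] by auto
  moreover have "delta A s a = Some (d s a)" using Q s by (simp add: delta_eq)
  ultimately show "X \<in> descendants A C"
    unfolding descendants_def component_graph_def using s assms scc_refl by blast
qed

end

section \<open>Coherent kernels\<close>

text \<open>The states reachable from a circuit have the properties required of \<open>K\<close> here.\<close>

locale kernel = dfa A b for A :: "'q automaton" and b +
  fixes K :: "'q set"
  assumes K_sub: "K \<subseteq> states A"
    and K_closed: "q \<in> K \<Longrightarrow> a < b \<Longrightarrow> d q a \<in> K"
    and K_pred: "q \<in> K \<Longrightarrow> \<exists>p\<in>K. \<exists>a<b. d p a = q"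
    and cyclic_K: "cyclic \<subseteq> K"
begin

definition zero :: "'q \<Rightarrow> 'q" where
  "zero q = d q 0"

text \<open>
  If \<open>S\<close> is the set of numbers accepted from \<open>q\<close>, then \<open>tau q\<close> should accept \<open>S - 1\<close>:
  reading the digit 1 from \<open>q\<close> must be the same as reading 0 from \<open>tau q\<close>.
\<close>

definition tau :: "'q \<Rightarrow> 'q" where
  "tau q = inv_into K zero (d q 1)"

text \<open>The second clause is reading a digit after subtracting it, the third is the carry into
  the next digit. All clauses are finite checks, of cost \<open>b\<close> per state.\<close>

definition coherent :: bool where
  "coherent \<longleftrightarrow>
     inj_on zero K \<and>
     (\<forall>q\<in>K. \<forall>a<b. zero ((tau ^^ a) q) = d q a) \<and>
     (\<forall>q\<in>K. tau (zero q) = zero ((tau ^^ b) q)) \<and>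
     inj_on tau (tau ` K)"

lemma finite_K: "finite K"
  using K_sub finite_states by (rule finite_subset)

lemma zero_K [simp]: "q \<in> K \<Longrightarrow> zero q \<in> K"
  using K_closed b by (simp add: zero_def)

end

section \<open>Coherence implies (UP 2)-(UP 4)\<close>

locale coherent_kernel = kernel A b K for A :: "'q automaton" and b K +
  assumes coherent: coherent
begin

lemma inj_zero: "inj_on zero K"
  and zero_tau_pow: "q \<in> K \<Longrightarrow> a < b \<Longrightarrow> zero ((tau ^^ a) q) = d q a"
  and tau_zero: "q \<in> K \<Longrightarrow> tau (zero q) = zero ((tau ^^ b) q)"
  and inj_tau: "inj_on tau (tau ` K)"
  using coherent by (auto simp: coherent_def)

lemma zero_image: "zero ` K = K"
  using inj_zero finite_K by (intro endo_inj_surj) auto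

lemma tau_K [simp]: "q \<in> K \<Longrightarrow> tau q \<in> K"
  using K_closed[of q 1] b zero_image unfolding tau_def by (metis inv_into_into)

lemma tau_pow_K [simp]: "q \<in> K \<Longrightarrow> (tau ^^ k) q \<in> K"
  by (induction k) auto

text \<open>Iterated carry: subtracting k after reading 0 amounts to subtracting b k before it.
  Combined with \<open>zero_tau_pow\<close> it produces the numbers n b + a in the definition of
  \<open>Delta\<close>.\<close>

lemma tau_pow_zero: "q \<in> K \<Longrightarrow> (tau ^^ k) (zero q) = zero ((tau ^^ (b * k)) q)"
proof (induction k)
  case (Suc k)
  have "(tau ^^ Suc k) (zero q) = tau (zero ((tau ^^ (b * k)) q))" using Suc by simp
  also have "\<dots> = zero ((tau ^^ b) ((tau ^^ (b * k)) q))" using Suc.prems tau_zero by simp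
  also have "\<dots> = zero ((tau ^^ (b * Suc k)) q)" by (simp add: funpow_add)
  finally show ?case .
qed simp

text \<open>The states on which \<open>tau\<close> is periodic; they form the type-one components.\<close>

definition I where "I = tau ` K"

lemma I_sub: "I \<subseteq> K"
  by (auto simp: I_def)

lemma I_K: "q \<in> I \<Longrightarrow> q \<in> K"
  using I_sub by blast

lemma finite_I: "finite I"
  using I_sub finite_K by (rule finite_subset)

lemma bij_tau: "bij_betw tau I I"
proof -
  have "tau ` I \<subseteq> I" by (auto simp: I_def)
  moreover have inj: "inj_on tau I" using inj_tau by (simp add: I_def)
  ultimately have "tau ` I = I" using finite_I by (intro endo_inj_surj)
  then show ?thesis using inj by (simp add: bij_betw_def)
qed

lemma bij_tau_pow: "bij_betw (tau ^^ k) I I"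
  using bij_tau by (rule bij_betw_funpow)

lemma tau_pow_I: "q \<in> I \<Longrightarrow> (tau ^^ k) q \<in> I"
  using bij_tau_pow bij_betwE by blast

lemma tau_pow_Suc_in_I: "q \<in> K \<Longrightarrow> 0 < k \<Longrightarrow> (tau ^^ k) q \<in> I"
  using tau_pow_I[of "tau q" "k - 1"] by (cases k) (auto simp: I_def funpow_swap1)

text \<open>As tau permutes \<open>I\<close>, q is \<open>(tau ^^ b) r\<close> for some r in
  \<open>I\<close>, and the carry identity exhibits \<open>zero q\<close> as an image under
  tau.\<close>

lemma zero_I: "q \<in> I \<Longrightarrow> zero q \<in> I"
proof -
  assume "q \<in> I"
  then obtain r where r: "r \<in> I" "q = (tau ^^ b) r"
    using bij_tau_pow[of b] unfolding bij_betw_def by blast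
  then have "zero q = tau (zero r)" using tau_zero I_K by simp
  then show "zero q \<in> I" using r I_K by (simp add: I_def)
qed

text \<open>Reading a is a steps of tau followed by 0, and one step of tau already leads into
  \<open>I\<close>. In particular every positive digit leads from \<open>K\<close> into
  \<open>I\<close>.\<close>

lemma d_in_I:
  assumes "q \<in> K" "a < b" "0 < a \<or> q \<in> I"
  shows "d q a \<in> I"
proof -
  have "(tau ^^ a) q \<in> I" using assms tau_pow_I tau_pow_Suc_in_I by blast
  then show ?thesis using zero_I zero_tau_pow[OF assms(1,2)] by metis
qed

lemma bij_d:
  assumes "a < b" shows "bij_betw (\<lambda>q. d q a) I I"
proof -
  have "inj_on zero I" using inj_zero I_sub by (rule inj_on_subset)
  then have "zero ` I = I" using finite_I zero_I by (intro endo_inj_surj) auto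
  then have "bij_betw zero I I" using \<open>inj_on zero I\<close> by (simp add: bij_betw_def)
  then have "bij_betw (zero \<circ> (tau ^^ a)) I I" using bij_tau_pow bij_betw_trans by blast
  then show ?thesis
    using zero_tau_pow[OF I_K assms] by (subst bij_betw_cong[of _ _ "zero \<circ> (tau ^^ a)"]) auto
qed

text \<open>The way back repeats the same letter: it permutes \<open>I\<close>, so some power of it
  fixes \<open>q\<close>. Hence reachability is symmetric on \<open>I\<close>.\<close>

lemma edge_I:
  assumes "q \<in> I" "(q, t) \<in> E"
  shows "t \<in> I" "(t, q) \<in> E\<^sup>*"
proof -
  obtain a where a: "a < b" "t = d q a" using assms by (auto simp: edges_iff)
  let ?g = "\<lambda>q. d q a"
  obtain m where m: "0 < m" "(?g ^^ m) q = q"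
    using bij_betw_funpow_eq_id[OF finite_I bij_d[OF a(1)]] assms(1) by blast
  show t: "t \<in> I" using d_in_I[OF I_K[OF assms(1)] a(1)] assms(1) a by simp
  have "(t, (?g ^^ k) t) \<in> E\<^sup>* \<and> (?g ^^ k) t \<in> I" for k
  proof (induction k)
    case (Suc k)
    then have "((?g ^^ k) t, (?g ^^ Suc k) t) \<in> E"
      using a(1) I_K K_sub unfolding edges_iff by auto
    moreover have "(?g ^^ Suc k) t \<in> I"
      using Suc d_in_I[of "(?g ^^ k) t" a] a(1) I_K by auto
    ultimately show ?case using Suc rtrancl_into_rtrancl[of t "(?g ^^ k) t" E] by blast
  qed (use t in simp)
  moreover have "(?g ^^ (m - 1)) t = q"
    using m unfolding a(2) by (cases m) (simp_all add: funpow_Suc_right del: funpow.simps)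
  ultimately show "(t, q) \<in> E\<^sup>*" by metis
qed

lemma rtrancl_I:
  assumes "(q, t) \<in> E\<^sup>*" "q \<in> I"
  shows "t \<in> I \<and> (t, q) \<in> E\<^sup>*"
  using assms
proof (induction rule: rtrancl_induct)
  case (step y t)
  then show ?case using edge_I[of y t] by (meson rtrancl_trans)
qed simp

lemma scc_I:
  assumes "q \<in> I"
  shows "scc q = E\<^sup>* `` {q}" "scc q \<subseteq> I"
  using rtrancl_I[OF _ assms] by (auto simp: scc_def)

lemma scc_I_closed:
  assumes "q \<in> I" "s \<in> scc q" "a < b"
  shows "d s a \<in> scc q"
proof -
  have s: "s \<in> I" using scc_I assms by blast
  then have "(s, d s a) \<in> E" using assms(3) I_K K_sub by (auto simp: edges_iff)
  moreover have "(q, s) \<in> E\<^sup>*" using assms(2) by (simp add: scc_def)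
  ultimately show ?thesis using scc_I(1)[OF assms(1)] by auto
qed

lemma type_one_scc_I:
  assumes "q \<in> I"
  shows "type_one A (scc q)"
  unfolding type_one_iff
proof (intro conjI)
  have Q: "q \<in> states A" using assms I_K K_sub by blast
  then show "scc q \<in> sccs A" by simp
  show "\<exists>s\<in>scc q. \<exists>a<b. d s a \<in> scc q \<and> a \<noteq> 0"
    using scc_I_closed[OF assms scc_refl b] b by (intro bexI[of _ q] exI[of _ 1]) auto
  have "(q, d q 1) \<in> E" using Q b by (auto simp: edges_iff)
  then have "(q, q) \<in> E\<^sup>+" using edge_I(2)[OF assms] by (metis rtrancl_into_trancl2)
  then show "\<not> trivial_scc A (scc q)" using cyclic_scc_nontrivial by (simp add: cyclic_def)
qed

text \<open>A set of numbers, not of words: n is in S iff 0 is in S - n, and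
  \<open>(tau ^^ n) q\<close> stands for S - n. Under (UP 0) these are the values of the words
  accepted from \<open>q\<close>, least significant digit first.\<close>

definition word_set :: "'q \<Rightarrow> nat set" where
  "word_set q = {n. (tau ^^ n) q \<in> finals A}"

text \<open>
  Reading 0 conjugates \<open>tau ^^ b\<close> to \<open>tau\<close> on \<open>I\<close>, which forces the order of \<open>tau\<close> to be coprime to \<open>b\<close>.
\<close>

lemma tau_order:
  obtains m where "0 < m" "\<forall>s\<in>I. (tau ^^ m) s = s" "coprime m b"
proof -
  let ?P = "\<lambda>m. 0 < m \<and> (\<forall>s\<in>I. (tau ^^ m) s = s)"
  have ex: "\<exists>m. ?P m" using bij_betw_funpow_eq_id[OF finite_I bij_tau] .
  \<comment> \<open>Every s in \<open>I\<close> is \<open>zero r\<close>, and \<open>zero\<close>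
    turns b k steps of tau at r into k steps at s.\<close>
  have *: "(tau ^^ k) s = s" if "\<forall>s\<in>I. (tau ^^ (b * k)) s = s" and s: "s \<in> I" for k s
  proof -
    have "zero ` I = I"
      using inj_on_subset[OF inj_zero I_sub] finite_I zero_I by (intro endo_inj_surj) auto
    then obtain r where r: "r \<in> I" "s = zero r" using s by blast
    then show ?thesis using tau_pow_zero[OF I_K[OF r(1)], of k] that by simp
  qed
  define m where "m = Least ?P"
  have m: "0 < m" "\<forall>s\<in>I. (tau ^^ m) s = s" using LeastI_ex[OF ex] by (simp_all add: m_def)
  define g where "g = gcd m b"
  obtain m' where m': "m = g * m'" unfolding g_def using gcd_dvd1 by (rule dvdE)
  obtain b' where b': "b = g * b'" unfolding g_def using gcd_dvd2 by (rule dvdE)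
  have "(tau ^^ (m * k)) s = s" if "s \<in> I" for k s
    using m that by (induction k) (auto simp: funpow_add)
  \<comment> \<open>This multiple of m acts trivially, so by \<open>*\<close> already m' = m / g
    does; leastness of m forces g = 1.\<close>
  moreover have "b * m' = m * b'" by (simp add: m' b')
  ultimately have "\<forall>s\<in>I. (tau ^^ (b * m')) s = s" by simp
  then have "?P m'" using *[of m'] m m' by auto
  then have "m \<le> m'" unfolding m_def by (rule Least_le)
  moreover have "0 < m'" "0 < g" using m(1) m' by auto
  ultimately have "g = 1" unfolding m' by (cases g) auto
  then have "coprime m b" by (simp add: g_def coprime_iff_gcd_eq_1)
  then show ?thesis using that m by blast
qed

end

text \<open>\<open>separated\<close> is the Myhill-Nerode consequence of minimality. It is an
  assumption here because \<open>minimal\<close> compares with automata over nat only, while the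
  state type is still arbitrary.\<close>

locale atomic_kernel = coherent_kernel A b K for A :: "'q automaton" and b K +
  assumes UP0: "UP0 A"
    and separated: "\<lbrakk>s \<in> states A; t \<in> states A;
      \<And>u. u \<in> lists {..<b} \<Longrightarrow> foldl d s u \<in> finals A \<longleftrightarrow> foldl d t u \<in> finals A\<rbrakk> \<Longrightarrow> s = t"
begin

lemma zero_final: "q \<in> K \<Longrightarrow> zero q \<in> finals A \<longleftrightarrow> q \<in> finals A"
  using UP0 K_sub b unfolding UP0_def zero_def by (auto simp: delta_eq)

text \<open>Moving all powers of tau in front of the digit gives
  \<open>zero ((tau ^^ (n * b + a)) q)\<close>, and (UP 0) lets finality ignore the outer
  \<open>zero\<close>.\<close>

lemma Delta_word_set:
  assumes "q \<in> K" "a < b"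
  shows "Delta b (word_set q) a = word_set (d q a)"
proof -
  have "(tau ^^ n) (d q a) = zero ((tau ^^ (n * b + a)) q)" for n
  proof -
    have "(tau ^^ n) (d q a) = zero ((tau ^^ (b * n)) ((tau ^^ a) q))"
      using assms tau_pow_zero zero_tau_pow by (metis tau_pow_K)
    then show ?thesis by (simp add: funpow_add mult.commute)
  qed
  then show ?thesis using assms zero_final by (simp add: Delta_def word_set_def)
qed

lemma Delta_word_word_set:
  "q \<in> K \<Longrightarrow> u \<in> lists {..<b} \<Longrightarrow> Delta_word b (word_set q) u = word_set (foldl d q u)"
  unfolding Delta_word_def
  by (induction u arbitrary: q) (auto simp: Delta_word_set intro: K_closed)

text \<open>Acceptance of u can be read off the set, as membership of 0 after the quotients by the
  digits of u; so equal sets mean equivalent states.\<close>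

lemma word_set_inject:
  assumes "s \<in> K" "t \<in> K" "word_set s = word_set t"
  shows "s = t"
proof (rule separated)
  fix u :: "nat list" assume u: "u \<in> lists {..<b}"
  have "foldl d q u \<in> finals A \<longleftrightarrow> 0 \<in> Delta_word b (word_set q) u" if "q \<in> K" for q
    unfolding Delta_word_word_set[OF that u] by (simp add: word_set_def)
  then show "foldl d s u \<in> finals A \<longleftrightarrow> foldl d t u \<in> finals A" using assms by simp
qed (use assms K_sub in auto)

lemma reachable_iff_word:
  assumes "q \<in> K"
  shows "E\<^sup>* `` {q} = {foldl d q u | u. u \<in> lists {..<b}}"
proof (intro set_eqI iffI)
  fix t assume "t \<in> E\<^sup>* `` {q}"
  then have "(q, t) \<in> E\<^sup>*" by simp
  then show "t \<in> {foldl d q u | u. u \<in> lists {..<b}}"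
  proof (induction rule: rtrancl_induct)
    case base
    have "q = foldl d q []" by simp
    then show ?case by blast
  next
    case (step y t)
    then obtain u a where "y = foldl d q u" "u \<in> lists {..<b}" "a < b" "t = d y a"
      by (auto simp: edges_iff)
    then have "t = foldl d q (u @ [a])" "u @ [a] \<in> lists {..<b}" by auto
    then show ?case by blast
  qed
next
  fix t assume "t \<in> {foldl d q u | u. u \<in> lists {..<b}}"
  then obtain u where u: "t = foldl d q u" "u \<in> lists {..<b}" by blast
  have "(q, foldl d q u) \<in> E\<^sup>*" using u(2) assms
  proof (induction u arbitrary: q)
    case (Cons a u)
    then have "(q, d q a) \<in> E" "d q a \<in> K" using K_sub K_closed by (auto simp: edges_iff)
    then show ?case using Cons by (auto intro: converse_rtrancl_into_rtrancl)
  qed simp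
  then show "t \<in> E\<^sup>* `` {q}" using u by simp
qed

text \<open>The isomorphism is \<open>word_set\<close> itself. It is onto because on
  \<open>I\<close> the component of \<open>q\<close> is everything reachable from \<open>q\<close>,
  that is, the states reached by words.\<close>

lemma UP_atomic_scc_I:
  assumes q: "q \<in> I"
  shows "UP_atomic_scc A (scc q)"
proof -
  let ?C = "scc q" and ?S = "word_set q"
  let ?R = "restrict_to A ?C q" and ?U = "atomic_automaton b ?S"
  have C_K: "?C \<subseteq> K" using scc_I(2)[OF q] I_sub by blast
  have C_sccs: "?C \<in> sccs A" using q I_K K_sub by (intro scc_in_sccs) auto
  obtain m where m: "0 < m" "\<forall>s\<in>I. (tau ^^ m) s = s" "coprime m b" by (rule tau_order)
  have "has_pure_period ?S m"
    unfolding has_pure_period_iff word_set_def using m q by (simp add: funpow_add Suc_le_eq)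
  then have per: "purely_periodic ?S" "coprime (period ?S) b"
    using period_dvd m(3) coprime_divisors[of "period ?S" m b b] unfolding purely_periodic_def by auto
  have states_U: "states ?U = word_set ` ?C"
  proof -
    have "states ?U = {Delta_word b ?S u | u. u \<in> lists {..<b}}"
      by (simp add: atomic_automaton_def)
    also have "\<dots> = {word_set (foldl d q u) | u. u \<in> lists {..<b}}"
      using Delta_word_word_set[OF I_K[OF q]] by metis
    also have "\<dots> = word_set ` ?C"
      unfolding scc_I(1)[OF q] reachable_iff_word[OF I_K[OF q]] by blast
    finally show ?thesis .
  qed
  have bij: "bij_betw word_set (states ?R) (states ?U)"
    unfolding states_U restrict_to_def using word_set_inject C_K by (auto simp: bij_betw_def inj_on_def)
  have delta_U: "delta ?U X a = (if X \<in> states ?U \<and> a < b then Some (Delta b X a) else None)" for X a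
    by (simp add: atomic_automaton_def)
  have "(\<exists>t. (s, a, t) \<in> internal_transitions A ?C)" if "s \<in> ?C" "a < b" for s a
    unfolding internal_transitions_iff[OF C_sccs] using scc_I_closed[OF q that] that by blast
  then have delta_R: "delta ?R s a = Some (d s a)" if "s \<in> ?C" "a < b" for s a
    using that C_K K_sub by (auto simp: restrict_to_def delta_eq)
  have "isomorphic ?R ?U"
    unfolding isomorphic_def
  proof (intro conjI exI[of _ word_set] bij ballI allI impI)
    show "base ?R = base ?U" using base by (simp add: restrict_to_def atomic_automaton_def)
    show "word_set (initial ?R) = initial ?U" by (simp add: restrict_to_def atomic_automaton_def)
  next
    fix s a assume "s \<in> states ?R" "a < base ?R"
    then have s: "s \<in> ?C" "a < b" using base by (auto simp: restrict_to_def)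
    then show "delta ?U (word_set s) a = map_option word_set (delta ?R s a)"
      unfolding delta_R[OF s] delta_U states_U using C_K Delta_word_set by auto
  next
    fix s assume "s \<in> states ?R"
    then have s: "s \<in> ?C" by (simp add: restrict_to_def)
    have "finals ?U = {X \<in> states ?U. 0 \<in> X}" by (simp add: atomic_automaton_def)
    then show "s \<in> finals ?R \<longleftrightarrow> word_set s \<in> finals ?U"
      using s unfolding states_U by (simp add: restrict_to_def word_set_def)
  qed
  then have "UP_atomic ?R"
    unfolding UP_atomic_def using per base by (auto simp: restrict_to_def)
  then show ?thesis unfolding UP_atomic_scc_def using scc_refl by blast
qed

text \<open>A component inside \<open>I\<close> is closed under the digit 1, which a type-two
  component is not.\<close>

lemma type_two_disjoint_I:
  assumes "type_two A C" "s \<in> C"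
  shows "s \<in> K" "s \<notin> I"
proof -
  have C: "C \<in> sccs A" "\<not> trivial_scc A C" "\<forall>s\<in>C. \<forall>a<b. d s a \<in> C \<longrightarrow> a = 0"
    using assms(1) unfolding type_two_iff by blast+
  show "s \<in> K" using nontrivial_subset_cyclic[OF C(1,2)] cyclic_K assms(2) by blast
  have "C = scc s" using sccs_mem[OF C(1) assms(2)] by simp
  then show "s \<notin> I" using scc_I_closed[of s s 1] C(3) assms(2) b by fastforce
qed

text \<open>An internal transition with a positive digit ends in \<open>I\<close>, so a type-one
  component is the component of a state of \<open>I\<close>.\<close>

lemma UP2: "UP2 A"
  unfolding UP2_def
proof (intro allI impI)
  fix C assume C: "type_one A C"
  then obtain s a where C': "C \<in> sccs A" "\<not> trivial_scc A C"
    and s: "s \<in> C" "a < b" "d s a \<in> C" "a \<noteq> 0" unfolding type_one_iff by blast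
  have "s \<in> K" using nontrivial_subset_cyclic[OF C'] cyclic_K s by blast
  then have "d s a \<in> I" using d_in_I s by simp
  moreover have "C = scc (d s a)" using sccs_mem[OF C'(1) s(3)] by simp
  ultimately show "UP_atomic_scc A C" using UP_atomic_scc_I by metis
qed

text \<open>The embedding of a type-two component: the \<open>tau\<close>-periodic state with the same image under \<open>tau\<close>.\<close>

definition recurrent :: "'q \<Rightarrow> 'q" where
  "recurrent s = inv_into I tau (tau s)"

lemma recurrent:
  assumes "s \<in> K"
  shows "recurrent s \<in> I" "tau (recurrent s) = tau s"
proof -
  have "tau s \<in> tau ` I" using assms bij_tau by (simp add: bij_betw_def I_def)
  then show "recurrent s \<in> I" "tau (recurrent s) = tau s"
    unfolding recurrent_def by (auto intro: inv_into_into f_inv_into_f)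
qed

text \<open>\<open>s\<close> and \<open>recurrent s\<close> are identified by the first step of tau,
  and a positive digit involves at least one such step.\<close>

lemma d_recurrent:
  assumes "s \<in> K" "a < b" "0 < a"
  shows "d (recurrent s) a = d s a"
proof -
  obtain k where a: "a = Suc k" using assms(3) by (cases a) auto
  have "(tau ^^ a) (recurrent s) = (tau ^^ a) s"
    using recurrent(2)[OF assms(1)] by (simp add: a funpow_Suc_right del: funpow.simps)
  then show ?thesis
    using zero_tau_pow[OF assms(1,2)] zero_tau_pow[OF I_K[OF recurrent(1)[OF assms(1)]] assms(2)] by simp
qed

text \<open>Both sides lie in \<open>I\<close>, where tau is injective, so it suffices to compare
  their images; by the carry identity these only depend on the b-th powers of tau, with b
  positive.\<close>

lemma recurrent_zero:
  assumes "s \<in> K"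
  shows "recurrent (zero s) = zero (recurrent s)"
proof -
  have r: "recurrent s \<in> I" "recurrent (zero s) \<in> I" using recurrent(1) assms by auto
  have "(tau ^^ b) (recurrent s) = (tau ^^ b) s"
    using recurrent(2)[OF assms] b by (cases b) (auto simp: funpow_Suc_right simp del: funpow.simps)
  then have "tau (zero (recurrent s)) = tau (recurrent (zero s))"
    using recurrent(2)[of "zero s"] assms r I_K by (simp add: tau_zero)
  then show ?thesis
    using bij_tau zero_I[OF r(1)] r(2) by (auto simp: bij_betw_def inj_on_def)
qed

text \<open>Since \<open>recurrent\<close> commutes with 0 and \<open>C\<close> is a single 0-orbit,
  all of \<open>C\<close> is sent into one component. The positive digits lead there as well, which
  makes it the unique descendant.\<close>

lemma type_two_embedding:
  assumes "type_two A C"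
  shows "\<exists>D. descendants A C = {D} \<and> type_one A D \<and> embedded A C D"
proof -
  have C: "C \<in> sccs A" "\<not> trivial_scc A C" "\<forall>s\<in>C. \<forall>a<b. d s a \<in> C \<longrightarrow> a = 0"
    using assms unfolding type_two_iff by blast+
  have C_K: "\<And>s. s \<in> C \<Longrightarrow> s \<in> K" and C_I: "\<And>s. s \<in> C \<Longrightarrow> s \<notin> I"
    using type_two_disjoint_I[OF assms] by blast+
  obtain q where q: "q \<in> C" using sccs_nonempty[OF C(1)] by blast
  let ?r = "recurrent q"
  let ?D = "scc ?r"
  have r: "?r \<in> I" using recurrent(1) C_K q by simp
  have D_I: "?D \<subseteq> I" using scc_I(2)[OF r] .
  have D_closed: "d s a \<in> ?D" if "s \<in> ?D" "a < b" for s a using scc_I_closed[OF r] that .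
  have D_scc: "?D \<in> sccs A" using r I_K K_sub by (intro scc_in_sccs) auto
  have zero_C: "zero s \<in> C" if "s \<in> C" for s
    using type_two_zero[OF assms] that bij_betwE unfolding zero_def by blast
  have rec_D: "recurrent s \<in> ?D" if "s \<in> C" for s
  proof -
    have "recurrent ((zero ^^ k) q) \<in> ?D \<and> (zero ^^ k) q \<in> C" for k
    proof (induction k)
      case (Suc k)
      then have "(zero ^^ k) q \<in> K" using C_K by blast
      then have "recurrent ((zero ^^ Suc k) q) = d (recurrent ((zero ^^ k) q)) 0"
        using recurrent_zero[of "(zero ^^ k) q"] zero_def[of "recurrent ((zero ^^ k) q)"] by simp
      then show ?case using Suc D_closed b zero_C by simp
    qed (simp add: q)
    moreover have "s \<in> range (\<lambda>k. (zero ^^ k) q)"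
      using zero_circuit_eq_orbit[OF C q] that unfolding zero_def[abs_def] by simp
    ultimately show ?thesis by blast
  qed
  have out: "d s a \<in> ?D" if "s \<in> C" "a < b" "0 < a" for s a
    using D_closed[OF rec_D[OF that(1)] that(2)] d_recurrent[OF C_K[OF that(1)] that(2,3)] by simp
  have desc: "descendants A C = {?D}"
  proof -
    have 1: "scc (d s a) = ?D" if s: "s \<in> C" "a < b" "d s a \<notin> C" for s a
    proof -
      have "0 < a" using s zero_C[OF s(1)] unfolding zero_def by (cases a) auto
      then show ?thesis using out[OF s(1,2)] scc_eqI by blast
    qed
    have 2: "q \<in> C \<and> 1 < b \<and> d q 1 \<notin> C" using q b C(3) by auto
    show ?thesis unfolding descendants_iff[OF C(1)]
    proof (intro set_eqI iffI)
      fix X assume "X \<in> {?D}"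
      then have "X = scc (d q 1)" using 1 2 by auto
      then show "X \<in> {scc (d s a) | s a. s \<in> C \<and> a < b \<and> d s a \<notin> C}" using 2 by blast
    next
      fix X assume "X \<in> {scc (d s a) | s a. s \<in> C \<and> a < b \<and> d s a \<notin> C}"
      then show "X \<in> {?D}" using 1 by blast
    qed
  qed
  let ?f = "\<lambda>s. if s \<in> ?D then s else recurrent s"
  have C_not_D: "s \<notin> ?D" if "s \<in> C" for s using that C_I D_I by blast
  have "embedded A C ?D"
    unfolding embedded_iff[OF sccs_subset[OF C(1)] sccs_subset[OF D_scc]]
  proof (intro exI[of _ ?f] conjI ballI allI impI)
    show "?f ` (C \<union> ?D) \<subseteq> ?D" using rec_D by auto
    show "?f s = s" if "s \<in> ?D" for s using that by simp
    fix s a assume s: "s \<in> C \<union> ?D" "a < b"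
    show "d (?f s) a = ?f (d s a)"
    proof (cases "s \<in> ?D")
      case True
      then show ?thesis using D_closed s by simp
    next
      case False
      then have sC: "s \<in> C" using s by simp
      show ?thesis
      proof (cases "a = 0")
        case True
        then show ?thesis
          using False C_not_D[OF zero_C[OF sC]] recurrent_zero[OF C_K[OF sC]] by (simp add: zero_def)
      next
        case a: False
        then show ?thesis using False out[OF sC s(2)] d_recurrent[OF C_K[OF sC] s(2)] by simp
      qed
    qed
  qed
  then show ?thesis using desc type_one_scc_I[OF r] by blast
qed

lemma UP3: "UP3 A"
  unfolding UP3_def using type_two_embedding by blast

lemma UP4: "UP4 A"
  unfolding UP4_def using type_two_embedding by fastforce

end

section \<open>Equivalent states of a minimal automaton\<close>

context dfa
begin

lemma run_eq_foldl:
  "q \<in> states A \<Longrightarrow> u \<in> lists {..<b} \<Longrightarrow> run A q u = Some (foldl d q u)"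
  by (induction u arbitrary: q) (auto simp: delta_eq)

lemma language_eq: "language A = {u \<in> lists {..<b}. foldl d (initial A) u \<in> finals A}"
proof -
  have i: "initial A \<in> states A" using automaton by (simp add: automaton_def)
  have "(\<exists>q\<in>finals A. run A (initial A) u = Some q) \<longleftrightarrow> foldl d (initial A) u \<in> finals A"
    if "u \<in> lists {..<b}" for u using run_eq_foldl[OF i that] by simp
  then show ?thesis unfolding language_def base by blast
qed

definition equivalent :: "'q \<Rightarrow> 'q \<Rightarrow> bool" where
  "equivalent s t \<longleftrightarrow> (\<forall>u\<in>lists {..<b}. foldl d s u \<in> finals A \<longleftrightarrow> foldl d t u \<in> finals A)"

lemma equivalent_d: "equivalent s t \<Longrightarrow> a < b \<Longrightarrow> equivalent (d s a) (d t a)"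
  unfolding equivalent_def
proof (intro ballI)
  fix u assume *: "\<forall>u\<in>lists {..<b}. (foldl d s u \<in> finals A) = (foldl d t u \<in> finals A)"
    and "a < b" "u \<in> lists {..<b}"
  then have "a # u \<in> lists {..<b}" by simp
  from bspec[OF * this] show "(foldl d (d s a) u \<in> finals A) = (foldl d (d t a) u \<in> finals A)" by simp
qed

end

text \<open>Otherwise redirecting to \<open>s\<close> all transitions entering \<open>t\<close> yields a smaller automaton.\<close>

lemma minimal_equivalent_eq:
  fixes A :: "nat automaton"
  assumes minimal: "minimal A" and A: "dfa A b" and st: "s \<in> states A" "t \<in> states A" "dfa.equivalent A b s t"
  shows "s = t"
proof (rule ccontr)
  assume neq: "s \<noteq> t"
  interpret dfa A b by (rule A)
  define h where "h q = (if q = t then s else q)" for q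
  define B where "B = \<lparr> base = b, states = states A - {t}, initial = h (initial A),
    delta = (\<lambda>q a. if q \<in> states A - {t} \<and> a < b then Some (h (d q a)) else None),
    finals = finals A - {t} \<rparr>"
  have h: "h q \<in> states A - {t}" "equivalent (h q) q" if "q \<in> states A" for q
    using that st neq by (auto simp: h_def equivalent_def)
  have "automaton B"
    unfolding automaton_def
  proof (intro conjI allI impI; (elim conjE)?)
    show "finite (states B)" "initial B \<in> states B" "finals B \<subseteq> states B"
      using automaton h by (auto simp: automaton_def B_def)
  next
    fix q a r assume "delta B q a = Some r"
    then show "q \<in> states B" "a < base B" "r \<in> states B"
      using h[of "d q a"] by (auto simp: B_def split: if_splits)
  qed
  moreover have "complete B" by (simp add: complete_def B_def)
  ultimately interpret B: dfa B b using b by unfold_locales (simp_all add: B_def)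
  have d_B: "B.d q a = h (d q a)" if "q \<in> states A - {t}" "a < b" for q a
    using that unfolding B.d_def by (simp add: B_def)
  \<comment> \<open>The two runs start in different but equivalent states: a redirection separates
    them and preserves only equivalence.\<close>
  have "foldl B.d q u \<in> finals A - {t} \<longleftrightarrow> foldl d r u \<in> finals A"
    if "u \<in> lists {..<b}" "q \<in> states A - {t}" "r \<in> states A" "equivalent q r" for q r u
    using that
  proof (induction u arbitrary: q r)
    case Nil
    have "foldl d q [] \<in> finals A \<longleftrightarrow> foldl d r [] \<in> finals A"
      using Nil.prems(3) unfolding equivalent_def by blast
    then show ?case using Nil by auto
  next
    case (Cons a u)
    then have a: "a < b" "u \<in> lists {..<b}" by auto
    have "equivalent (h (d q a)) (d r a)"
      using equivalent_d[OF Cons.prems(3) a(1)] h(2)[of "d q a"] Cons.prems(1) a(1)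
      by (auto simp: equivalent_def)
    then have "foldl B.d (h (d q a)) u \<in> finals A - {t} \<longleftrightarrow> foldl d (d r a) u \<in> finals A"
      using Cons.prems h(1)[of "d q a"] a by (intro Cons.IH) auto
    then show ?case using d_B[OF Cons.prems(1) a(1)] by simp
  qed
  moreover have i: "initial A \<in> states A" using automaton by (simp add: automaton_def)
  ultimately have "language B = language A"
    unfolding language_eq B.language_eq using h[OF i] by (auto simp: B_def)
  moreover have "base B = base A" using base by (simp add: B_def)
  ultimately have "card (states A) \<le> card (states B)"
    using minimal \<open>automaton B\<close> \<open>complete B\<close> unfolding minimal_def by blast
  moreover have "card (states B) < card (states A)"
    unfolding B_def using card_Diff1_less[OF finite_states st(2)] by simp
  ultimately show False by simp
qed

section \<open>(UP 2)-(UP 4) imply coherence\<close>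

context dfa
begin

text \<open>Extracts from the isomorphism a labelling h of the states by sets with a common period.
  Closure of \<open>C\<close> under all letters comes from the completeness of the atomic
  automaton.\<close>

lemma UP_atomic_scc_shift:
  assumes C: "C \<in> sccs A" and UP: "UP_atomic_scc A C"
  obtains h p where "inj_on h C" "\<And>s. s \<in> C \<Longrightarrow> has_pure_period (h s) p" "coprime p b"
    "\<And>s a. s \<in> C \<Longrightarrow> a < b \<Longrightarrow> d s a \<in> C"
    "\<And>s a. s \<in> C \<Longrightarrow> a < b \<Longrightarrow> h (d s a) = Delta b (h s) a"
proof -
  obtain q S where q: "q \<in> C" and S: "purely_periodic S" "coprime (period S) b"
    and iso: "isomorphic (restrict_to A C q) (atomic_automaton b S)"
    using UP base unfolding UP_atomic_scc_def UP_atomic_def by (auto simp: restrict_to_def)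
  let ?R = "restrict_to A C q" and ?U = "atomic_automaton b S"
  obtain h where h: "bij_betw h (states ?R) (states ?U)"
    and hd: "\<forall>s\<in>states ?R. \<forall>a<base ?R. delta ?U (h s) a = map_option h (delta ?R s a)"
    using iso unfolding isomorphic_def by blast
  have R [simp]: "states ?R = C" "base ?R = b" using base by (simp_all add: restrict_to_def)
  have U: "h s \<in> states ?U" if "s \<in> C" for s using bij_betwE[OF h] that by simp
  have per: "has_pure_period S (period S)"
    using S(1) has_pure_period_period unfolding purely_periodic_def by blast
  have step: "d s a \<in> C \<and> h (d s a) = Delta b (h s) a" if s: "s \<in> C" "a < b" for s a
  proof -
    have "delta ?U (h s) a = Some (Delta b (h s) a)"
      using U[OF s(1)] s(2) by (simp add: atomic_automaton_def Let_def)
    then have 1: "map_option h (delta ?R s a) = Some (Delta b (h s) a)" using hd s by simp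
    then have "delta ?R s a \<noteq> None" by (cases "delta ?R s a") auto
    then have ex: "\<exists>t. (s, a, t) \<in> internal_transitions A C"
      by (rule contrapos_np) (simp add: restrict_to_def)
    then have "d s a \<in> C" unfolding internal_transitions_iff[OF C] by blast
    moreover have "delta ?R s a = Some (d s a)"
      using ex s sccs_subset[OF C] by (auto simp: restrict_to_def delta_eq)
    ultimately show ?thesis using 1 by simp
  qed
  show ?thesis
  proof (rule that[of h "period S"])
    show "inj_on h C" using h by (simp add: bij_betw_def)
    fix s assume "s \<in> C"
    then obtain u where "h s = Delta_word b S u"
      using U[of s] by (auto simp: atomic_automaton_def Let_def)
    then show "has_pure_period (h s) (period S)" using has_pure_period_Delta_word[OF per] by simp
  qed (use S step in auto)
qed

end

context kernel
begin

lemma tau_eqI: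
  assumes "inj_on zero K" "r \<in> K" "zero r = d s 1"
  shows "tau s = r"
  unfolding tau_def using inv_into_f_f[OF assms(1,2)] assms(3) by simp

text \<open>Under the labelling h, tau becomes \<open>shift 1\<close>, for which the identities are
  arithmetic. Since tau inverts 0 on all of \<open>K\<close>, injectivity there is assumed; as 0
  permutes \<open>C\<close>, the preimage in question lies in \<open>C\<close>.\<close>

lemma atomic_scc_coherent:
  assumes inj: "inj_on zero K" and C: "C \<in> sccs A" "\<not> trivial_scc A C" "UP_atomic_scc A C"
  shows "inj_on tau C"
    "\<And>s. s \<in> C \<Longrightarrow> tau s \<in> C"
    "\<And>s a. s \<in> C \<Longrightarrow> a < b \<Longrightarrow> zero ((tau ^^ a) s) = d s a"
    "\<And>s. s \<in> C \<Longrightarrow> tau (zero s) = zero ((tau ^^ b) s)"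
proof -
  obtain h p where h: "inj_on h C" and per: "\<And>s. s \<in> C \<Longrightarrow> has_pure_period (h s) p"
    and p: "coprime p b"
    and closed: "\<And>s a. s \<in> C \<Longrightarrow> a < b \<Longrightarrow> d s a \<in> C"
    and hd: "\<And>s a. s \<in> C \<Longrightarrow> a < b \<Longrightarrow> h (d s a) = Delta b (h s) a"
    by (rule UP_atomic_scc_shift[OF C(1,3)]) blast
  have C_K: "C \<subseteq> K" using nontrivial_subset_cyclic[OF C(1,2)] cyclic_K by blast
  have hz: "h (zero s) = Delta b (h s) 0" "zero s \<in> C" if "s \<in> C" for s
    using hd closed that b by (auto simp: zero_def)
  have zero_C: "zero ` C = C"
    using finite_subset[OF C_K finite_K] inj_on_subset[OF inj C_K] hz(2) by (intro endo_inj_surj) auto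
  have Delta_shift: "Delta b (shift a X) 0 = Delta b X a" for X a
    by (simp add: Delta_def shift_def)
  have tau: "tau s \<in> C \<and> h (tau s) = shift 1 (h s)" if s: "s \<in> C" for s
  proof -
    have "d s 1 \<in> zero ` C" using closed[OF s b] zero_C by simp
    then obtain r where r: "r \<in> C" "zero r = d s 1" by (metis imageE)
    then have "tau s = r" using tau_eqI[OF inj] C_K by blast
    moreover have "Delta b (h r) 0 = Delta b (shift 1 (h s)) 0"
      using hz(1)[OF r(1)] hd[OF s b] r(2) by (simp add: Delta_shift)
    then have "h r = shift 1 (h s)"
      by (rule Delta_0_inject[OF per[OF r(1)] has_pure_period_shift[OF per[OF s]] p])
    ultimately show ?thesis using r by simp
  qed
  then show tau_C: "\<And>s. s \<in> C \<Longrightarrow> tau s \<in> C" by blast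
  have tau_pow: "(tau ^^ k) s \<in> C \<and> h ((tau ^^ k) s) = shift k (h s)" if "s \<in> C" for s k
  proof (induction k)
    case (Suc k)
    then show ?case using tau by (simp add: shift_def add.assoc)
  qed (use that in \<open>simp add: shift_def\<close>)
  show "inj_on tau C"
  proof (rule inj_onI)
    fix s t assume st: "s \<in> C" "t \<in> C" "tau s = tau t"
    then have "shift 1 (h s) = shift 1 (h t)" using tau by metis
    then have "h s = h t" using shift_inject per st by blast
    then show "s = t" using h st by (auto dest: inj_onD)
  qed
  show "zero ((tau ^^ a) s) = d s a" if s: "s \<in> C" "a < b" for s a
  proof (rule inj_onD[OF h])
    show "h (zero ((tau ^^ a) s)) = h (d s a)"
      using hz(1)[of "(tau ^^ a) s"] tau_pow[OF s(1), of a] hd[OF s] Delta_shift by simp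
  qed (use hz tau_pow closed s in auto)
  show "tau (zero s) = zero ((tau ^^ b) s)" if s: "s \<in> C" for s
  proof (rule inj_onD[OF h])
    have "h (tau (zero s)) = shift 1 (Delta b (h s) 0)" using tau hz s by metis
    also have "\<dots> = Delta b (shift b (h s)) 0"
      by (simp add: shift_def Delta_def algebra_simps)
    also have "\<dots> = h (zero ((tau ^^ b) s))" using hz(1)[of "(tau ^^ b) s"] tau_pow[OF s, of b] by simp
    finally show "h (tau (zero s)) = h (zero ((tau ^^ b) s))" .
  qed (use hz tau_pow tau s in auto)
qed

lemma nontrivial_cases:
  assumes "q \<in> cyclic"
  shows "type_one A (scc q) \<or> type_two A (scc q)"
  using cyclic_scc_nontrivial[OF assms] unfolding type_one_def by blast

lemma UP_imp_coherent:
  assumes UP2: "UP2 A" and UP3: "UP3 A" and UP4: "UP4 A"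
  shows coherent
proof -
  have one: "C \<in> sccs A" "\<not> trivial_scc A C" "UP_atomic_scc A C" if "type_one A C" for C
    using that UP2 unfolding UP2_def type_one_def by auto
  have one_closed: "d s a \<in> C" if "type_one A C" "s \<in> C" "a < b" for C s a
    by (rule UP_atomic_scc_shift[OF one(1,3)[OF that(1)]]) (use that in blast)
  have two: "\<exists>D. type_one A D \<and> embedded A C D \<and> (\<forall>s\<in>C. \<forall>a<b. d s a \<notin> C \<longrightarrow> d s a \<in> D)"
    if C2: "type_two A C" for C
  proof -
    obtain D where D: "descendants A C = {D}" "type_one A D"
      using UP3[unfolded UP3_def, rule_format, OF C2] by blast
    then have "embedded A C D" using UP4[unfolded UP4_def, rule_format, OF C2, of D] by simp
    moreover have "C \<in> sccs A" using C2 by (simp add: type_two_def)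
    then have "d s a \<in> D" if "s \<in> C" "a < b" "d s a \<notin> C" for s a
      using that D(1) scc_refl[of "d s a"] unfolding descendants_iff[OF \<open>C \<in> sccs A\<close>] by blast
    ultimately show ?thesis using D(2) by blast
  qed
  have cyclic_closed: "d q a \<in> cyclic" if q: "q \<in> cyclic" "a < b" for q a
  proof -
    have C: "scc q \<subseteq> cyclic" using nontrivial_subset_cyclic cyclic_scc_nontrivial[OF q(1)] by blast
    show ?thesis
    proof (cases "type_one A (scc q)")
      case True
      then show ?thesis using one_closed[OF True scc_refl q(2)] C by blast
    next
      case False
      then have "type_two A (scc q)" using nontrivial_cases[OF q(1)] by blast
      then obtain D where D: "type_one A D" "d q a \<notin> scc q \<longrightarrow> d q a \<in> D" using two q by force
      then show ?thesis using C nontrivial_subset_cyclic[OF one(1,2)[OF D(1)]] by blast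
    qed
  qed
  have K_cyclic: "K \<subseteq> cyclic"
  proof
    fix q assume q: "q \<in> K"
    \<comment> \<open>Following predecessors inside the finite set \<open>K\<close> must repeat a
      state, so q is reachable from a circuit; and \<open>cyclic\<close> is closed under
      letters.\<close>
    have "\<forall>q\<in>K. \<exists>p\<in>K. (p, q) \<in> E" using K_pred K_sub by (auto simp: edges_iff) blast
    then obtain g where g: "\<And>q. q \<in> K \<Longrightarrow> g q \<in> K \<and> (g q, q) \<in> E" by metis
    have g_K: "(g ^^ k) q \<in> K" for k by (induction k) (use q g in auto)
    have path: "((g ^^ (i + k)) q, (g ^^ i) q) \<in> E\<^sup>*" for i k
    proof (induction k)
      case (Suc k)
      have "((g ^^ (i + Suc k)) q, (g ^^ (i + k)) q) \<in> E" using g[OF g_K[of "i + k"]] by simp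
      then show ?case using Suc by (rule converse_rtrancl_into_rtrancl)
    qed simp
    have "range (\<lambda>k. (g ^^ k) q) \<subseteq> K" using g_K by blast
    then have "\<not> inj (\<lambda>k. (g ^^ k) q)"
      using finite_K finite_imageD finite_subset infinite_UNIV_nat by metis
    then obtain i j where ij: "i < j" "(g ^^ i) q = (g ^^ j) q"
      unfolding inj_def by (metis linorder_neqE_nat)
    let ?r = "(g ^^ i) q"
    have "((g ^^ Suc (j - 1)) q, (g ^^ (j - 1)) q) \<in> E" using g[OF g_K[of "j - 1"]] by simp
    moreover have "((g ^^ (j - 1)) q, ?r) \<in> E\<^sup>*" using path[of i "j - 1 - i"] ij(1) by simp
    ultimately have "((g ^^ j) q, ?r) \<in> E\<^sup>+" using ij(1) by (auto intro: rtrancl_into_trancl2)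
    then have r: "?r \<in> cyclic" using ij(2) by (simp add: cyclic_def)
    have "(?r, q) \<in> E\<^sup>*" using path[of 0 i] by simp
    then show "q \<in> cyclic"
      by (induction rule: rtrancl_induct) (use r cyclic_closed in \<open>auto simp: edges_iff\<close>)
  qed
  have zero_scc: "zero q \<in> scc q" if "q \<in> K" for q
  proof (cases "type_one A (scc q)")
    case True
    then show ?thesis using one_closed[OF True scc_refl] b by (simp add: zero_def)
  next
    case False
    then have "type_two A (scc q)" using nontrivial_cases K_cyclic that by blast
    then show ?thesis using type_two_zero bij_betwE scc_refl unfolding zero_def by fast
  qed
  \<comment> \<open>Reading 0 stays in the component, so two states with the same 0-successor share
    a component, where injectivity is known for either type.\<close>
  have inj: "inj_on zero K"
  proof (rule inj_onI)
    fix s t assume st: "s \<in> K" "t \<in> K" "zero s = zero t"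
    have C: "scc s = scc t" using scc_eqI[OF zero_scc] st by metis
    show "s = t"
    proof (cases "type_one A (scc s)")
      case True
      obtain h p where h: "inj_on h (scc s)" "\<And>q. q \<in> scc s \<Longrightarrow> has_pure_period (h q) p" "coprime p b"
        "\<And>q a. q \<in> scc s \<Longrightarrow> a < b \<Longrightarrow> h (d q a) = Delta b (h q) a"
        by (rule UP_atomic_scc_shift[OF one(1,3)[OF True]]) blast
      have "t \<in> scc s" using C by simp
      have "Delta b (h s) 0 = Delta b (h t) 0"
        using h(4)[of s 0] h(4)[OF \<open>t \<in> scc s\<close>, of 0] st(3) b by (simp add: zero_def)
      then have "h s = h t" using Delta_0_inject[OF h(2) h(2) h(3)] \<open>t \<in> scc s\<close> by simp
      then show ?thesis using h(1) \<open>t \<in> scc s\<close> by (auto dest: inj_onD)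
    next
      case False
      then have "type_two A (scc s)" using nontrivial_cases K_cyclic st by blast
      then have "inj_on (\<lambda>s. d s 0) (scc s)" using type_two_zero by (simp add: bij_betw_def)
      then show ?thesis using st(3) C scc_refl[of s] scc_refl[of t] unfolding zero_def by (auto dest: inj_onD)
    qed
  qed
  have coh: "inj_on tau C" "\<And>s. s \<in> C \<Longrightarrow> tau s \<in> C"
    "\<And>s a. s \<in> C \<Longrightarrow> a < b \<Longrightarrow> zero ((tau ^^ a) s) = d s a"
    "\<And>s. s \<in> C \<Longrightarrow> tau (zero s) = zero ((tau ^^ b) s)" if C: "type_one A C" for C
    using atomic_scc_coherent[OF inj one[OF C]] by simp_all
  have key: "tau q \<in> \<Union>{C. type_one A C} \<and> (\<forall>a<b. zero ((tau ^^ a) q) = d q a) \<and>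
      tau (zero q) = zero ((tau ^^ b) q)" if q: "q \<in> K" for q
  proof (cases "type_one A (scc q)")
    case True
    then show ?thesis using coh[OF True] scc_refl[of q] by blast
  next
    case False
    then have C2: "type_two A (scc q)" using nontrivial_cases K_cyclic q by blast
    then obtain D where D: "type_one A D" "embedded A (scc q) D"
      and out: "\<And>s a. s \<in> scc q \<Longrightarrow> a < b \<Longrightarrow> d s a \<notin> scc q \<Longrightarrow> d s a \<in> D"
      using two[OF C2] by blast
    have C: "scc q \<in> sccs A" "\<forall>s\<in>scc q. \<forall>a<b. d s a \<in> scc q \<longrightarrow> a = 0"
      using C2 type_two_iff by blast+
    have DQ: "D \<subseteq> states A" and D_K: "D \<subseteq> K"
      using sccs_subset one(1)[OF D(1)] nontrivial_subset_cyclic[OF one(1,2)[OF D(1)]] cyclic_K by blast+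
    obtain f where f: "f ` (scc q \<union> D) \<subseteq> D" "\<forall>s\<in>D. f s = s"
      "\<forall>s\<in>scc q \<union> D. \<forall>a<b. d s a \<in> scc q \<union> D \<longrightarrow> d (f s) a = f (d s a)"
      using D(2) unfolding embedded_iff[OF sccs_subset[OF C(1)] DQ] by blast
    \<comment> \<open>A positive digit leaves the circuit for the unique descendant
      \<open>D\<close>, on which f is the identity. As tau is computed from the digit 1, s and
      \<open>f s\<close> also agree under tau.\<close>
    have d_f: "d (f s) a = d s a \<and> d s a \<in> D" if s: "s \<in> scc q" "a < b" "0 < a" for s a
    proof -
      have "d s a \<in> D" using out C(2) s by auto
      then show ?thesis using f(2,3) s by auto
    qed
    have fD: "f s \<in> D" if "s \<in> scc q" for s using f(1) that by blast
    have tau_f: "tau s = tau (f s)" if "s \<in> scc q" for s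
      unfolding tau_def using d_f[OF that b] by simp
    have z: "zero q \<in> scc q" using zero_scc[OF q] .
    have f_zero: "f (zero q) = zero (f q)"
      using f(3) scc_refl[of q] z b unfolding zero_def by auto
    have tau_pow: "(tau ^^ a) q = (tau ^^ a) (f q)" if "0 < a" for a
      using that tau_f[OF scc_refl] by (cases a) (simp_all add: funpow_Suc_right del: funpow.simps)
    have "tau q \<in> D" using tau_f[OF scc_refl] coh(2)[OF D(1) fD[OF scc_refl]] by simp
    moreover have "zero ((tau ^^ a) q) = d q a" if "a < b" for a
    proof (cases "a = 0")
      case False
      then show ?thesis using coh(3)[OF D(1) fD[OF scc_refl] that] tau_pow d_f[OF scc_refl that] by simp
    qed (simp add: zero_def)
    moreover have "tau (zero q) = zero ((tau ^^ b) q)"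
      using tau_f[OF z] f_zero coh(4)[OF D(1) fD[OF scc_refl]] tau_pow[of b] b by simp
    ultimately show ?thesis using D(1) by blast
  qed
  moreover have "inj_on tau (tau ` K)"
  proof (rule inj_onI)
    fix x y assume "x \<in> tau ` K" "y \<in> tau ` K" and eq: "tau x = tau y"
    then obtain C C' where C: "type_one A C" "x \<in> C" "type_one A C'" "y \<in> C'" using key by blast
    have "tau x \<in> C" "tau x \<in> C'" using coh(2)[OF C(1,2)] coh(2)[OF C(3,4)] eq by simp_all
    then have "C = C'" using sccs_mem[OF one(1)[OF C(1)]] sccs_mem[OF one(1)[OF C(3)]] by blast
    then show "x = y" using coh(1)[OF C(1)] C eq by (auto dest: inj_onD)
  qed
  ultimately show coherent unfolding coherent_def using inj by blast
qed

end

theorem UP_iff_coherent: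
  fixes A :: "nat automaton"
  assumes "minimal A" "UP0 A" "kernel A b K"
  shows "UP2 A \<and> UP3 A \<and> UP4 A \<longleftrightarrow> kernel.coherent A b K"
proof
  interpret kernel A b K by fact
  show coherent if "UP2 A \<and> UP3 A \<and> UP4 A" using that UP_imp_coherent by blast
  assume coherent
  then interpret atomic_kernel A b K
    using \<open>UP0 A\<close> minimal_equivalent_eq[OF \<open>minimal A\<close> dfa_axioms]
    by unfold_locales (auto simp: equivalent_def)
  show "UP2 A \<and> UP3 A \<and> UP4 A" using UP2 UP3 UP4 by blast
qed

section \<open>A structured language over the RAM\<close>

text \<open>\<open>vRes\<close> is the flag, \<open>vOne\<close> the constant 1 (there is no
  immediate addition), \<open>vB\<close>, \<open>vN\<close>, \<open>vL\<close> are the base, the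
  number of states and the input length, \<open>vI\<close>, \<open>vC\<close>, \<open>vJ\<close>
  loop counters, \<open>vR\<close> the pointer into the transition table, \<open>vH\<close>,
  \<open>vT\<close> head and tail of the queue.\<close>

datatype var = vRes | vOne | vB | vN | vL | vI | vC | vJ | vD | vR | vH | vT | vQ | vX | vY | vZ

text \<open>\<open>Row\<close> holds row addresses, \<open>Zer\<close> 0-successors,
  \<open>Deg\<close> remaining in-degrees, \<open>Que\<close> the queue, \<open>Inv\<close>
  preimages under 0, \<open>Tau\<close> the operator; \<open>Img\<close> marks tau(K),
  \<open>Dup\<close> the values tau takes on it.\<close>

datatype arr = Inp | Row | Zer | Deg | Que | Inv | Tau | Img | Dup

datatype com =
    SKIP
  | SET var nat
  | ADD var var var
  | SUB var var var
  | LD var arr var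
  | ST arr var var
  | SEQ com com (infixr ";;" 60)
  | IF var com com
  | WHILE var com

type_synonym store = "(var \<Rightarrow> nat) \<times> (arr \<Rightarrow> nat \<Rightarrow> nat)"

text \<open>
  The input is laid out contiguously from address 0, the other arrays are interleaved
  behind it. Hence input accesses must stay below the input length \<open>L\<close>, and accesses
  to the other arrays need \<open>L\<close> in \<open>vL\<close>.
\<close>

definition guard :: "nat \<Rightarrow> arr \<Rightarrow> nat \<Rightarrow> (var \<Rightarrow> nat) \<Rightarrow> bool" where
  "guard L A i \<sigma> \<longleftrightarrow> (if A = Inp then i < L else \<sigma> vL = L)"

text \<open>
  Only loop iterations are charged: a compiled program spends at most its own length between
  two iterations.
\<close>

inductive exec :: "nat \<Rightarrow> com \<Rightarrow> store \<Rightarrow> nat \<Rightarrow> store \<Rightarrow> bool" for L where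
  SKIP: "exec L SKIP s 0 s"
| SET: "exec L (SET x k) (\<sigma>, \<alpha>) 0 (\<sigma>(x := k), \<alpha>)"
| ADD: "exec L (ADD x y z) (\<sigma>, \<alpha>) 0 (\<sigma>(x := \<sigma> y + \<sigma> z), \<alpha>)"
| SUB: "exec L (SUB x y z) (\<sigma>, \<alpha>) 0 (\<sigma>(x := \<sigma> y - \<sigma> z), \<alpha>)"
| LD: "guard L A (\<sigma> y) \<sigma> \<Longrightarrow> exec L (LD x A y) (\<sigma>, \<alpha>) 0 (\<sigma>(x := \<alpha> A (\<sigma> y)), \<alpha>)"
| ST: "A \<noteq> Inp \<Longrightarrow> guard L A (\<sigma> x) \<sigma> \<Longrightarrow>
       exec L (ST A x y) (\<sigma>, \<alpha>) 0 (\<sigma>, \<alpha>(A := (\<alpha> A)(\<sigma> x := \<sigma> y)))"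
| SEQ: "exec L c1 s t1 s' \<Longrightarrow> exec L c2 s' t2 s'' \<Longrightarrow> exec L (c1 ;; c2) s (t1 + t2) s''"
| IF: "exec L (if \<sigma> v \<noteq> 0 then c1 else c2) (\<sigma>, \<alpha>) t s' \<Longrightarrow> exec L (IF v c1 c2) (\<sigma>, \<alpha>) t s'"
| WHILE0: "\<sigma> v = 0 \<Longrightarrow> exec L (WHILE v c) (\<sigma>, \<alpha>) 0 (\<sigma>, \<alpha>)"
| WHILE1: "\<sigma> v \<noteq> 0 \<Longrightarrow> exec L c (\<sigma>, \<alpha>) t1 s' \<Longrightarrow> exec L (WHILE v c) s' t2 s'' \<Longrightarrow>
       exec L (WHILE v c) (\<sigma>, \<alpha>) (Suc (t1 + t2)) s''"

text \<open>The postcondition also receives the part of the time budget that is left over.\<close>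

definition wp :: "nat \<Rightarrow> com \<Rightarrow> (nat \<Rightarrow> store \<Rightarrow> bool) \<Rightarrow> nat \<Rightarrow> store \<Rightarrow> bool" where
  "wp L c Q T s \<longleftrightarrow> (\<exists>t s'. exec L c s t s' \<and> t \<le> T \<and> Q (T - t) s')"

inductive_cases exec_SKIP: "exec L SKIP s t s'"
inductive_cases exec_SET: "exec L (SET x k) s t s'"
inductive_cases exec_ADD: "exec L (ADD x y z) s t s'"
inductive_cases exec_SUB: "exec L (SUB x y z) s t s'"
inductive_cases exec_LD: "exec L (LD x A y) s t s'"
inductive_cases exec_ST: "exec L (ST A x y) s t s'"
inductive_cases exec_SEQ: "exec L (c1 ;; c2) s t s'"
inductive_cases exec_IF: "exec L (IF v c1 c2) s t s'"

lemma wp_SKIP [simp]: "wp L SKIP Q T s \<longleftrightarrow> Q T s"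
  unfolding wp_def by (metis exec.SKIP exec_SKIP diff_zero zero_le)

lemma wp_SET [simp]: "wp L (SET x k) Q T (\<sigma>, \<alpha>) \<longleftrightarrow> Q T (\<sigma>(x := k), \<alpha>)"
  by (force simp: wp_def intro: exec.SET elim: exec_SET)

lemma wp_ADD [simp]: "wp L (ADD x y z) Q T (\<sigma>, \<alpha>) \<longleftrightarrow> Q T (\<sigma>(x := \<sigma> y + \<sigma> z), \<alpha>)"
  by (force simp: wp_def intro: exec.ADD elim: exec_ADD)

lemma wp_SUB [simp]: "wp L (SUB x y z) Q T (\<sigma>, \<alpha>) \<longleftrightarrow> Q T (\<sigma>(x := \<sigma> y - \<sigma> z), \<alpha>)"
  by (force simp: wp_def intro: exec.SUB elim: exec_SUB)

lemma wp_LD [simp]: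
  "wp L (LD x A y) Q T (\<sigma>, \<alpha>) \<longleftrightarrow> guard L A (\<sigma> y) \<sigma> \<and> Q T (\<sigma>(x := \<alpha> A (\<sigma> y)), \<alpha>)"
  by (force simp: wp_def intro: exec.LD elim: exec_LD)

lemma wp_ST [simp]:
  "wp L (ST A x y) Q T (\<sigma>, \<alpha>) \<longleftrightarrow>
     A \<noteq> Inp \<and> guard L A (\<sigma> x) \<sigma> \<and> Q T (\<sigma>, \<alpha>(A := (\<alpha> A)(\<sigma> x := \<sigma> y)))"
  by (force simp: wp_def intro: exec.ST elim: exec_ST)

lemma wp_SEQ [simp]: "wp L (c1 ;; c2) Q = wp L c1 (wp L c2 Q)"
proof (intro ext iffI)
  fix T s
  assume "wp L (c1 ;; c2) Q T s"
  then obtain t1 t2 s' s'' where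
    "exec L c1 s t1 s'" "exec L c2 s' t2 s''" "t1 + t2 \<le> T" "Q (T - (t1 + t2)) s''"
    by (auto simp: wp_def elim: exec_SEQ)
  moreover have "t1 \<le> T" "t2 \<le> T - t1" "T - (t1 + t2) = T - t1 - t2"
    using \<open>t1 + t2 \<le> T\<close> by auto
  ultimately show "wp L c1 (wp L c2 Q) T s"
    unfolding wp_def by metis
next
  fix T s
  assume "wp L c1 (wp L c2 Q) T s"
  then obtain t1 t2 s' s'' where *:
    "exec L c1 s t1 s'" "exec L c2 s' t2 s''" "t1 \<le> T" "t2 \<le> T - t1" "Q (T - t1 - t2) s''"
    unfolding wp_def by metis
  then have "exec L (c1 ;; c2) s (t1 + t2) s''" "t1 + t2 \<le> T"
    by (auto intro: exec.SEQ)
  with * show "wp L (c1 ;; c2) Q T s"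
    unfolding wp_def by (intro exI[of _ "t1 + t2"] exI[of _ s'']) simp
qed

lemma wp_IF [simp]:
  "wp L (IF v c1 c2) Q T (\<sigma>, \<alpha>) \<longleftrightarrow>
     (if \<sigma> v \<noteq> 0 then wp L c1 Q T (\<sigma>, \<alpha>) else wp L c2 Q T (\<sigma>, \<alpha>))"
proof -
  have "exec L (IF v c1 c2) (\<sigma>, \<alpha>) t s' \<longleftrightarrow> exec L (if \<sigma> v \<noteq> 0 then c1 else c2) (\<sigma>, \<alpha>) t s'" for t s'
    by (auto intro: exec.IF elim: exec_IF simp del: if_split)
  then show ?thesis by (simp add: wp_def)
qed

text \<open>Each round gets a fresh budget \<open>K\<close> and is charged one more for itself;
  \<open>V\<close> bounds the number of rounds, and \<open>T'\<close> is handed on to what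
  follows.\<close>

lemma wp_WHILE:
  assumes "I s"
    and step: "\<And>\<sigma> \<alpha>. I (\<sigma>, \<alpha>) \<Longrightarrow> \<sigma> v \<noteq> 0 \<Longrightarrow>
       wp L c (\<lambda>_ s'. I s' \<and> V s' < V (\<sigma>, \<alpha>)) K (\<sigma>, \<alpha>)"
    and "V s * Suc K + T' \<le> T"
    and post: "\<And>t \<sigma> \<alpha>. I (\<sigma>, \<alpha>) \<Longrightarrow> \<sigma> v = 0 \<Longrightarrow> T' \<le> t \<Longrightarrow> Q t (\<sigma>, \<alpha>)"
  shows "wp L (WHILE v c) Q T s"
proof -
  have "\<exists>t s'. exec L (WHILE v c) s t s' \<and> t \<le> V s * Suc K \<and> I s' \<and> fst s' v = 0"
    using \<open>I s\<close>
  proof (induction "V s" arbitrary: s rule: less_induct)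
    case less
    obtain \<sigma> \<alpha> where s: "s = (\<sigma>, \<alpha>)" by (cases s)
    show ?case
    proof (cases "\<sigma> v = 0")
      case True
      then show ?thesis using less.prems exec.WHILE0[of \<sigma> v L c \<alpha>] s by fastforce
    next
      case False
      then obtain t s' where s': "exec L c (\<sigma>, \<alpha>) t s'" "t \<le> K" "I s'" "V s' < V (\<sigma>, \<alpha>)"
        using step less.prems s unfolding wp_def by blast
      then obtain u s'' where s'': "exec L (WHILE v c) s' u s''" "u \<le> V s' * Suc K" "I s''" "fst s'' v = 0"
        using less.hyps[of s'] s by blast
      have "exec L (WHILE v c) s (Suc (t + u)) s''"
        using False s' s'' s by (auto intro: exec.WHILE1)
      moreover have "Suc (t + u) \<le> V s * Suc K"
      proof -
        have "Suc (t + u) \<le> Suc (V s') * Suc K" using s'(2) s''(2) by simp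
        also have "\<dots> \<le> V s * Suc K" using s'(4) s by (intro mult_le_mono1) simp
        finally show ?thesis .
      qed
      ultimately show ?thesis using s'' by blast
    qed
  qed
  then obtain t s' where *: "exec L (WHILE v c) s t s'" "t \<le> V s * Suc K" "I s'" "fst s' v = 0"
    by blast
  moreover have "t \<le> T" "T' \<le> T - t" using * assms(3) by auto
  ultimately show ?thesis
    using post[of "fst s'" "snd s'" "T - t"] unfolding wp_def by (metis prod.collapse)
qed

lemma wp_mono:
  assumes "wp L c Q T s" "\<And>t s'. Q t s' \<Longrightarrow> Q' (t + U) s'"
  shows "wp L c Q' (T + U) s"
proof -
  obtain t s' where *: "exec L c s t s'" "t \<le> T" "Q (T - t) s'"
    using assms(1) unfolding wp_def by blast
  have "T + U - t = T - t + U" using *(2) by simp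
  then have "Q' (T + U - t) s'" using assms(2)[OF *(3)] by simp
  then show ?thesis using * unfolding wp_def by (metis trans_le_add1)
qed

section \<open>Compilation to machine code\<close>

fun reg :: "var \<Rightarrow> nat" where
  "reg vRes = 0" | "reg vOne = 1" | "reg vB = 2" | "reg vN = 3" | "reg vL = 4" | "reg vI = 5"
| "reg vC = 6" | "reg vJ = 7" | "reg vD = 8" | "reg vR = 9" | "reg vH = 10" | "reg vT = 11"
| "reg vQ = 12" | "reg vX = 13" | "reg vY = 14" | "reg vZ = 15"

fun slot :: "arr \<Rightarrow> nat" where
  "slot Inp = 0" | "slot Row = 0" | "slot Zer = 1" | "slot Deg = 2" | "slot Que = 3"
| "slot Inv = 4" | "slot Tau = 5" | "slot Img = 6" | "slot Dup = 7"

text \<open>Registers 16 and 17 belong to no variable and serve as scratch. Three doublings give 8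
  i, the stride of the eight interleaved arrays; for the input, clearing and adding is a register
  move.\<close>

definition addr_code :: "arr \<Rightarrow> var \<Rightarrow> instr list" where
  "addr_code A x = (if A = Inp then [Const 16 0, Add 16 16 (reg x)] else
     [Add 16 (reg x) (reg x), Add 16 16 16, Add 16 16 16, Const 17 (slot A), Add 16 16 17,
      Add 16 16 (reg vL)])"

text \<open>Jump targets are absolute, so the position \<open>p\<close> of the code is a
  parameter.\<close>

fun compile :: "nat \<Rightarrow> com \<Rightarrow> program" where
  "compile p SKIP = []"
| "compile p (SET x k) = [Const (reg x) k]"
| "compile p (ADD x y z) = [Add (reg x) (reg y) (reg z)]"
| "compile p (SUB x y z) = [Sub (reg x) (reg y) (reg z)]"
| "compile p (LD x A y) = addr_code A y @ [Load (reg x) 16]"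
| "compile p (ST A x y) = addr_code A x @ [Store 16 (reg y)]"
| "compile p (c1 ;; c2) = (let p1 = compile p c1 in p1 @ compile (p + length p1) c2)"
| "compile p (IF v c1 c2) =
     (let p1 = compile (Suc p) c1; q = Suc (Suc p) + length p1; p2 = compile q c2 in
      JumpZero (reg v) q # p1 @ Jump (q + length p2) # p2)"
| "compile p (WHILE v c) =
     (let p1 = compile (Suc p) c in JumpZero (reg v) (Suc (Suc p) + length p1) # p1 @ [Jump p])"

definition address :: "nat \<Rightarrow> arr \<Rightarrow> nat \<Rightarrow> nat" where
  "address L A i = (if A = Inp then i else L + 8 * i + slot A)"

text \<open>The cells of \<open>Inp\<close> from \<open>L\<close> on are left out, as those
  addresses belong to the other arrays; registers 16 and 17 are unconstrained.\<close>

definition represents :: "nat \<Rightarrow> store \<Rightarrow> config \<Rightarrow> bool" where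
  "represents L s c \<longleftrightarrow>
     (\<forall>v. regs c (reg v) = fst s v) \<and>
     (\<forall>A i. (A = Inp \<longrightarrow> i < L) \<longrightarrow> mem c (address L A i) = snd s A i)"

lemma reg_eq_iff [simp]: "reg x = reg y \<longleftrightarrow> x = y"
  by (cases x; cases y; simp)

lemma reg_neq_scratch [simp]: "reg x \<noteq> 16" "reg x \<noteq> 17" "16 \<noteq> reg x" "17 \<noteq> reg x"
  by (cases x; simp)+

lemma slot_less: "slot A < 8"
  by (cases A) auto

lemma slot_eq_iff: "A \<noteq> Inp \<Longrightarrow> B \<noteq> Inp \<Longrightarrow> slot A = slot B \<longleftrightarrow> A = B"
  by (cases A; cases B; simp)

text \<open>Only arrays other than \<open>Inp\<close> are written, hence the asymmetry. Slots are
  below 8, so index and slot are quotient and remainder.\<close>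

lemma address_eq_iff:
  assumes "A = Inp \<longrightarrow> i < L" "B \<noteq> Inp"
  shows "address L A i = address L B j \<longleftrightarrow> A = B \<and> i = j"
proof (cases "A = Inp")
  case False
  have "8 * i + slot A = 8 * j + slot B \<longleftrightarrow> slot A = slot B \<and> i = j"
    using slot_less[of A] slot_less[of B] by presburger
  then show ?thesis using assms False slot_eq_iff[of A B] by (auto simp: address_def)
qed (use assms in \<open>auto simp: address_def\<close>)

definition code_at :: "program \<Rightarrow> nat \<Rightarrow> program \<Rightarrow> bool" where
  "code_at P p xs \<longleftrightarrow> (\<forall>i<length xs. p + i < length P \<and> P ! (p + i) = xs ! i)"

lemma code_at_Nil [simp]: "code_at P p []"
  by (simp add: code_at_def)

lemma code_at_Cons [simp]:
  "code_at P p (x # xs) \<longleftrightarrow> p < length P \<and> P ! p = x \<and> code_at P (Suc p) xs"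
  by (auto simp: code_at_def All_less_Suc2 nth_Cons split: nat.splits)

lemma code_at_append [simp]:
  "code_at P p (xs @ ys) \<longleftrightarrow> code_at P p xs \<and> code_at P (p + length xs) ys"
  by (induction xs arbitrary: p) auto

definition runs :: "program \<Rightarrow> config \<Rightarrow> nat \<Rightarrow> config \<Rightarrow> bool" where
  "runs P c k c' \<longleftrightarrow> (step P ^^ k) c = c'"

lemma runs_0: "runs P c 0 c"
  by (simp add: runs_def)

lemma runs_Suc: "runs P (step P c) k c' \<Longrightarrow> runs P c (Suc k) c'"
  by (simp add: runs_def funpow_swap1)

lemma runs_trans: "runs P c k c' \<Longrightarrow> runs P c' l c'' \<Longrightarrow> runs P c (k + l) c''"
  unfolding runs_def using funpow_add[of l k "step P"] by (simp add: add.commute)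

lemma step_code_at:
  assumes "pc c < length P"
  shows "step P c = exec_instr (P ! pc c) c"
  using assms by (simp add: step_def halted_def)

lemma runs_addr_code:
  assumes "code_at P (pc c) (addr_code A x)" "represents L s c"
    and "guard L A (fst s x) (fst s)"
  shows "\<exists>c'. runs P c (length (addr_code A x)) c' \<and> pc c' = pc c + length (addr_code A x) \<and>
    represents L s c' \<and> regs c' 16 = address L A (fst s x)"
proof (cases "A = Inp")
  case True
  let ?c' = "step P (step P c)"
  have "runs P c 2 ?c'" by (simp add: runs_def eval_nat_numeral)
  moreover have "pc ?c' = pc c + 2 \<and> represents L s ?c' \<and> regs ?c' 16 = address L A (fst s x)"
    using assms True by (simp add: addr_code_def step_code_at represents_def address_def)
  moreover have "length (addr_code A x) = 2" using True by (simp add: addr_code_def)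
  ultimately show ?thesis by auto
next
  case False
  let ?c' = "step P (step P (step P (step P (step P (step P c)))))"
  have "regs c 4 = fst s vL" using assms(2) reg.simps(5) unfolding represents_def by metis
  have "runs P c 6 ?c'" by (simp add: runs_def eval_nat_numeral)
  moreover have "pc ?c' = pc c + 6 \<and> represents L s ?c' \<and> regs ?c' 16 = address L A (fst s x)"
    using assms False \<open>regs c 4 = fst s vL\<close>
    by (simp add: addr_code_def step_code_at represents_def address_def guard_def)
  moreover have "length (addr_code A x) = 6" using False by (simp add: addr_code_def)
  ultimately show ?thesis by auto
qed

text \<open>Without iterations each instruction is executed at most once, and each charged iteration
  adds at most one traversal. The product form survives sequencing since both parts fit under the
  factor \<open>Suc (t1 + t2)\<close>.\<close>

lemma compile_correct:
  assumes "exec L com s t s'" "represents L s c" "code_at P (pc c) (compile (pc c) com)"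
  shows "\<exists>k c'. runs P c k c' \<and> k \<le> length (compile (pc c) com) * Suc t \<and>
    represents L s' c' \<and> pc c' = pc c + length (compile (pc c) com)"
  using assms
proof (induction arbitrary: c rule: exec.induct)
  case (SKIP s)
  then show ?case using runs_0 by fastforce
next
  case (SET x k \<sigma> \<alpha>)
  then show ?case
    by (intro exI[of _ 1] exI[of _ "step P c"])
      (auto simp: runs_def step_code_at represents_def)
next
  case (ADD x y z \<sigma> \<alpha>)
  then show ?case
    by (intro exI[of _ 1] exI[of _ "step P c"])
      (auto simp: runs_def step_code_at represents_def)
next
  case (SUB x y z \<sigma> \<alpha>)
  then show ?case
    by (intro exI[of _ 1] exI[of _ "step P c"])
      (auto simp: runs_def step_code_at represents_def)
next
  case (LD A \<sigma> y x \<alpha>)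
  let ?n = "length (addr_code A y)"
  obtain c' where c': "runs P c ?n c'" "pc c' = pc c + ?n" "represents L (\<sigma>, \<alpha>) c'"
    "regs c' 16 = address L A (\<sigma> y)"
    using runs_addr_code[of P c A y L "(\<sigma>, \<alpha>)"] LD by auto
  have "runs P c (?n + 1) (step P c')"
    using c'(1) by (rule runs_trans) (simp add: runs_def)
  moreover have "represents L (\<sigma>(x := \<alpha> A (\<sigma> y)), \<alpha>) (step P c')"
    using LD c' by (auto simp: step_code_at represents_def guard_def)
  moreover have "pc (step P c') = pc c + (?n + 1)"
    using LD c' by (simp add: step_code_at)
  ultimately show ?case by fastforce
next
  case (ST A \<sigma> x y \<alpha>)
  let ?n = "length (addr_code A x)"
  obtain c' where c': "runs P c ?n c'" "pc c' = pc c + ?n" "represents L (\<sigma>, \<alpha>) c'"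
    "regs c' 16 = address L A (\<sigma> x)"
    using runs_addr_code[of P c A x L "(\<sigma>, \<alpha>)"] ST by auto
  have "runs P c (?n + 1) (step P c')"
    using c'(1) by (rule runs_trans) (simp add: runs_def)
  moreover have "represents L (\<sigma>, \<alpha>(A := (\<alpha> A)(\<sigma> x := \<sigma> y))) (step P c')"
    using ST c' by (auto simp: step_code_at represents_def address_eq_iff)
  moreover have "pc (step P c') = pc c + (?n + 1)"
    using ST c' by (simp add: step_code_at)
  ultimately show ?case by fastforce
next
  case (SEQ c1 s t1 s' c2 t2 s'')
  let ?p1 = "compile (pc c) c1"
  obtain k1 d where d: "runs P c k1 d" "k1 \<le> length ?p1 * Suc t1" "represents L s' d"
      "pc d = pc c + length ?p1"
    using SEQ.IH(1)[of c] SEQ.prems by (auto simp: Let_def)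
  let ?p2 = "compile (pc d) c2"
  obtain k2 e where e: "runs P d k2 e" "k2 \<le> length ?p2 * Suc t2" "represents L s'' e"
      "pc e = pc d + length ?p2"
    using SEQ.IH(2)[of d] SEQ.prems d by (auto simp: Let_def)
  have "runs P c (k1 + k2) e" using d e runs_trans by blast
  moreover have "k1 + k2 \<le> (length ?p1 + length ?p2) * Suc (t1 + t2)"
  proof -
    have "length ?p1 * Suc t1 \<le> length ?p1 * Suc (t1 + t2)"
         "length ?p2 * Suc t2 \<le> length ?p2 * Suc (t1 + t2)" by (intro mult_le_mono2; simp)+
    then show ?thesis using d(2) e(2) unfolding add_mult_distrib by linarith
  qed
  ultimately show ?case using d e
    by (intro exI[of _ "k1 + k2"] exI[of _ e]) (auto simp: Let_def)
next
  case (IF \<sigma> v c1 c2 \<alpha> t s')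
  let ?p1 = "compile (Suc (pc c)) c1"
  let ?q = "Suc (Suc (pc c)) + length ?p1"
  let ?p2 = "compile ?q c2"
  have v: "regs c (reg v) = \<sigma> v" using IF.prems by (simp add: represents_def)
  have rep: "represents L (\<sigma>, \<alpha>) (c\<lparr>pc := x\<rparr>)" for x
    using IF.prems by (simp add: represents_def)
  show ?case
  proof (cases "\<sigma> v = 0")
    case True
    let ?d = "c\<lparr>pc := ?q\<rparr>"
    obtain k e where e: "runs P ?d k e" "k \<le> length ?p2 * Suc t" "represents L s' e"
      "pc e = ?q + length ?p2"
      using IF.IH[of ?d] IF.prems True rep by (auto simp: Let_def)
    have "step P c = ?d" using IF.prems v True by (simp add: step_code_at Let_def)
    then have "runs P c (Suc k) e" using e by (intro runs_Suc) simp
    then show ?thesis using e by (intro exI[of _ "Suc k"] exI[of _ e]) (auto simp: Let_def algebra_simps)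
  next
    case False
    let ?d = "c\<lparr>pc := Suc (pc c)\<rparr>"
    obtain k e where e: "runs P ?d k e" "k \<le> length ?p1 * Suc t" "represents L s' e"
      "pc e = Suc (pc c) + length ?p1"
      using IF.IH[of ?d] IF.prems False rep by (auto simp: Let_def)
    have "step P c = ?d" using IF.prems v False by (simp add: step_code_at Let_def)
    then have 1: "runs P c (Suc k) e" using e by (intro runs_Suc) simp
    let ?f = "e\<lparr>pc := ?q + length ?p2\<rparr>"
    have "step P e = ?f" using IF.prems e by (simp add: step_code_at Let_def)
    then have "runs P e 1 ?f" by (simp add: runs_def)
    with 1 have "runs P c (Suc k + 1) ?f" by (rule runs_trans)
    moreover have "represents L s' ?f" using e(3) by (simp add: represents_def)
    ultimately show ?thesis using e
      by (intro exI[of _ "Suc k + 1"] exI[of _ ?f]) (auto simp: Let_def algebra_simps)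
  qed
next
  case (WHILE0 \<sigma> v com \<alpha>)
  let ?d = "c\<lparr>pc := Suc (Suc (pc c)) + length (compile (Suc (pc c)) com)\<rparr>"
  have "step P c = ?d" using WHILE0 by (simp add: step_code_at Let_def represents_def)
  then have "runs P c 1 ?d" by (simp add: runs_def)
  moreover have "represents L (\<sigma>, \<alpha>) ?d" using WHILE0 by (simp add: represents_def)
  ultimately show ?case by (intro exI[of _ 1] exI[of _ ?d]) (auto simp: Let_def)
next
  case (WHILE1 \<sigma> v com \<alpha> t1 s' t2 s'')
  let ?p1 = "compile (Suc (pc c)) com"
  let ?d = "c\<lparr>pc := Suc (pc c)\<rparr>"
  have "represents L (\<sigma>, \<alpha>) ?d" using WHILE1.prems by (simp add: represents_def)
  then obtain k e where e: "runs P ?d k e" "k \<le> length ?p1 * Suc t1" "represents L s' e"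
      "pc e = Suc (pc c) + length ?p1"
      using WHILE1.IH(1)[of ?d] WHILE1.prems by (auto simp: Let_def)
  have "step P c = ?d" using WHILE1 by (simp add: step_code_at Let_def represents_def)
  then have 1: "runs P c (Suc k) e" using e by (intro runs_Suc) simp
  let ?f = "e\<lparr>pc := pc c\<rparr>"
  have "step P e = ?f" using WHILE1.prems e by (simp add: step_code_at Let_def)
  then have "runs P e 1 ?f" by (simp add: runs_def)
  with 1 have 2: "runs P c (Suc k + 1) ?f" by (rule runs_trans)
  have "represents L s' ?f" using e(3) by (simp add: represents_def)
  then obtain k' g where g: "runs P ?f k' g" "k' \<le> (length ?p1 + 2) * Suc t2" "represents L s'' g"
      "pc g = pc c + (length ?p1 + 2)"
    using WHILE1.IH(2)[of ?f] WHILE1.prems by (auto simp: Let_def)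
  have "runs P c (Suc k + 1 + k') g" using 2 g(1) by (rule runs_trans)
  moreover have "Suc k + 1 + k' \<le> (length ?p1 + 2) * Suc (Suc (t1 + t2))"
    using e(2) g(2) by (simp add: algebra_simps)
  ultimately show ?case using g by (intro exI[of _ "Suc k + 1 + k'"] exI[of _ g]) (auto simp: Let_def)
qed

text \<open>The zero default matters: it means no transition counted, no preimage found and no mark
  set, so the arrays are used without initialisation.\<close>

definition initial_store :: "nat list \<Rightarrow> store" where
  "initial_store xs = (\<lambda>_. 0, \<lambda>A i. if A = Inp then xs ! i else 0)"

lemma decides_within_compile:
  assumes "wp (length xs) com (\<lambda>_ s. fst s vRes = (if \<phi> then 1 else 0)) T (initial_store xs)"
  shows "decides_within (compile 0 com) xs (length (compile 0 com) * Suc T) \<phi>"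
proof -
  let ?P = "compile 0 com"
  obtain t s' where s': "exec (length xs) com (initial_store xs) t s'" "t \<le> T"
      "fst s' vRes = (if \<phi> then 1 else 0)"
    using assms unfolding wp_def by blast
  have "represents (length xs) (initial_store xs) (start xs)"
    by (auto simp: represents_def start_def initial_store_def address_def)
  moreover have "code_at ?P 0 ?P" by (simp add: code_at_def)
  ultimately obtain k c' where k: "runs ?P (start xs) k c'" "k \<le> length ?P * Suc t"
      "represents (length xs) s' c'" "pc c' = length ?P"
    using compile_correct[OF s'(1), of "start xs" ?P] by (auto simp: start_def)
  have "k \<le> length ?P * Suc T" using k(2) s'(2) by (meson Suc_le_mono le_trans mult_le_mono2)
  moreover have "regs c' 0 = fst s' vRes" using k(3) reg.simps(1) unfolding represents_def by metis
  ultimately show ?thesis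
    using k s'(3) unfolding decides_within_def runs_def halted_def Let_def
    by (intro exI[of _ k]) auto
qed

section \<open>The decision program\<close>

text \<open>The counter \<open>vI\<close> runs upwards; \<open>vC\<close> holds the number of remaining rounds.\<close>

definition FOR :: "com \<Rightarrow> com" where
  "FOR body = SET vI 0 ;; SUB vC vN vI ;; WHILE vC (body ;; ADD vI vI vOne ;; SUB vC vN vI)"

definition COPY :: "var \<Rightarrow> var \<Rightarrow> com" where
  "COPY x y = SET x 0 ;; ADD x x y"

text \<open>
  \<open>vD\<close> and \<open>vZ\<close> are scratch. Throughout, \<open>vRes\<close> is a failure flag; it is complemented at the very end.
\<close>

definition CHECK :: "var \<Rightarrow> var \<Rightarrow> com" where
  "CHECK x y = SUB vZ y x ;; SUB vD x y ;; ADD vD vD vZ ;; IF vD (SET vRes 1) SKIP"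

lemma wp_COPY [simp]: "x \<noteq> y \<Longrightarrow> wp L (COPY x y) Q T (\<sigma>, \<alpha>) \<longleftrightarrow> Q T (\<sigma>(x := \<sigma> y), \<alpha>)"
  by (simp add: COPY_def)

text \<open>The two truncated differences add up to the distance of the values, which vanishes
  exactly at equality; the flag is only ever raised.\<close>

lemma wp_CHECK [simp]:
  assumes "x \<noteq> vD" "x \<noteq> vZ" "y \<noteq> vD" "y \<noteq> vZ"
  shows "wp L (CHECK x y) Q T (\<sigma>, \<alpha>) \<longleftrightarrow>
    Q T (\<sigma>(vZ := \<sigma> y - \<sigma> x, vD := \<sigma> x - \<sigma> y + (\<sigma> y - \<sigma> x),
      vRes := if \<sigma> x = \<sigma> y then \<sigma> vRes else 1), \<alpha>)"
proof -
  have "\<sigma>(vZ := u, vD := v, vRes := \<sigma> vRes) = \<sigma>(vZ := u, vD := v)" for u v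
    by (simp add: fun_eq_iff)
  then show ?thesis using assms by (auto simp: CHECK_def)
qed

text \<open>\<open>P\<close> describes the store after the counters have advanced, which keeps the
  bookkeeping out of the proofs about loop bodies.\<close>

lemma wp_FOR:
  assumes "\<sigma> vN = n" "\<sigma> vOne = 1"
    and init: "P 0 (\<sigma>(vI := 0, vC := n)) \<alpha>"
    and step: "\<And>i \<sigma> \<alpha>. i < n \<Longrightarrow> P i \<sigma> \<alpha> \<Longrightarrow> \<sigma> vI = i \<Longrightarrow> \<sigma> vN = n \<Longrightarrow> \<sigma> vOne = 1 \<Longrightarrow>
      wp L body (\<lambda>_ (\<sigma>', \<alpha>'). \<sigma>' vI = i \<and> \<sigma>' vN = n \<and> \<sigma>' vOne = 1 \<and>
        P (Suc i) (\<sigma>'(vI := Suc i, vC := n - Suc i)) \<alpha>') K (\<sigma>, \<alpha>)"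
    and post: "\<And>t \<sigma> \<alpha>. T' \<le> t \<Longrightarrow> P n \<sigma> \<alpha> \<Longrightarrow> Q t (\<sigma>, \<alpha>)"
    and T: "n * Suc K + T' \<le> T"
  shows "wp L (FOR body) Q T (\<sigma>, \<alpha>)"
proof -
  let ?I = "\<lambda>(\<sigma>, \<alpha>). \<exists>i\<le>n. \<sigma> vI = i \<and> \<sigma> vC = n - i \<and> \<sigma> vN = n \<and> \<sigma> vOne = 1 \<and> P i \<sigma> \<alpha>"
  have "wp L (WHILE vC (body ;; ADD vI vI vOne ;; SUB vC vN vI)) Q T (\<sigma>(vI := 0, vC := n), \<alpha>)"
  proof (rule wp_WHILE[where I = ?I and V = "\<lambda>s. fst s vC" and K = K and T' = T'])
    show "?I (\<sigma>(vI := 0, vC := n), \<alpha>)" using assms(1,2) init by auto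
    show "fst (\<sigma>(vI := 0, vC := n), \<alpha>) vC * Suc K + T' \<le> T" using T by simp
    show "Q t (\<sigma>, \<alpha>)" if "?I (\<sigma>, \<alpha>)" "\<sigma> vC = 0" "T' \<le> t" for t \<sigma> \<alpha>
      using that post by auto
    fix \<sigma> \<alpha> assume "?I (\<sigma>, \<alpha>)" "\<sigma> vC \<noteq> 0"
    then obtain i where i: "i < n" "\<sigma> vI = i" "\<sigma> vC = n - i" "\<sigma> vN = n" "\<sigma> vOne = 1" "P i \<sigma> \<alpha>"
      by auto
    from wp_mono[OF step[OF i(1,6,2,4,5)], where U = 0 and
      Q' = "wp L (ADD vI vI vOne ;; SUB vC vN vI) (\<lambda>_ s'. ?I s' \<and> fst s' vC < fst (\<sigma>, \<alpha>) vC)"]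
    show "wp L (body ;; ADD vI vI vOne ;; SUB vC vN vI) (\<lambda>_ s'. ?I s' \<and> fst s' vC < fst (\<sigma>, \<alpha>) vC) K (\<sigma>, \<alpha>)"
      using i by (auto simp: Suc_le_eq)
  qed
  then show ?thesis using assms(1) by (simp add: FOR_def)
qed

section \<open>Reading the input table\<close>

locale table =
  fixes b n L :: nat and d :: "nat \<Rightarrow> nat \<Rightarrow> nat" and F :: "nat set" and inp :: "nat \<Rightarrow> nat"
  assumes b: "1 < b" and d_less: "q < n \<Longrightarrow> a < b \<Longrightarrow> d q a < n"
    and L: "L = 3 + n + n * b"
    and inp_0: "inp 0 = b" and inp_1: "inp 1 = n"
    and inp_final: "q < n \<Longrightarrow> inp (3 + q) = (if q \<in> F then 1 else 0)"
    and inp_d: "q < n \<Longrightarrow> a < b \<Longrightarrow> inp (3 + n + q * b + a) = d q a"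
begin

definition env :: "(var \<Rightarrow> nat) \<Rightarrow> (arr \<Rightarrow> nat \<Rightarrow> nat) \<Rightarrow> bool" where
  "env \<sigma> \<alpha> \<longleftrightarrow> \<sigma> vOne = 1 \<and> \<sigma> vB = b \<and> \<sigma> vN = n \<and> \<sigma> vL = L \<and> \<alpha> Inp = inp"

lemma read_d:
  assumes "r = 3 + n + q * b + a" "q < n" "a < b"
  shows "inp r = d q a" "r < L"
proof -
  have "q * b + a < Suc q * b" using assms(3) by simp
  also have "\<dots> \<le> n * b" using assms(2) by (intro mult_le_mono1) simp
  finally show "r < L" using assms(1) L by simp
qed (use assms inp_d in simp)

text \<open>The input length 3 + n + n b (three header cells, the flags, the rows) is formed by
  adding b n times, for lack of multiplication.\<close>

definition prologue :: com where
  "prologue = SET vOne 1 ;; SET vX 0 ;; LD vB Inp vX ;; LD vN Inp vOne ;;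
    SET vL 3 ;; ADD vL vL vN ;; FOR (ADD vL vL vB)"

lemma prologue:
  assumes "\<sigma> = (\<lambda>_. 0)" "\<alpha> Inp = inp" "n + T' \<le> T"
    and post: "\<And>t \<sigma>. T' \<le> t \<Longrightarrow> env \<sigma> \<alpha> \<Longrightarrow> \<sigma> vRes = 0 \<Longrightarrow> Q t (\<sigma>, \<alpha>)"
  shows "wp L prologue Q T (\<sigma>, \<alpha>)"
proof -
  have inp1: "inp (Suc 0) = n" using inp_1 by simp
  let ?\<sigma> = "(\<lambda>_. 0)(vOne := 1, vX := 0, vB := b, vN := n, vL := 3 + n)"
  have "wp L (FOR (ADD vL vL vB)) Q T (?\<sigma>, \<alpha>)"
  proof (rule wp_FOR[where K = 0 and n = n and T' = T' and
        P = "\<lambda>i \<sigma> \<alpha>'. \<sigma> vOne = 1 \<and> \<sigma> vB = b \<and> \<sigma> vN = n \<and> \<sigma> vL = 3 + n + i * b \<and>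
          \<sigma> vRes = 0 \<and> \<alpha>' = \<alpha>"])
    show "Q t (\<sigma>, \<alpha>')" if "T' \<le> t" "\<sigma> vOne = 1 \<and> \<sigma> vB = b \<and> \<sigma> vN = n \<and> \<sigma> vL = 3 + n + n * b \<and>
          \<sigma> vRes = 0 \<and> \<alpha>' = \<alpha>" for t \<sigma> \<alpha>'
    proof -
      have "env \<sigma> \<alpha>" unfolding env_def using that assms(2) by (simp add: L)
      then show ?thesis using that post by simp
    qed
  qed (use assms(3) in auto)
  then show ?thesis
    using assms(1,2) L by (simp add: prologue_def guard_def inp_0 inp1 fun_upd_twist)
qed

definition hits :: "nat \<Rightarrow> nat \<Rightarrow> nat \<Rightarrow> nat" where
  "hits q j t = (\<Sum>a<j. if d q a = t then 1 else 0)"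

lemma hits_0 [simp]: "hits q 0 t = 0"
  and hits_Suc: "hits q (Suc j) t = hits q j t + (if d q j = t then 1 else 0)"
  by (simp_all add: hits_def)

definition count_edges :: com where
  "count_edges = WHILE vJ (LD vX Inp vR ;; LD vY Deg vX ;; ADD vY vY vOne ;; ST Deg vX vY ;;
     ADD vR vR vOne ;; SUB vJ vJ vOne)"

text \<open>\<open>vR\<close> crosses the table once, row after row; saving it at each row start
  tabulates the row addresses without multiplication.\<close>

definition scan :: com where
  "scan = SET vR 3 ;; ADD vR vR vN ;; FOR (ST Row vI vR ;; LD vX Inp vR ;; ST Zer vI vX ;;
     SET vD 3 ;; ADD vY vD vI ;; LD vY Inp vY ;; ADD vQ vD vX ;; LD vQ Inp vQ ;; CHECK vY vQ ;;
     COPY vJ vB ;; count_edges)"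

definition UP0_upto :: "nat \<Rightarrow> bool" where
  "UP0_upto i \<longleftrightarrow> (\<forall>q<i. q \<in> F \<longleftrightarrow> d q 0 \<in> F)"

definition blank :: "(arr \<Rightarrow> nat \<Rightarrow> nat) \<Rightarrow> bool" where
  "blank \<alpha> \<longleftrightarrow> \<alpha> Inv = (\<lambda>_. 0) \<and> \<alpha> Img = (\<lambda>_. 0) \<and> \<alpha> Dup = (\<lambda>_. 0)"

definition scanned :: "nat \<Rightarrow> (var \<Rightarrow> nat) \<Rightarrow> (arr \<Rightarrow> nat \<Rightarrow> nat) \<Rightarrow> bool" where
  "scanned i \<sigma> \<alpha> \<longleftrightarrow> env \<sigma> \<alpha> \<and> blank \<alpha> \<and> (\<forall>q<i. \<alpha> Row q = 3 + n + q * b \<and> \<alpha> Zer q = d q 0) \<and>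
     \<sigma> vRes = (if UP0_upto i then 0 else 1)"

lemma scanned_update [simp]:
  "x \<notin> {vOne, vB, vN, vL, vRes} \<Longrightarrow> scanned i (\<sigma>(x := v)) \<alpha> \<longleftrightarrow> scanned i \<sigma> \<alpha>"
  "X \<notin> {Inp, Row, Zer, Inv, Img, Dup} \<Longrightarrow> scanned i \<sigma> (\<alpha>(X := f)) \<longleftrightarrow> scanned i \<sigma> \<alpha>"
  by (cases x; simp add: scanned_def env_def blank_def) (cases X; simp add: scanned_def env_def blank_def)

lemma scannedD:
  assumes "scanned i \<sigma> \<alpha>"
  shows "\<sigma> vOne = 1" "\<sigma> vB = b" "\<sigma> vN = n" "\<sigma> vL = L" "\<alpha> Inp = inp"
    "q < i \<Longrightarrow> \<alpha> Row q = 3 + n + q * b" "q < i \<Longrightarrow> \<alpha> Zer q = d q 0"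
  using assms by (simp_all add: scanned_def env_def)

lemma scan:
  assumes "env \<sigma> \<alpha>" "\<sigma> vRes = 0" "blank \<alpha>" "\<alpha> Deg = (\<lambda>_. 0)" "n * Suc b + T' \<le> T"
    and post: "\<And>t \<sigma> \<alpha>. T' \<le> t \<Longrightarrow> scanned n \<sigma> \<alpha> \<Longrightarrow> \<alpha> Deg = (\<lambda>t. \<Sum>q<n. hits q b t) \<Longrightarrow> Q t (\<sigma>, \<alpha>)"
  shows "wp L scan Q T (\<sigma>, \<alpha>)"
proof -
  let ?P = "\<lambda>i \<sigma> \<alpha>. scanned i \<sigma> \<alpha> \<and> \<alpha> Deg = (\<lambda>t. \<Sum>q<i. hits q b t) \<and> \<sigma> vR = 3 + n + i * b"
  have "wp L (FOR (ST Row vI vR ;; LD vX Inp vR ;; ST Zer vI vX ;;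
     SET vD 3 ;; ADD vY vD vI ;; LD vY Inp vY ;; ADD vQ vD vX ;; LD vQ Inp vQ ;; CHECK vY vQ ;;
     COPY vJ vB ;; count_edges)) Q T (\<sigma>(vR := 3 + n), \<alpha>)"
  proof (rule wp_FOR[where K = b and n = n and T' = T' and P = ?P])
    show "?P 0 (\<sigma>(vR := 3 + n, vI := 0, vC := n)) \<alpha>"
      using assms by (simp add: scanned_def env_def UP0_upto_def)
    fix i \<sigma> \<alpha> assume i: "i < n" and P: "?P i \<sigma> \<alpha>" and vI: "\<sigma> vI = i"
    have R: "inp (3 + n + i * b) = d i 0" "3 + n + i * b < L" using read_d[of _ i 0] i b by auto
    have fin: "inp (3 + q) = (if q \<in> F then 1 else 0)" "3 + q < L" if "q < n" for q
      using inp_final[OF that] that L by auto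
    have z: "d i 0 < n" using d_less i b by simp
    \<comment> \<open>Row address, 0-successor and finality test of state i are complete before its
      transitions are counted; only \<open>Deg\<close> and the pointer still move.\<close>
    let ?P' = "\<lambda>j \<sigma>' \<alpha>'. scanned (Suc i) \<sigma>' \<alpha>' \<and> \<sigma>' vI = i \<and>
      \<alpha>' Deg = (\<lambda>t. (\<Sum>q<i. hits q b t) + hits i j t) \<and> \<sigma>' vR = 3 + n + i * b + j"
    have inner: "wp L count_edges (\<lambda>_ (\<sigma>', \<alpha>'). ?P' b \<sigma>' \<alpha>') b (\<sigma>', \<alpha>')"
      if "?P' 0 \<sigma>' \<alpha>'" "\<sigma>' vJ = b" for \<sigma>' \<alpha>'
      unfolding count_edges_def
    proof (rule wp_WHILE[where I = "\<lambda>(\<sigma>', \<alpha>'). \<sigma>' vJ \<le> b \<and> ?P' (b - \<sigma>' vJ) \<sigma>' \<alpha>'"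
          and V = "\<lambda>(\<sigma>', _). \<sigma>' vJ" and K = 0 and T' = 0])
      fix \<sigma>' \<alpha>' assume "case (\<sigma>', \<alpha>') of (\<sigma>', \<alpha>') \<Rightarrow> \<sigma>' vJ \<le> b \<and> ?P' (b - \<sigma>' vJ) \<sigma>' \<alpha>'"
        and J: "\<sigma>' vJ \<noteq> 0"
      then have P': "?P' (b - \<sigma>' vJ) \<sigma>' \<alpha>'" and J': "b - \<sigma>' vJ < b" "b - (\<sigma>' vJ - 1) = Suc (b - \<sigma>' vJ)"
        by auto
      have "inp (\<sigma>' vR) = d i (b - \<sigma>' vJ)" "\<sigma>' vR < L" using read_d[OF _ i J'(1)] P' by auto
      then show "wp L (LD vX Inp vR ;; LD vY Deg vX ;; ADD vY vY vOne ;; ST Deg vX vY ;;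
         ADD vR vR vOne ;; SUB vJ vJ vOne)
        (\<lambda>_ s'. (case s' of (\<sigma>', \<alpha>') \<Rightarrow> \<sigma>' vJ \<le> b \<and> ?P' (b - \<sigma>' vJ) \<sigma>' \<alpha>') \<and>
          (case s' of (\<sigma>', _) \<Rightarrow> \<sigma>' vJ) < (case (\<sigma>', \<alpha>') of (\<sigma>', _) \<Rightarrow> \<sigma>' vJ)) 0 (\<sigma>', \<alpha>')"
        using P' J J' by (simp add: scanned_def env_def guard_def blank_def hits_Suc fun_eq_iff)
    qed (use that in auto)
    have body: "wp L (ST Row vI vR ;; LD vX Inp vR ;; ST Zer vI vX ;;
       SET vD 3 ;; ADD vY vD vI ;; LD vY Inp vY ;; ADD vQ vD vX ;; LD vQ Inp vQ ;; CHECK vY vQ ;;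
       COPY vJ vB ;; count_edges) Q' b (\<sigma>, \<alpha>)"
      if cont: "\<And>t \<sigma>' \<alpha>'. ?P' b \<sigma>' \<alpha>' \<Longrightarrow> Q' t (\<sigma>', \<alpha>')" for Q'
    proof -
      have *: "wp L count_edges Q' b (\<sigma>', \<alpha>')" if "?P' 0 \<sigma>' \<alpha>'" "\<sigma>' vJ = b" for \<sigma>' \<alpha>'
        using wp_mono[OF inner[OF that], where U = 0 and Q' = Q'] cont by auto
      show ?thesis
        using P vI i
        apply (simp add: R fin z scanned_def env_def guard_def split del: if_split)
        apply (rule *)
        by (simp_all add: scanned_def env_def blank_def UP0_upto_def All_less_Suc)
    qed
    show "wp L (ST Row vI vR ;; LD vX Inp vR ;; ST Zer vI vX ;;
       SET vD 3 ;; ADD vY vD vI ;; LD vY Inp vY ;; ADD vQ vD vX ;; LD vQ Inp vQ ;; CHECK vY vQ ;;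
       COPY vJ vB ;; count_edges)
       (\<lambda>_ (\<sigma>', \<alpha>'). \<sigma>' vI = i \<and> \<sigma>' vN = n \<and> \<sigma>' vOne = 1 \<and>
         ?P (Suc i) (\<sigma>'(vI := Suc i, vC := n - Suc i)) \<alpha>') b (\<sigma>, \<alpha>)"
      by (rule body) (simp add: scanned_def env_def add.assoc add.commute)
  qed (use assms post in \<open>auto simp: env_def\<close>)
  then show ?thesis using assms(1) by (simp add: scan_def env_def)
qed

lemma hits_mono: "j \<le> k \<Longrightarrow> hits q j t \<le> hits q k t"
  unfolding hits_def by (intro sum_mono2) auto

lemma hits_pos_iff: "0 < hits q j t \<longleftrightarrow> (\<exists>a<j. d q a = t)"
  proof -
  have "hits q j t = 0 \<longleftrightarrow> (\<forall>a<j. d q a \<noteq> t)" by (auto simp: hits_def)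
  then show ?thesis by auto
qed

text \<open>
  Kahn's algorithm. \<open>Deg\<close> counts the incoming transitions whose source has not been processed, and
  a state is enqueued exactly when this count drops to 0, so at any time the enqueued states are
  those with \<open>g t = 0\<close>. When the queue is exhausted, the states with \<open>g t \<noteq> 0\<close> are
  those reachable from a circuit.
\<close>

definition queue :: "nat \<Rightarrow> (nat \<Rightarrow> nat) \<Rightarrow> (nat \<Rightarrow> nat) \<Rightarrow> bool" where
  "queue k q g \<longleftrightarrow> inj_on q {..<k} \<and> q ` {..<k} = {t. t < n \<and> g t = 0} \<and>
     (\<forall>j<k. \<forall>p<n. \<forall>a<b. d p a = q j \<longrightarrow> p \<in> q ` {..<j})"

lemma queue_length: "queue k q g \<Longrightarrow> k \<le> n"
proof -
  assume "queue k q g"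
  then have "inj_on q {..<k}" "q ` {..<k} \<subseteq> {..<n}" by (auto simp: queue_def)
  then show "k \<le> n" using card_inj_on_le[of q "{..<k}" "{..<n}"] by simp
qed

lemma queue_decrement: "queue k q g \<Longrightarrow> g t \<noteq> 0 \<Longrightarrow> c \<noteq> 0 \<Longrightarrow> queue k q (g(t := c))"
  by (auto simp: queue_def)

text \<open>The last premise keeps the queue topologically sorted, from which the rank outside the
  kernel is obtained later.\<close>

lemma queue_push:
  assumes "queue k q g" "t < n" "g t \<noteq> 0" "\<And>p a. p < n \<Longrightarrow> a < b \<Longrightarrow> d p a = t \<Longrightarrow> p \<in> q ` {..<k}"
  shows "queue (Suc k) (q(k := t)) (g(t := 0))"
proof -
  have img: "(q(k := t)) ` {..<j} = q ` {..<j}" if "j \<le> k" for j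
    using that by (intro image_cong) auto
  have new: "t \<notin> q ` {..<k}" using assms by (auto simp: queue_def)
  have "inj_on (q(k := t)) {..<k}"
    using assms(1) by (subst inj_on_cong[of _ _ q]) (auto simp: queue_def)
  then have "inj_on (q(k := t)) {..<Suc k}"
    using new img[of k] by (simp add: lessThan_Suc)
  moreover have "(q(k := t)) ` {..<Suc k} = {s. s < n \<and> (g(t := 0)) s = 0}"
    using img[of k] assms(1,2) by (auto simp: lessThan_Suc queue_def)
  moreover have "\<forall>p<n. \<forall>a<b. d p a = (q(k := t)) j \<longrightarrow> p \<in> (q(k := t)) ` {..<j}" if "j < Suc k" for j
    using that assms(1,4) img[of j] by (cases "j = k") (auto simp: queue_def)
  ultimately show ?thesis unfolding queue_def by blast
qed

text \<open>h is the number of processed and k that of enqueued states.\<close>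

definition peeled :: "nat \<Rightarrow> nat \<Rightarrow> (nat \<Rightarrow> nat) \<Rightarrow> (nat \<Rightarrow> nat) \<Rightarrow> bool" where
  "peeled h k q g \<longleftrightarrow> queue k q g \<and> h \<le> k \<and> (\<forall>t. g t = (\<Sum>p\<in>{..<n} - q ` {..<h}. hits p b t))"

text \<open>Here the first \<open>j\<close> transitions leaving the queue's element number \<open>h\<close> have been removed as well.\<close>

definition peeling :: "nat \<Rightarrow> nat \<Rightarrow> nat \<Rightarrow> (nat \<Rightarrow> nat) \<Rightarrow> (nat \<Rightarrow> nat) \<Rightarrow> bool" where
  "peeling h j k q g \<longleftrightarrow> queue k q g \<and> h < k \<and>
     (\<forall>t. g t = (\<Sum>p\<in>{..<n} - q ` {..<Suc h}. hits p b t) + (hits (q h) b t - hits (q h) j t))"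

lemma queue_less: "queue k q g \<Longrightarrow> j < k \<Longrightarrow> q j < n"
  by (auto simp: queue_def)

lemma peeling_0:
  assumes "peeled h k q g" "h < k"
  shows "peeling h 0 k q g"
proof -
  have q: "queue k q g" using assms by (simp add: peeled_def)
  have "q h \<notin> q ` {..<h}"
    using q assms(2) by (auto simp: queue_def inj_on_def) (metis lessThan_iff less_irrefl less_trans)
  then have "{..<n} - q ` {..<h} = insert (q h) ({..<n} - q ` {..<Suc h})"
    using queue_less[OF q assms(2)] by (auto simp: lessThan_Suc)
  moreover have "finite ({..<n} - q ` {..<Suc h})" "q h \<notin> {..<n} - q ` {..<Suc h}" by auto
  ultimately have "(\<Sum>p\<in>{..<n} - q ` {..<h}. hits p b t) =
      (\<Sum>p\<in>{..<n} - q ` {..<Suc h}. hits p b t) + hits (q h) b t" for t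
    by (metis add.commute sum.insert)
  then show ?thesis using assms unfolding peeled_def peeling_def by simp
qed

lemma peeled_Suc: "peeling h b k q g \<Longrightarrow> peeled (Suc h) k q g"
  by (simp add: peeling_def peeled_def Suc_le_eq)

lemma peeling_Suc:
  assumes P: "peeling h j k q g" and j: "j < b" and t: "t = d (q h) j"
  shows "peeling h (Suc j) (if g t = 1 then Suc k else k) (if g t = 1 then q(k := t) else q) (g(t := g t - 1))"
    and "t < n"
proof -
  let ?U = "\<lambda>q. {..<n} - q ` {..<Suc h}"
  have q: "queue k q g" and h: "h < k"
    and g: "\<And>t. g t = (\<Sum>p\<in>?U q. hits p b t) + (hits (q h) b t - hits (q h) j t)"
    using P by (simp_all add: peeling_def)
  show "t < n" using d_less[OF queue_less[OF q h] j] t by simp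
  have le: "hits (q h) (Suc j) s \<le> hits (q h) b s" for s using j by (intro hits_mono) simp
  have pos: "g t \<noteq> 0" using le[of t] t by (simp add: g hits_Suc)
  have g': "(g(t := g t - 1)) s = (\<Sum>p\<in>?U q. hits p b s) + (hits (q h) b s - hits (q h) (Suc j) s)" for s
  proof -
    define e :: nat where "e = (if s = t then 1 else 0)"
    have "(g(t := g t - 1)) s = g s - e" by (simp add: e_def)
    moreover have "hits (q h) (Suc j) s = hits (q h) j s + e" using t by (auto simp: hits_Suc e_def)
    ultimately show ?thesis using le[of s] g[of s] by linarith
  qed
  show "peeling h (Suc j) (if g t = 1 then Suc k else k) (if g t = 1 then q(k := t) else q) (g(t := g t - 1))"
  proof (cases "g t = 1")
    case False
    then show ?thesis
      unfolding peeling_def using queue_decrement[OF q pos, of "g t - 1"] pos h g' by simp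
  next
    case True
    have img: "(q(k := t)) ` {..<Suc h} = q ` {..<Suc h}" using h by (intro image_cong) auto
    \<comment> \<open>A count of 1 means that the removed transition was the last one from an
      unprocessed source, so all predecessors are already enqueued.\<close>
    have "p \<in> q ` {..<k}" if p: "p < n" "a < b" "d p a = t" for p a
    proof (rule ccontr)
      assume "p \<notin> q ` {..<k}"
      then have "p \<in> ?U q" using p h by auto
      moreover have "(\<Sum>p\<in>?U q. hits p b t) = 0"
        using g'[of t] True by simp
      ultimately have "hits p b t = 0" by simp
      then show False using hits_pos_iff[of p b t] p by auto
    qed
    then have "queue (Suc k) (q(k := t)) (g(t := 0))" using queue_push[OF q \<open>t < n\<close> pos] by blast
    then show ?thesis
      unfolding peeling_def using True h g' img by simp
  qed
qed

text \<open>The rank r certifies that no circuit passes outside \<open>K\<close>, without mentioning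
  paths.\<close>

definition is_kernel :: "nat set \<Rightarrow> bool" where
  "is_kernel K \<longleftrightarrow> K \<subseteq> {..<n} \<and> (\<forall>q\<in>K. \<forall>a<b. d q a \<in> K) \<and>
     (\<forall>q\<in>K. \<exists>p\<in>K. \<exists>a<b. d p a = q) \<and>
     (\<exists>r :: nat \<Rightarrow> nat. \<forall>p<n. \<forall>a<b. d p a \<notin> K \<longrightarrow> r p < r (d p a))"

text \<open>The rank is the position in the queue. With the queue exhausted, the counts range over
  sources in \<open>K\<close> only, so a state has a non-zero count iff it has a predecessor in
  \<open>K\<close>.\<close>

lemma is_kernel_peeled:
  assumes "peeled k k q g" and K: "K = {t. t < n \<and> g t \<noteq> 0}"
  shows "is_kernel K"
proof -
  have q: "queue k q g" and g: "\<And>t. g t = (\<Sum>p\<in>{..<n} - q ` {..<k}. hits p b t)"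
    using assms by (simp_all add: peeled_def)
  have K_eq: "{..<n} - q ` {..<k} = K" using q by (auto simp: queue_def K)
  have "finite K" by (simp add: K)
  then have "g t = 0 \<longleftrightarrow> (\<forall>p\<in>K. hits p b t = 0)" for t by (simp add: g K_eq)
  then have g_iff: "g t \<noteq> 0 \<longleftrightarrow> (\<exists>p\<in>K. \<exists>a<b. d p a = t)" for t
    using hits_pos_iff[of _ b t] by (metis neq0_conv)
  let ?r = "inv_into {..<k} q"
  have rank: "?r p < ?r (d p a)" if p: "p < n" "a < b" "d p a \<notin> K" for p a
  proof -
    have inj: "inj_on q {..<k}" using q by (simp add: queue_def)
    have "d p a \<in> q ` {..<k}" using q p d_less by (auto simp: queue_def K)
    then obtain j where j: "j < k" "d p a = q j" by auto
    then have "p \<in> q ` {..<j}" using q p unfolding queue_def by blast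
    then obtain i where i: "i < j" "p = q i" by auto
    have "?r (q j) = j" "?r (q i) = i" using inj i j by (auto intro!: inv_into_f_f)
    then show ?thesis using i j by simp
  qed
  have "d q a \<in> K" if "q \<in> K" "a < b" for q a
    using that g_iff[of "d q a"] d_less[of q a] unfolding K by blast
  moreover have "\<exists>p\<in>K. \<exists>a<b. d p a = q" if "q \<in> K" for q
    using that g_iff[of q] unfolding K by blast
  moreover have "K \<subseteq> {..<n}" by (auto simp: K)
  ultimately show ?thesis unfolding is_kernel_def using rank by blast
qed

definition fill_queue :: com where
  "fill_queue = SET vT 0 ;;
     FOR (LD vX Deg vI ;; IF vX SKIP (ST Que vT vI ;; ADD vT vT vOne))"

lemma fill_queue:
  assumes "scanned n \<sigma> \<alpha>" "\<alpha> Deg = (\<lambda>t. \<Sum>q<n. hits q b t)" "n + T' \<le> T"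
    and post: "\<And>t \<sigma> \<alpha>. T' \<le> t \<Longrightarrow> scanned n \<sigma> \<alpha> \<Longrightarrow> peeled 0 (\<sigma> vT) (\<alpha> Que) (\<alpha> Deg) \<Longrightarrow> Q t (\<sigma>, \<alpha>)"
  shows "wp L fill_queue Q T (\<sigma>, \<alpha>)"
proof -
  define g where "g = (\<lambda>t. \<Sum>q<n. hits q b t)"
  have "wp L (FOR (LD vX Deg vI ;; IF vX SKIP (ST Que vT vI ;; ADD vT vT vOne))) Q T (\<sigma>(vT := 0), \<alpha>)"
  proof (rule wp_FOR[where K = 0 and n = n and T' = T' and P = "\<lambda>i \<sigma> \<alpha>. scanned n \<sigma> \<alpha> \<and>
      \<alpha> Deg = g \<and> inj_on (\<alpha> Que) {..<\<sigma> vT} \<and> \<alpha> Que ` {..<\<sigma> vT} = {t. t < i \<and> g t = 0}"])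
    fix i \<sigma> \<alpha>
    assume i: "i < n" "\<sigma> vI = i" "\<sigma> vN = n" "\<sigma> vOne = 1" and P: "scanned n \<sigma> \<alpha> \<and>
      \<alpha> Deg = g \<and> inj_on (\<alpha> Que) {..<\<sigma> vT} \<and> \<alpha> Que ` {..<\<sigma> vT} = {t. t < i \<and> g t = 0}"
    note sc = scannedD[OF conjunct1[OF P]]
    let ?q = "(\<alpha> Que)(\<sigma> vT := i)"
    have img: "?q ` {..<\<sigma> vT} = \<alpha> Que ` {..<\<sigma> vT}" by (intro image_cong) auto
    have "inj_on ?q {..<\<sigma> vT}" using P by (subst inj_on_cong[of _ _ "\<alpha> Que"]) auto
    then have inj: "inj_on ?q {..<Suc (\<sigma> vT)}" using P img by (simp add: lessThan_Suc)
    have img1: "?q ` {..<Suc (\<sigma> vT)} = {t. t < Suc i \<and> g t = 0}" if "g i = 0"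
      using P img that by (auto simp: lessThan_Suc less_Suc_eq)
    have img0: "{t. t < i \<and> g t = 0} = {t. t < Suc i \<and> g t = 0}" if "g i \<noteq> 0"
      using that by (auto simp: less_Suc_eq)
    show "wp L (LD vX Deg vI ;; IF vX SKIP (ST Que vT vI ;; ADD vT vT vOne))
      (\<lambda>_ (\<sigma>', \<alpha>'). \<sigma>' vI = i \<and> \<sigma>' vN = n \<and> \<sigma>' vOne = 1 \<and>
        scanned n (\<sigma>'(vI := Suc i, vC := n - Suc i)) \<alpha>' \<and> \<alpha>' Deg = g \<and>
        inj_on (\<alpha>' Que) {..<(\<sigma>'(vI := Suc i, vC := n - Suc i)) vT} \<and>
        \<alpha>' Que ` {..<(\<sigma>'(vI := Suc i, vC := n - Suc i)) vT} = {t. t < Suc i \<and> g t = 0}) 0 (\<sigma>, \<alpha>)"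
    proof (cases "g i = 0")
      case True
      then show ?thesis using P i inj img1 by (simp add: sc guard_def)
    next
      case False
      then show ?thesis using P i img0 by (simp add: sc guard_def)
    qed
  next
    fix t \<sigma> \<alpha> assume "T' \<le> t" and P: "scanned n \<sigma> \<alpha> \<and>
      \<alpha> Deg = g \<and> inj_on (\<alpha> Que) {..<\<sigma> vT} \<and> \<alpha> Que ` {..<\<sigma> vT} = {t. t < n \<and> g t = 0}"
    have "d p a \<noteq> \<alpha> Que j" if "j < \<sigma> vT" "p < n" "a < b" for j p a
    proof -
      have "\<alpha> Que j \<in> \<alpha> Que ` {..<\<sigma> vT}" using that by simp
      then have "g (\<alpha> Que j) = 0" using P by simp
      then have "hits p b (\<alpha> Que j) = 0" using that by (simp add: g_def)
      then show ?thesis using hits_pos_iff[of p b "\<alpha> Que j"] that by auto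
    qed
    then have "peeled 0 (\<sigma> vT) (\<alpha> Que) (\<alpha> Deg)" using P by (simp add: peeled_def queue_def) (simp add: g_def)
    then show "Q t (\<sigma>, \<alpha>)" using \<open>T' \<le> t\<close> P post by blast
  qed (use assms in \<open>simp_all add: scannedD g_def\<close>)
  then show ?thesis by (simp add: fill_queue_def)
qed

definition remove_edges :: com where
  "remove_edges = WHILE vJ (LD vX Inp vR ;; LD vY Deg vX ;; SUB vY vY vOne ;; ST Deg vX vY ;;
     ADD vR vR vOne ;; SUB vJ vJ vOne ;; IF vY SKIP (ST Que vT vX ;; ADD vT vT vOne))"

definition peel :: com where
  "peel = SET vH 0 ;; COPY vC vT ;; WHILE vC (LD vQ Que vH ;; ADD vH vH vOne ;; LD vR Row vQ ;;
     COPY vJ vB ;; remove_edges ;; SUB vC vT vH)"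

lemma remove_edges:
  assumes "scanned n \<sigma> \<alpha>" "\<sigma> vJ = b" "\<sigma> vH = Suc h" "\<sigma> vR = 3 + n + \<alpha> Que h * b"
    "peeling h 0 (\<sigma> vT) (\<alpha> Que) (\<alpha> Deg)"
    and post: "\<And>t \<sigma> \<alpha>. scanned n \<sigma> \<alpha> \<Longrightarrow> \<sigma> vH = Suc h \<Longrightarrow> peeled (Suc h) (\<sigma> vT) (\<alpha> Que) (\<alpha> Deg) \<Longrightarrow> Q t (\<sigma>, \<alpha>)"
  shows "wp L remove_edges Q b (\<sigma>, \<alpha>)"
  unfolding remove_edges_def
proof (rule wp_WHILE[where V = "\<lambda>(\<sigma>', _). \<sigma>' vJ" and K = 0 and T' = 0 and
    I = "\<lambda>(\<sigma>', \<alpha>'). scanned n \<sigma>' \<alpha>' \<and> \<sigma>' vJ \<le> b \<and> \<sigma>' vH = Suc h \<and>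
      \<sigma>' vR = 3 + n + \<alpha>' Que h * b + (b - \<sigma>' vJ) \<and> peeling h (b - \<sigma>' vJ) (\<sigma>' vT) (\<alpha>' Que) (\<alpha>' Deg)"])
  let ?I = "\<lambda>s. (case s of (\<sigma>', \<alpha>') \<Rightarrow> scanned n \<sigma>' \<alpha>' \<and> \<sigma>' vJ \<le> b \<and> \<sigma>' vH = Suc h \<and>
      \<sigma>' vR = 3 + n + \<alpha>' Que h * b + (b - \<sigma>' vJ) \<and> peeling h (b - \<sigma>' vJ) (\<sigma>' vT) (\<alpha>' Que) (\<alpha>' Deg))"
  fix \<sigma> \<alpha> assume "?I (\<sigma>, \<alpha>)" and J: "\<sigma> vJ \<noteq> 0"
  then have I: "scanned n \<sigma> \<alpha>" "\<sigma> vJ \<le> b" "\<sigma> vH = Suc h" "\<sigma> vR = 3 + n + \<alpha> Que h * b + (b - \<sigma> vJ)"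
    and P: "peeling h (b - \<sigma> vJ) (\<sigma> vT) (\<alpha> Que) (\<alpha> Deg)"
    and J': "b - \<sigma> vJ < b" "b - (\<sigma> vJ - 1) = Suc (b - \<sigma> vJ)" by auto
  have Qh: "\<alpha> Que h < n" "h < \<sigma> vT" using P queue_less by (auto simp: peeling_def)
  let ?t = "d (\<alpha> Que h) (b - \<sigma> vJ)"
  have R: "inp (3 + n + \<alpha> Que h * b + (b - \<sigma> vJ)) = ?t" "3 + n + \<alpha> Que h * b + (b - \<sigma> vJ) < L"
    using read_d[OF refl Qh(1) J'(1)] by auto
  \<comment> \<open>The transition about to be removed is still counted; so the truncated
    subtraction is exact and no state is enqueued twice.\<close>
  have pos: "\<alpha> Deg ?t \<noteq> 0"
  proof -
    have "hits (\<alpha> Que h) (Suc (b - \<sigma> vJ)) ?t \<le> hits (\<alpha> Que h) b ?t"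
      using J'(1) by (intro hits_mono) simp
    then show ?thesis using P by (simp add: peeling_def hits_Suc)
  qed
  note step = peeling_Suc(1)[OF P J'(1) refl]
  show "wp L (LD vX Inp vR ;; LD vY Deg vX ;; SUB vY vY vOne ;; ST Deg vX vY ;;
     ADD vR vR vOne ;; SUB vJ vJ vOne ;; IF vY SKIP (ST Que vT vX ;; ADD vT vT vOne))
     (\<lambda>_ s'. ?I s' \<and> (case s' of (\<sigma>', _) \<Rightarrow> \<sigma>' vJ) < (case (\<sigma>, \<alpha>) of (\<sigma>', _) \<Rightarrow> \<sigma>' vJ)) 0 (\<sigma>, \<alpha>)"
  proof (cases "\<alpha> Deg ?t = 1")
    case True
    then show ?thesis using I J J'(2) Qh R step
      by (simp add: scannedD[OF I(1)] guard_def)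
  next
    case False
    then have "\<alpha> Deg ?t - Suc 0 \<noteq> 0" using pos by simp
    then show ?thesis using I J J'(2) Qh R step False
      by (simp add: scannedD[OF I(1)] guard_def)
  qed
qed (use assms peeled_Suc in auto)

lemma peel:
  assumes "scanned n \<sigma> \<alpha>" "peeled 0 (\<sigma> vT) (\<alpha> Que) (\<alpha> Deg)" "n * Suc b + T' \<le> T"
    and post: "\<And>t \<sigma> \<alpha>. T' \<le> t \<Longrightarrow> scanned n \<sigma> \<alpha> \<Longrightarrow> is_kernel {q. q < n \<and> \<alpha> Deg q \<noteq> 0} \<Longrightarrow> Q t (\<sigma>, \<alpha>)"
  shows "wp L peel Q T (\<sigma>, \<alpha>)"
proof -
  let ?I = "\<lambda>s. case s of (\<sigma>, \<alpha>) \<Rightarrow> scanned n \<sigma> \<alpha> \<and> peeled (\<sigma> vH) (\<sigma> vT) (\<alpha> Que) (\<alpha> Deg) \<and>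
    \<sigma> vC = \<sigma> vT - \<sigma> vH"
  \<comment> \<open>The loop stops when the queue is empty, but its length varies; the bound n on
    processed states limits the rounds.\<close>
  let ?V = "\<lambda>s. case s of (\<sigma>, _) \<Rightarrow> n - \<sigma> vH"
  have "wp L (WHILE vC (LD vQ Que vH ;; ADD vH vH vOne ;; LD vR Row vQ ;;
     COPY vJ vB ;; remove_edges ;; SUB vC vT vH)) Q T (\<sigma>(vH := 0, vC := \<sigma> vT), \<alpha>)"
  proof (rule wp_WHILE[where I = ?I and V = ?V and K = b and T' = T'])
    fix \<sigma> \<alpha> assume "?I (\<sigma>, \<alpha>)" "\<sigma> vC \<noteq> 0"
    then have I: "scanned n \<sigma> \<alpha>" "peeled (\<sigma> vH) (\<sigma> vT) (\<alpha> Que) (\<alpha> Deg)" "\<sigma> vH < \<sigma> vT" by auto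
    then have P: "peeling (\<sigma> vH) 0 (\<sigma> vT) (\<alpha> Que) (\<alpha> Deg)" by (intro peeling_0)
    have q: "queue (\<sigma> vT) (\<alpha> Que) (\<alpha> Deg)" using P by (simp add: peeling_def)
    have h: "\<alpha> Que (\<sigma> vH) < n" "\<sigma> vH < n" using queue_less[OF q I(3)] queue_length[OF q] I(3) by auto
    show "wp L (LD vQ Que vH ;; ADD vH vH vOne ;; LD vR Row vQ ;; COPY vJ vB ;; remove_edges ;; SUB vC vT vH)
      (\<lambda>_ s'. ?I s' \<and> ?V s' < ?V (\<sigma>, \<alpha>)) b (\<sigma>, \<alpha>)"
      using h
      apply (simp add: scannedD[OF I(1)] guard_def)
      apply (rule remove_edges[where h = "\<sigma> vH"])
      using I(1) P by (auto simp: scannedD[OF I(1)])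
  next
    fix t \<sigma> \<alpha> assume "?I (\<sigma>, \<alpha>)" "\<sigma> vC = 0" "T' \<le> t"
    moreover from this have "peeled (\<sigma> vT) (\<sigma> vT) (\<alpha> Que) (\<alpha> Deg)"
      by (simp add: peeled_def) (metis le_antisym)
    ultimately show "Q t (\<sigma>, \<alpha>)" using post is_kernel_peeled[OF _ refl] by auto
  qed (use assms in \<open>auto simp: scanned_def env_def\<close>)
  then show ?thesis by (simp add: peel_def)
qed

section \<open>Checking coherence of the kernel\<close>

definition z :: "nat \<Rightarrow> nat" where
  "z q = d q 0"

definition tau :: "nat set \<Rightarrow> nat \<Rightarrow> nat" where
  "tau K q = inv_into K z (d q 1)"

text \<open>A copy of \<open>kernel.coherent\<close> over the bare table, so that the program is
  verified without reference to automata; the two are identified in the final theorem.\<close>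

definition coherent :: "nat set \<Rightarrow> bool" where
  "coherent K \<longleftrightarrow> inj_on z K \<and> (\<forall>q\<in>K. \<forall>a<b. z ((tau K ^^ a) q) = d q a) \<and>
     (\<forall>q\<in>K. tau K (z q) = z ((tau K ^^ b) q)) \<and> inj_on (tau K) (tau K ` K)"

end

locale table_kernel = table +
  fixes K :: "nat set"
  assumes is_kernel: "is_kernel K"
begin

abbreviation \<tau> :: "nat \<Rightarrow> nat" where "\<tau> \<equiv> tau K"

lemma K_less: "q \<in> K \<Longrightarrow> q < n"
  and K_closed: "q \<in> K \<Longrightarrow> a < b \<Longrightarrow> d q a \<in> K"
  using is_kernel by (auto simp: is_kernel_def)

lemma finite_K: "finite K"
  using K_less by (intro finite_subset[of K "{..<n}"]) auto

lemma z_K: "q \<in> K \<Longrightarrow> z q \<in> K"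
  using K_closed b by (simp add: z_def)

definition below :: "nat \<Rightarrow> nat set" where
  "below i = K \<inter> {..<i}"

lemma below_0 [simp]: "below 0 = {}"
  and below_Suc: "below (Suc i) = (if i \<in> K then insert i (below i) else below i)"
  and below_n [simp]: "below n = K"
  and not_below [simp]: "i \<notin> below i"
  using K_less by (auto simp: below_def less_Suc_eq)

definition ready :: "(var \<Rightarrow> nat) \<Rightarrow> (arr \<Rightarrow> nat \<Rightarrow> nat) \<Rightarrow> bool" where
  "ready \<sigma> \<alpha> \<longleftrightarrow> env \<sigma> \<alpha> \<and> (\<forall>q<n. \<alpha> Row q = 3 + n + q * b \<and> \<alpha> Zer q = z q \<and> (\<alpha> Deg q = 0 \<longleftrightarrow> q \<notin> K))"

lemma ready_update [simp]:
  "x \<notin> {vOne, vB, vN, vL} \<Longrightarrow> ready (\<sigma>(x := v)) \<alpha> \<longleftrightarrow> ready \<sigma> \<alpha>"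
  "X \<notin> {Inp, Row, Zer, Deg} \<Longrightarrow> ready \<sigma> (\<alpha>(X := f)) \<longleftrightarrow> ready \<sigma> \<alpha>"
  by (cases x; simp add: ready_def env_def) (cases X; simp add: ready_def env_def)

lemma readyD:
  assumes "ready \<sigma> \<alpha>"
  shows "\<sigma> vOne = 1" "\<sigma> vB = b" "\<sigma> vN = n" "\<sigma> vL = L" "\<alpha> Inp = inp"
    "q < n \<Longrightarrow> \<alpha> Row q = 3 + n + q * b" "q < n \<Longrightarrow> \<alpha> Zer q = z q" "q < n \<Longrightarrow> \<alpha> Deg q = 0 \<longleftrightarrow> q \<notin> K"
  using assms by (simp_all add: ready_def env_def)

text \<open>The inverse of the digit 0 is stored shifted by one, 0 meaning that no preimage has been found.\<close>

definition inverts :: "nat \<Rightarrow> (nat \<Rightarrow> nat) \<Rightarrow> bool" where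
  "inverts i v \<longleftrightarrow> (\<forall>s. v s = 0 \<longleftrightarrow> s \<notin> z ` below i) \<and>
     (inj_on z (below i) \<longrightarrow> (\<forall>q\<in>below i. v (z q) = Suc q))"

text \<open>A collision shows as a cell that is already filled. It is then overwritten, which is why
  the stored values are trusted only under injectivity.\<close>

lemma inverts_Suc:
  assumes "inverts i v" "i \<in> K"
  shows "inverts (Suc i) (v(z i := Suc i))"
    and "inj_on z (below (Suc i)) \<longleftrightarrow> inj_on z (below i) \<and> v (z i) = 0"
proof -
  have "v (z i) = 0 \<longleftrightarrow> z i \<notin> z ` below i" using assms(1) unfolding inverts_def by blast
  then show *: "inj_on z (below (Suc i)) \<longleftrightarrow> inj_on z (below i) \<and> v (z i) = 0"
    using assms(2) by (simp add: below_Suc)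
  show "inverts (Suc i) (v(z i := Suc i))"
    using assms unfolding inverts_def * by (auto simp: below_Suc) (metis image_eqI)
qed

definition invert :: com where
  "invert = FOR (LD vX Deg vI ;; IF vX (LD vY Zer vI ;; LD vX Inv vY ;; IF vX (SET vRes 1) SKIP ;;
     ADD vX vI vOne ;; ST Inv vY vX) SKIP)"

lemma invert:
  assumes "ready \<sigma> \<alpha>" "blank \<alpha>" "\<sigma> vRes = (if UP0_upto n then 0 else 1)" "n + T' \<le> T"
    and post: "\<And>u \<sigma> \<alpha>. T' \<le> u \<Longrightarrow> ready \<sigma> \<alpha> \<Longrightarrow> \<alpha> Img = (\<lambda>_. 0) \<Longrightarrow> \<alpha> Dup = (\<lambda>_. 0) \<Longrightarrow>
      inverts n (\<alpha> Inv) \<Longrightarrow> \<sigma> vRes = (if UP0_upto n \<and> inj_on z K then 0 else 1) \<Longrightarrow> Q u (\<sigma>, \<alpha>)"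
  shows "wp L invert Q T (\<sigma>, \<alpha>)"
  unfolding invert_def
proof (rule wp_FOR[where K = 0 and n = n and T' = T' and P = "\<lambda>i \<sigma> \<alpha>. ready \<sigma> \<alpha> \<and>
    \<alpha> Img = (\<lambda>_. 0) \<and> \<alpha> Dup = (\<lambda>_. 0) \<and> inverts i (\<alpha> Inv) \<and>
    \<sigma> vRes = (if UP0_upto n \<and> inj_on z (below i) then 0 else 1)"])
  fix i \<sigma> \<alpha>
  assume i: "i < n" "\<sigma> vI = i" "\<sigma> vN = n" "\<sigma> vOne = 1" and P: "ready \<sigma> \<alpha> \<and>
    \<alpha> Img = (\<lambda>_. 0) \<and> \<alpha> Dup = (\<lambda>_. 0) \<and> inverts i (\<alpha> Inv) \<and>
    \<sigma> vRes = (if UP0_upto n \<and> inj_on z (below i) then 0 else 1)"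
  note r = readyD[OF conjunct1[OF P]]
  show "wp L (LD vX Deg vI ;; IF vX (LD vY Zer vI ;; LD vX Inv vY ;; IF vX (SET vRes 1) SKIP ;;
     ADD vX vI vOne ;; ST Inv vY vX) SKIP)
     (\<lambda>_ (\<sigma>', \<alpha>'). \<sigma>' vI = i \<and> \<sigma>' vN = n \<and> \<sigma>' vOne = 1 \<and>
       ready (\<sigma>'(vI := Suc i, vC := n - Suc i)) \<alpha>' \<and>
       \<alpha>' Img = (\<lambda>_. 0) \<and> \<alpha>' Dup = (\<lambda>_. 0) \<and> inverts (Suc i) (\<alpha>' Inv) \<and>
       (\<sigma>'(vI := Suc i, vC := n - Suc i)) vRes =
         (if UP0_upto n \<and> inj_on z (below (Suc i)) then 0 else 1)) 0 (\<sigma>, \<alpha>)"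
  proof (cases "i \<in> K")
    case True
    then show ?thesis using P i inverts_Suc[of i "\<alpha> Inv"] by (simp add: r guard_def)
  next
    case False
    then have "inverts (Suc i) (\<alpha> Inv)" "below (Suc i) = below i"
      using P by (simp_all add: inverts_def below_Suc)
    then show ?thesis using P i False by (simp add: r guard_def)
  qed
qed (use assms readyD[OF assms(1)] post in \<open>simp_all add: blank_def inverts_def\<close>)

text \<open>Row address plus one is the entry for the digit 1; the final subtraction undoes the
  shift in \<open>Inv\<close>.\<close>

definition tabulate :: com where
  "tabulate = FOR (LD vX Deg vI ;; IF vX (LD vR Row vI ;; ADD vR vR vOne ;; LD vX Inp vR ;;
     LD vX Inv vX ;; SUB vX vX vOne ;; ST Tau vI vX) SKIP)"

lemma tau_eqI: "inj_on z K \<Longrightarrow> r \<in> K \<Longrightarrow> z r = d q 1 \<Longrightarrow> \<tau> q = r"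
  by (metis inv_into_f_f tau_def)

lemma z_image: "inj_on z K \<Longrightarrow> z ` K = K"
  using finite_K z_K by (intro endo_inj_surj) auto

lemma tau_K:
  assumes "inj_on z K" "q \<in> K" shows "\<tau> q \<in> K"
  using K_closed[OF assms(2) b] z_image[OF assms(1)] unfolding tau_def by (metis inv_into_into)

lemma tau_pow_K: "inj_on z K \<Longrightarrow> q \<in> K \<Longrightarrow> (\<tau> ^^ k) q \<in> K"
  by (induction k) (auto intro: tau_K)

lemma tau_inverts:
  assumes "inj_on z K" "inverts n v" "q \<in> K"
  shows "v (d q 1) - 1 = \<tau> q"
proof -
  have "d q 1 \<in> z ` K" using K_closed[OF assms(3) b] z_image[OF assms(1)] by simp
  then obtain r where r: "r \<in> K" "z r = d q 1" by (metis imageE)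
  then have "v (d q 1) = Suc r" using assms(1,2) unfolding inverts_def by (metis below_n)
  then show ?thesis using tau_eqI[OF assms(1) r] by simp
qed

definition tabulated :: "(var \<Rightarrow> nat) \<Rightarrow> (arr \<Rightarrow> nat \<Rightarrow> nat) \<Rightarrow> bool" where
  "tabulated \<sigma> \<alpha> \<longleftrightarrow> ready \<sigma> \<alpha> \<and> (\<forall>q\<in>K. \<alpha> Tau q = \<tau> q)"

lemma tabulate:
  assumes "inj_on z K" "ready \<sigma> \<alpha>" "\<alpha> Img = (\<lambda>_. 0)" "\<alpha> Dup = (\<lambda>_. 0)" "inverts n (\<alpha> Inv)"
    "\<sigma> vRes = 0" "n + T' \<le> T"
    and post: "\<And>u \<sigma> \<alpha>. T' \<le> u \<Longrightarrow> tabulated \<sigma> \<alpha> \<Longrightarrow> \<alpha> Img = (\<lambda>_. 0) \<Longrightarrow> \<alpha> Dup = (\<lambda>_. 0) \<Longrightarrow>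
      \<sigma> vRes = 0 \<Longrightarrow> Q u (\<sigma>, \<alpha>)"
  shows "wp L tabulate Q T (\<sigma>, \<alpha>)"
  unfolding tabulate_def
proof (rule wp_FOR[where K = 0 and n = n and T' = T' and P = "\<lambda>i \<sigma> \<alpha>. ready \<sigma> \<alpha> \<and>
    \<alpha> Img = (\<lambda>_. 0) \<and> \<alpha> Dup = (\<lambda>_. 0) \<and> inverts n (\<alpha> Inv) \<and> \<sigma> vRes = 0 \<and>
    (\<forall>q\<in>below i. \<alpha> Tau q = \<tau> q)"])
  fix i \<sigma> \<alpha>
  assume i: "i < n" "\<sigma> vI = i" "\<sigma> vN = n" "\<sigma> vOne = 1" and P: "ready \<sigma> \<alpha> \<and>
    \<alpha> Img = (\<lambda>_. 0) \<and> \<alpha> Dup = (\<lambda>_. 0) \<and> inverts n (\<alpha> Inv) \<and> \<sigma> vRes = 0 \<and>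
    (\<forall>q\<in>below i. \<alpha> Tau q = \<tau> q)"
  note r = readyD[OF conjunct1[OF P]]
  have R: "inp (Suc (3 + n + i * b)) = d i 1" "Suc (3 + n + i * b) < L"
    using read_d[of "3 + n + i * b + 1" i 1] i b by auto
  have "\<alpha> Inv (d i 1) - 1 = \<tau> i" if "i \<in> K" using tau_inverts[OF assms(1) _ that] P by simp
  then show "wp L (LD vX Deg vI ;; IF vX (LD vR Row vI ;; ADD vR vR vOne ;; LD vX Inp vR ;;
     LD vX Inv vX ;; SUB vX vX vOne ;; ST Tau vI vX) SKIP)
     (\<lambda>_ (\<sigma>', \<alpha>'). \<sigma>' vI = i \<and> \<sigma>' vN = n \<and> \<sigma>' vOne = 1 \<and>
       ready (\<sigma>'(vI := Suc i, vC := n - Suc i)) \<alpha>' \<and>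
       \<alpha>' Img = (\<lambda>_. 0) \<and> \<alpha>' Dup = (\<lambda>_. 0) \<and> inverts n (\<alpha>' Inv) \<and>
       (\<sigma>'(vI := Suc i, vC := n - Suc i)) vRes = 0 \<and> (\<forall>q\<in>below (Suc i). \<alpha>' Tau q = \<tau> q)) 0 (\<sigma>, \<alpha>)"
    using P i R by (auto simp: r guard_def below_Suc)
qed (use assms readyD[OF assms(2)] post in \<open>simp_all add: tabulated_def\<close>)

lemma tabulated_update [simp]:
  "x \<notin> {vOne, vB, vN, vL} \<Longrightarrow> tabulated (\<sigma>(x := v)) \<alpha> \<longleftrightarrow> tabulated \<sigma> \<alpha>"
  "X \<notin> {Inp, Row, Zer, Deg, Tau} \<Longrightarrow> tabulated \<sigma> (\<alpha>(X := f)) \<longleftrightarrow> tabulated \<sigma> \<alpha>"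
  by (auto simp: tabulated_def)

lemma tabulatedD:
  assumes "tabulated \<sigma> \<alpha>"
  shows "\<sigma> vOne = 1" "\<sigma> vB = b" "\<sigma> vN = n" "\<sigma> vL = L" "\<alpha> Inp = inp"
    "q < n \<Longrightarrow> \<alpha> Row q = 3 + n + q * b" "q < n \<Longrightarrow> \<alpha> Zer q = z q" "q < n \<Longrightarrow> \<alpha> Deg q = 0 \<longleftrightarrow> q \<notin> K"
    "q \<in> K \<Longrightarrow> \<alpha> Tau q = \<tau> q" "q \<in> K \<Longrightarrow> \<alpha> Zer q = z q"
  using assms readyD[of \<sigma> \<alpha>] K_less[of q] by (auto simp: tabulated_def)

text \<open>\<open>vX\<close> runs through the powers of tau in step with the row entries. After b
  rounds it holds \<open>(tau K ^^ b) q\<close>, just what the carry identity needs.\<close>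

definition test_row :: com where
  "test_row = WHILE vJ (LD vY Zer vX ;; LD vQ Inp vR ;; CHECK vY vQ ;; LD vX Tau vX ;;
     ADD vR vR vOne ;; SUB vJ vJ vOne)"

definition test :: com where
  "test = FOR (LD vX Deg vI ;; IF vX (COPY vX vI ;; LD vR Row vI ;; COPY vJ vB ;; test_row ;;
     LD vY Zer vX ;; LD vX Zer vI ;; LD vX Tau vX ;; CHECK vX vY) SKIP)"

lemma test_row:
  assumes inj: "inj_on z K" and q: "q \<in> K"
    and "tabulated \<sigma> \<alpha>" "\<alpha> Img = (\<lambda>_. 0)" "\<alpha> Dup = (\<lambda>_. 0)" "\<sigma> vX = q" "\<sigma> vI = q"
      "\<sigma> vR = 3 + n + q * b" "\<sigma> vJ = b" "\<sigma> vRes = (if C then 0 else 1)"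
    and post: "\<And>u \<sigma> \<alpha>. tabulated \<sigma> \<alpha> \<Longrightarrow> \<alpha> Img = (\<lambda>_. 0) \<Longrightarrow> \<alpha> Dup = (\<lambda>_. 0) \<Longrightarrow>
      \<sigma> vX = (\<tau> ^^ b) q \<Longrightarrow> \<sigma> vI = q \<Longrightarrow>
      \<sigma> vRes = (if C \<and> (\<forall>a<b. z ((\<tau> ^^ a) q) = d q a) then 0 else 1) \<Longrightarrow> Q u (\<sigma>, \<alpha>)"
  shows "wp L test_row Q b (\<sigma>, \<alpha>)"
  unfolding test_row_def
proof (rule wp_WHILE[where V = "\<lambda>(\<sigma>', _). \<sigma>' vJ" and K = 0 and T' = 0 and
    I = "\<lambda>(\<sigma>', \<alpha>'). tabulated \<sigma>' \<alpha>' \<and> \<alpha>' Img = (\<lambda>_. 0) \<and> \<alpha>' Dup = (\<lambda>_. 0) \<and> \<sigma>' vJ \<le> b \<and>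
      \<sigma>' vI = q \<and> \<sigma>' vR = 3 + n + q * b + (b - \<sigma>' vJ) \<and> \<sigma>' vX = (\<tau> ^^ (b - \<sigma>' vJ)) q \<and>
      \<sigma>' vRes = (if C \<and> (\<forall>a<b - \<sigma>' vJ. z ((\<tau> ^^ a) q) = d q a) then 0 else 1)"])
  let ?I = "\<lambda>s. (case s of (\<sigma>', \<alpha>') \<Rightarrow> tabulated \<sigma>' \<alpha>' \<and> \<alpha>' Img = (\<lambda>_. 0) \<and> \<alpha>' Dup = (\<lambda>_. 0) \<and> \<sigma>' vJ \<le> b \<and>
      \<sigma>' vI = q \<and> \<sigma>' vR = 3 + n + q * b + (b - \<sigma>' vJ) \<and> \<sigma>' vX = (\<tau> ^^ (b - \<sigma>' vJ)) q \<and>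
      \<sigma>' vRes = (if C \<and> (\<forall>a<b - \<sigma>' vJ. z ((\<tau> ^^ a) q) = d q a) then 0 else 1))"
  fix \<sigma> \<alpha> assume "?I (\<sigma>, \<alpha>)" and J: "\<sigma> vJ \<noteq> 0"
  then have tab: "tabulated \<sigma> \<alpha>" and I: "\<alpha> Img = (\<lambda>_. 0)" "\<alpha> Dup = (\<lambda>_. 0)" "\<sigma> vJ \<le> b" "\<sigma> vI = q"
      "\<sigma> vR = 3 + n + q * b + (b - \<sigma> vJ)" "\<sigma> vX = (\<tau> ^^ (b - \<sigma> vJ)) q"
      "\<sigma> vRes = (if C \<and> (\<forall>a<b - \<sigma> vJ. z ((\<tau> ^^ a) q) = d q a) then 0 else 1)"
    and J': "b - \<sigma> vJ < b" "b - (\<sigma> vJ - 1) = Suc (b - \<sigma> vJ)" by auto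
  define j where "j = b - \<sigma> vJ"
  have R: "inp (3 + n + q * b + j) = d q j" "3 + n + q * b + j < L"
    using read_d[OF refl K_less[OF q] J'(1)] by (auto simp: j_def)
  have "(\<tau> ^^ j) q \<in> K" using tau_pow_K[OF inj q] .
  moreover have "\<sigma> vJ - Suc 0 \<le> b" using I(3) by simp
  ultimately show "wp L (LD vY Zer vX ;; LD vQ Inp vR ;; CHECK vY vQ ;; LD vX Tau vX ;;
     ADD vR vR vOne ;; SUB vJ vJ vOne)
     (\<lambda>_ s'. ?I s' \<and> (case s' of (\<sigma>', _) \<Rightarrow> \<sigma>' vJ) < (case (\<sigma>, \<alpha>) of (\<sigma>', _) \<Rightarrow> \<sigma>' vJ)) 0 (\<sigma>, \<alpha>)"
    using I J J'(2) R tab unfolding j_def[symmetric]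
    by (simp add: tabulatedD[OF tab] guard_def All_less_Suc)
qed (use assms in auto)

definition consistent :: "nat \<Rightarrow> bool" where
  "consistent i \<longleftrightarrow> (\<forall>q\<in>below i. (\<forall>a<b. z ((\<tau> ^^ a) q) = d q a) \<and> \<tau> (z q) = z ((\<tau> ^^ b) q))"

lemma test:
  assumes inj: "inj_on z K" and "tabulated \<sigma> \<alpha>" "\<alpha> Img = (\<lambda>_. 0)" "\<alpha> Dup = (\<lambda>_. 0)" "\<sigma> vRes = 0"
    "n * Suc b + T' \<le> T"
    and post: "\<And>u \<sigma> \<alpha>. T' \<le> u \<Longrightarrow> tabulated \<sigma> \<alpha> \<Longrightarrow> \<alpha> Img = (\<lambda>_. 0) \<Longrightarrow> \<alpha> Dup = (\<lambda>_. 0) \<Longrightarrow>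
      \<sigma> vRes = (if consistent n then 0 else 1) \<Longrightarrow> Q u (\<sigma>, \<alpha>)"
  shows "wp L test Q T (\<sigma>, \<alpha>)"
  unfolding test_def
proof (rule wp_FOR[where K = b and n = n and T' = T' and P = "\<lambda>i \<sigma> \<alpha>. tabulated \<sigma> \<alpha> \<and>
    \<alpha> Img = (\<lambda>_. 0) \<and> \<alpha> Dup = (\<lambda>_. 0) \<and> \<sigma> vRes = (if consistent i then 0 else 1)"])
  fix i \<sigma> \<alpha>
  assume i: "i < n" "\<sigma> vI = i" "\<sigma> vN = n" "\<sigma> vOne = 1" and P: "tabulated \<sigma> \<alpha> \<and>
    \<alpha> Img = (\<lambda>_. 0) \<and> \<alpha> Dup = (\<lambda>_. 0) \<and> \<sigma> vRes = (if consistent i then 0 else 1)"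
  note r = tabulatedD[OF conjunct1[OF P]]
  let ?post = "\<lambda>_ (\<sigma>', \<alpha>'). \<sigma>' vI = i \<and> \<sigma>' vN = n \<and> \<sigma>' vOne = 1 \<and>
       tabulated (\<sigma>'(vI := Suc i, vC := n - Suc i)) \<alpha>' \<and>
       \<alpha>' Img = (\<lambda>_. 0) \<and> \<alpha>' Dup = (\<lambda>_. 0) \<and>
       (\<sigma>'(vI := Suc i, vC := n - Suc i)) vRes = (if consistent (Suc i) then 0 else 1)"
  show "wp L (LD vX Deg vI ;; IF vX (COPY vX vI ;; LD vR Row vI ;; COPY vJ vB ;; test_row ;;
     LD vY Zer vX ;; LD vX Zer vI ;; LD vX Tau vX ;; CHECK vX vY) SKIP) ?post b (\<sigma>, \<alpha>)"
  proof (cases "i \<in> K")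
    case True
    have end_row: "wp L (LD vY Zer vX ;; LD vX Zer vI ;; LD vX Tau vX ;; CHECK vX vY) ?post u (\<sigma>', \<alpha>')"
      if "tabulated \<sigma>' \<alpha>'" "\<alpha>' Img = (\<lambda>_. 0)" "\<alpha>' Dup = (\<lambda>_. 0)" "\<sigma>' vX = (\<tau> ^^ b) i" "\<sigma>' vI = i"
        "\<sigma>' vRes = (if consistent i \<and> (\<forall>a<b. z ((\<tau> ^^ a) i) = d i a) then 0 else 1)" for u \<sigma>' \<alpha>'
      using that tau_pow_K[OF inj True, of b] True z_K[OF True]
      by (simp add: tabulatedD[OF that(1)] guard_def consistent_def below_Suc)
    show ?thesis
      using True P i
      apply (simp add: r guard_def split del: if_split)
      apply (rule test_row[OF inj True, where C = "consistent i"])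
      by (use end_row in \<open>simp_all add: r\<close>)
  next
    case False
    then show ?thesis using P i by (simp add: r guard_def consistent_def below_Suc)
  qed
qed (use assms tabulatedD[OF assms(2)] post in \<open>simp_all add: consistent_def\<close>)

definition mark :: com where
  "mark = FOR (LD vX Deg vI ;; IF vX (LD vY Tau vI ;; ST Img vY vOne) SKIP)"

lemma mark:
  assumes "tabulated \<sigma> \<alpha>" "\<alpha> Img = (\<lambda>_. 0)" "\<alpha> Dup = (\<lambda>_. 0)" "\<sigma> vRes = r" "n + T' \<le> T"
    and post: "\<And>u \<sigma> \<alpha>. T' \<le> u \<Longrightarrow> tabulated \<sigma> \<alpha> \<Longrightarrow> (\<forall>s. \<alpha> Img s = 0 \<longleftrightarrow> s \<notin> \<tau> ` K) \<Longrightarrow>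
      \<alpha> Dup = (\<lambda>_. 0) \<Longrightarrow> \<sigma> vRes = r \<Longrightarrow> Q u (\<sigma>, \<alpha>)"
  shows "wp L mark Q T (\<sigma>, \<alpha>)"
  unfolding mark_def
proof (rule wp_FOR[where K = 0 and n = n and T' = T' and P = "\<lambda>i \<sigma> \<alpha>. tabulated \<sigma> \<alpha> \<and>
    (\<forall>s. \<alpha> Img s = 0 \<longleftrightarrow> s \<notin> \<tau> ` below i) \<and> \<alpha> Dup = (\<lambda>_. 0) \<and> \<sigma> vRes = r"])
  fix i \<sigma> \<alpha>
  assume i: "i < n" "\<sigma> vI = i" "\<sigma> vN = n" "\<sigma> vOne = 1" and P: "tabulated \<sigma> \<alpha> \<and>
    (\<forall>s. \<alpha> Img s = 0 \<longleftrightarrow> s \<notin> \<tau> ` below i) \<and> \<alpha> Dup = (\<lambda>_. 0) \<and> \<sigma> vRes = r"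
  show "wp L (LD vX Deg vI ;; IF vX (LD vY Tau vI ;; ST Img vY vOne) SKIP)
     (\<lambda>_ (\<sigma>', \<alpha>'). \<sigma>' vI = i \<and> \<sigma>' vN = n \<and> \<sigma>' vOne = 1 \<and>
       tabulated (\<sigma>'(vI := Suc i, vC := n - Suc i)) \<alpha>' \<and>
       (\<forall>s. \<alpha>' Img s = 0 \<longleftrightarrow> s \<notin> \<tau> ` below (Suc i)) \<and> \<alpha>' Dup = (\<lambda>_. 0) \<and>
       (\<sigma>'(vI := Suc i, vC := n - Suc i)) vRes = r) 0 (\<sigma>, \<alpha>)"
    using P i by (simp add: tabulatedD[OF conjunct1[OF P]] guard_def below_Suc)
qed (use assms tabulatedD[OF assms(1)] post in simp_all)

definition test_image :: com where
  "test_image = FOR (LD vX Img vI ;; IF vX (LD vY Tau vI ;; LD vX Dup vY ;; IF vX (SET vRes 1) SKIP ;;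
     ST Dup vY vOne) SKIP)"

lemma test_image:
  assumes inj: "inj_on z K" and "tabulated \<sigma> \<alpha>" "\<forall>s. \<alpha> Img s = 0 \<longleftrightarrow> s \<notin> \<tau> ` K" "\<alpha> Dup = (\<lambda>_. 0)"
    "\<sigma> vRes = (if C then 0 else 1)" "n + T' \<le> T"
    and post: "\<And>u \<sigma> \<alpha>. T' \<le> u \<Longrightarrow> tabulated \<sigma> \<alpha> \<Longrightarrow>
      \<sigma> vRes = (if C \<and> inj_on \<tau> (\<tau> ` K) then 0 else 1) \<Longrightarrow> Q u (\<sigma>, \<alpha>)"
  shows "wp L test_image Q T (\<sigma>, \<alpha>)"
proof -
  define J where "J i = \<tau> ` K \<inter> {..<i}" for i
  have J: "J 0 = {}" "J n = \<tau> ` K" "i \<notin> J i"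
    "J (Suc i) = (if i \<in> \<tau> ` K then insert i (J i) else J i)" for i
    using tau_K[OF inj] K_less by (auto simp: J_def less_Suc_eq)
  show ?thesis
    unfolding test_image_def
  proof (rule wp_FOR[where K = 0 and n = n and T' = T' and P = "\<lambda>i \<sigma> \<alpha>. tabulated \<sigma> \<alpha> \<and>
      (\<forall>s. \<alpha> Img s = 0 \<longleftrightarrow> s \<notin> \<tau> ` K) \<and> (\<forall>s. \<alpha> Dup s = 0 \<longleftrightarrow> s \<notin> \<tau> ` J i) \<and>
      \<sigma> vRes = (if C \<and> inj_on \<tau> (J i) then 0 else 1)"])
    fix i \<sigma> \<alpha>
    assume i: "i < n" "\<sigma> vI = i" "\<sigma> vN = n" "\<sigma> vOne = 1" and P: "tabulated \<sigma> \<alpha> \<and>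
      (\<forall>s. \<alpha> Img s = 0 \<longleftrightarrow> s \<notin> \<tau> ` K) \<and> (\<forall>s. \<alpha> Dup s = 0 \<longleftrightarrow> s \<notin> \<tau> ` J i) \<and>
      \<sigma> vRes = (if C \<and> inj_on \<tau> (J i) then 0 else 1)"
    note r = tabulatedD[OF conjunct1[OF P]]
    show "wp L (LD vX Img vI ;; IF vX (LD vY Tau vI ;; LD vX Dup vY ;; IF vX (SET vRes 1) SKIP ;;
       ST Dup vY vOne) SKIP)
       (\<lambda>_ (\<sigma>', \<alpha>'). \<sigma>' vI = i \<and> \<sigma>' vN = n \<and> \<sigma>' vOne = 1 \<and>
         tabulated (\<sigma>'(vI := Suc i, vC := n - Suc i)) \<alpha>' \<and>
         (\<forall>s. \<alpha>' Img s = 0 \<longleftrightarrow> s \<notin> \<tau> ` K) \<and> (\<forall>s. \<alpha>' Dup s = 0 \<longleftrightarrow> s \<notin> \<tau> ` J (Suc i)) \<and>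
         (\<sigma>'(vI := Suc i, vC := n - Suc i)) vRes =
           (if C \<and> inj_on \<tau> (J (Suc i)) then 0 else 1)) 0 (\<sigma>, \<alpha>)"
    proof (cases "i \<in> \<tau> ` K")
      case True
      then have "i \<in> K" using tau_K[OF inj] by auto
      have "J (Suc i) = insert i (J i)" using True J(4) by simp
      moreover have "\<alpha> Img i \<noteq> 0" using P True by blast
      ultimately show ?thesis using P i J(3)[of i] r(9)[OF \<open>i \<in> K\<close>] r(1-5) by (simp add: guard_def)
    next
      case False
      then have "J (Suc i) = J i" "\<alpha> Img i = 0" using J(4) P by auto
      then show ?thesis using P i r(1-5) by (simp add: guard_def)
    qed
  qed (use assms tabulatedD[OF assms(2)] post J in simp_all)
qed

text \<open>A raised flag already settles the answer; otherwise \<open>z\<close> is injective on the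
  kernel, which the later phases need in order to read \<open>Inv\<close> as an inverse.\<close>

definition verify :: com where
  "verify = invert ;; IF vRes SKIP (tabulate ;; test ;; mark ;; test_image)"

lemma verify:
  assumes "scanned n \<sigma> \<alpha>" "K = {q. q < n \<and> \<alpha> Deg q \<noteq> 0}" "n * b + 5 * n + n + T' \<le> T"
    and post: "\<And>u \<sigma> \<alpha>. T' \<le> u \<Longrightarrow> \<sigma> vOne = 1 \<Longrightarrow>
      \<sigma> vRes = (if UP0_upto n \<and> coherent K then 0 else 1) \<Longrightarrow> Q u (\<sigma>, \<alpha>)"
  shows "wp L verify Q T (\<sigma>, \<alpha>)"
proof -
  have deg: "\<forall>q<n. \<alpha> Deg q = 0 \<longleftrightarrow> q \<notin> K" using assms(2) by auto
  show ?thesis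
    unfolding verify_def wp_SEQ
  proof (rule invert)
    show "ready \<sigma> \<alpha>" "blank \<alpha>" "\<sigma> vRes = (if UP0_upto n then 0 else 1)"
      using assms(1) deg by (simp_all add: scanned_def ready_def z_def)
    show "n + (n * b + 5 * n + T') \<le> T" using assms(3) by simp
    fix u \<sigma> \<alpha> assume u: "n * b + 5 * n + T' \<le> u"
      and I: "ready \<sigma> \<alpha>" "\<alpha> Img = (\<lambda>_. 0)" "\<alpha> Dup = (\<lambda>_. 0)" "inverts n (\<alpha> Inv)"
        "\<sigma> vRes = (if UP0_upto n \<and> inj_on z K then 0 else 1)"
    show "wp L (IF vRes SKIP (tabulate ;; test ;; mark ;; test_image)) Q u (\<sigma>, \<alpha>)"
    proof (cases "UP0_upto n \<and> inj_on z K")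
      case False
      then show ?thesis using I readyD(1)[OF I(1)] u post by (auto simp: coherent_def)
    next
      case True
      then have inj: "inj_on z K" and res: "\<sigma> vRes = 0" using I by auto
      have "wp L tabulate (wp L test (wp L mark (wp L test_image Q))) u (\<sigma>, \<alpha>)"
      proof (rule tabulate[OF inj I(1-4) res, where T' = "n * b + 4 * n + T'"])
        fix u \<sigma> \<alpha>
        assume "n * b + 4 * n + T' \<le> u" and T: "tabulated \<sigma> \<alpha>" "\<alpha> Img = (\<lambda>_. 0)" "\<alpha> Dup = (\<lambda>_. 0)" "\<sigma> vRes = 0"
        show "wp L test (wp L mark (wp L test_image Q)) u (\<sigma>, \<alpha>)"
        proof (rule test[OF inj T, where T' = "3 * n + T'"])
          show "n * Suc b + (3 * n + T') \<le> u" using \<open>n * b + 4 * n + T' \<le> u\<close> by (simp add: algebra_simps)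
          fix u \<sigma> \<alpha>
          assume "3 * n + T' \<le> u" and T: "tabulated \<sigma> \<alpha>" "\<alpha> Img = (\<lambda>_. 0)" "\<alpha> Dup = (\<lambda>_. 0)"
            "\<sigma> vRes = (if consistent n then 0 else 1)"
          show "wp L mark (wp L test_image Q) u (\<sigma>, \<alpha>)"
          proof (rule mark[OF T, where T' = "2 * n + T'"])
            show "n + (2 * n + T') \<le> u" using \<open>3 * n + T' \<le> u\<close> by simp
            fix u \<sigma> \<alpha>
            assume "2 * n + T' \<le> u" and T: "tabulated \<sigma> \<alpha>" "\<forall>s. \<alpha> Img s = 0 \<longleftrightarrow> s \<notin> \<tau> ` K" "\<alpha> Dup = (\<lambda>_. 0)"
              "\<sigma> vRes = (if consistent n then 0 else 1)"
            show "wp L test_image Q u (\<sigma>, \<alpha>)"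
            proof (rule test_image[OF inj T, where T' = T'])
              show "n + T' \<le> u" using \<open>2 * n + T' \<le> u\<close> by simp
              fix u \<sigma> \<alpha>
              assume "T' \<le> u" "tabulated \<sigma> \<alpha>" "\<sigma> vRes = (if consistent n \<and> inj_on \<tau> (\<tau> ` K) then 0 else 1)"
              moreover have "coherent K \<longleftrightarrow> consistent n \<and> inj_on \<tau> (\<tau> ` K)"
                using inj by (auto simp: coherent_def consistent_def)
              ultimately show "Q u (\<sigma>, \<alpha>)" using True post tabulatedD(1) by simp
            qed
          qed
        qed
      qed (use u in simp)
      then show ?thesis using res by simp
    qed
  qed
qed

end

text \<open>No command mentions a parameter of its locale, so the exported constants take no
  arguments: this is one program for all b and n.\<close>

definition main :: com where
  "main = table.prologue ;; table.scan ;; table.fill_queue ;; table.peel ;; table_kernel.verify ;;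
     SUB vRes vOne vRes"

text \<open>\<open>scan\<close>, \<open>peel\<close> and \<open>test\<close> cost n (b + 1) each;
  \<open>prologue\<close>, \<open>fill_queue\<close>, \<open>invert\<close>,
  \<open>tabulate\<close>, \<open>mark\<close> and \<open>test_image\<close> cost n each. One
  further n is slack.\<close>

lemma (in table) main:
  assumes "\<sigma> = (\<lambda>_. 0)" "\<alpha> Inp = inp" "\<And>A. A \<noteq> Inp \<Longrightarrow> \<alpha> A = (\<lambda>_. 0)" "3 * (n * b) + 10 * n \<le> T"
  shows "wp L main (\<lambda>_ s. \<exists>K. is_kernel K \<and> fst s vRes = (if UP0_upto n \<and> coherent K then 1 else 0)) T (\<sigma>, \<alpha>)"
  unfolding main_def wp_SEQ
proof (rule prologue[where T' = "3 * (n * b) + 9 * n"])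
  fix u \<sigma> assume "3 * (n * b) + 9 * n \<le> u" "env \<sigma> \<alpha>" "\<sigma> vRes = 0"
  let ?Q = "\<lambda>_ s. \<exists>K. is_kernel K \<and> fst s vRes = (if UP0_upto n \<and> coherent K then 1 else 0)"
  show "wp L scan (wp L fill_queue (wp L peel (wp L table_kernel.verify (wp L (SUB vRes vOne vRes) ?Q)))) u (\<sigma>, \<alpha>)"
  proof (rule scan[where T' = "2 * (n * b) + 8 * n"])
    show "n * Suc b + (2 * (n * b) + 8 * n) \<le> u" using \<open>3 * (n * b) + 9 * n \<le> u\<close> by (simp add: algebra_simps)
    fix u \<sigma> \<alpha>
    assume u: "2 * (n * b) + 8 * n \<le> u"
      and S: "scanned n \<sigma> \<alpha>" and D: "\<alpha> Deg = (\<lambda>t. \<Sum>q<n. hits q b t)"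
    show "wp L fill_queue (wp L peel (wp L table_kernel.verify (wp L (SUB vRes vOne vRes) ?Q))) u (\<sigma>, \<alpha>)"
    proof (rule fill_queue[OF S D, where T' = "2 * (n * b) + 7 * n"])
      show "n + (2 * (n * b) + 7 * n) \<le> u" using u by simp
      fix u \<sigma> \<alpha>
      assume u: "2 * (n * b) + 7 * n \<le> u"
        and S: "scanned n \<sigma> \<alpha>" and P: "peeled 0 (\<sigma> vT) (\<alpha> Que) (\<alpha> Deg)"
      show "wp L peel (wp L table_kernel.verify (wp L (SUB vRes vOne vRes) ?Q)) u (\<sigma>, \<alpha>)"
      proof (rule peel[OF S P, where T' = "n * b + 6 * n"])
        show "n * Suc b + (n * b + 6 * n) \<le> u" using u by (simp add: algebra_simps)
        fix u \<sigma> \<alpha>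
        assume u: "n * b + 6 * n \<le> u" and S: "scanned n \<sigma> \<alpha>" and K: "is_kernel {q. q < n \<and> \<alpha> Deg q \<noteq> 0}"
        define K where "K = {q. q < n \<and> \<alpha> Deg q \<noteq> 0}"
        interpret table_kernel b n L d F inp K using K by unfold_locales (simp add: K_def)
        show "wp L table_kernel.verify (wp L (SUB vRes vOne vRes) ?Q) u (\<sigma>, \<alpha>)"
        proof (rule verify[OF S K_def, where T' = 0])
          fix u and \<sigma> :: "var \<Rightarrow> nat" and \<alpha> assume "\<sigma> vOne = 1" "\<sigma> vRes = (if UP0_upto n \<and> coherent K then 0 else 1)"
          then show "wp L (SUB vRes vOne vRes) ?Q u (\<sigma>, \<alpha>)"
            using is_kernel by (auto intro!: exI[of _ K])
        qed (use u in simp)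
      qed
    qed
  qed (use assms \<open>env \<sigma> \<alpha>\<close> \<open>\<sigma> vRes = 0\<close> in \<open>simp_all add: blank_def\<close>)
qed (use assms in simp_all)

lemma encode_table:
  fixes A :: "nat automaton"
  assumes A: "dfa A b" and n: "states A = {..<n}"
  shows "table b n (length (encode A)) (dfa.d A) (finals A) (\<lambda>i. encode A ! i)"
proof -
  interpret dfa A b by (rule A)
  let ?f = "\<lambda>q. if q \<in> finals A then 1 else 0 :: nat"
  let ?g = "\<lambda>q a. case delta A q a of None \<Rightarrow> n | Some t \<Rightarrow> t"
  let ?rows = "map (\<lambda>q. map (?g q) [0..<b]) [0..<n]"
  have enc: "encode A = [b, n, initial A] @ map ?f [0..<n] @ concat ?rows"
    by (simp add: encode_def base n)
  have len: "length (concat (map (\<lambda>q. map (?g q) [0..<b]) [0..<m])) = m * b" for m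
    by (induction m) auto
  have row: "concat (map (\<lambda>q. map (?g q) [0..<b]) [0..<m]) ! (q * b + a) = ?g q a"
    if "q < m" "a < b" for q a m
    using that
  proof (induction m)
    case (Suc m)
    have "q * b + a < m * b" if "q < m"
    proof -
      have "q * b + a < Suc q * b" using Suc.prems by simp
      also have "\<dots> \<le> m * b" using that by (intro mult_le_mono1) simp
      finally show ?thesis .
    qed
    then show ?case using Suc by (cases "q = m") (auto simp: nth_append len)
  qed simp
  show ?thesis
  proof
    show "1 < b" by (rule b)
    show "d q a < n" if "q < n" "a < b" for q a using d_in_states[of q a] that n by simp
    show "length (encode A) = 3 + n + n * b" by (simp add: enc len)
    show "encode A ! 0 = b" "encode A ! 1 = n" by (simp_all add: enc)
    show "encode A ! (3 + q) = ?f q" if "q < n" for q using that by (simp add: enc nth_append)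
    show "encode A ! (3 + n + q * b + a) = d q a" if "q < n" "a < b" for q a
    proof -
      have "encode A ! (3 + n + q * b + a) = concat ?rows ! (q * b + a)"
        by (simp add: enc nth_append add.assoc)
      then show ?thesis using row[OF that] that n by (simp add: delta_eq)
    qed
  qed
qed

text \<open>As \<open>K\<close> is closed, a path ending outside \<open>K\<close> lies outside it
  throughout and strictly increases the rank, so it cannot be a circuit.\<close>

lemma kernel_of_table:
  fixes A :: "nat automaton"
  assumes A: "dfa A b" and n: "states A = {..<n}" and K: "table.is_kernel b n (dfa.d A) K"
    and table: "table b n L (dfa.d A) F inp"
  shows "kernel A b K"
proof -
  interpret dfa A b by (rule A)
  interpret table b n L d F inp by (rule table)
  obtain r :: "nat \<Rightarrow> nat" where r: "\<forall>p<n. \<forall>a<b. d p a \<notin> K \<longrightarrow> r p < r (d p a)"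
    and K': "K \<subseteq> {..<n}" "\<forall>q\<in>K. \<forall>a<b. d q a \<in> K" "\<forall>q\<in>K. \<exists>p\<in>K. \<exists>a<b. d p a = q"
    using K unfolding is_kernel_def by blast
  have closed: "t \<in> K" if "(s, t) \<in> E\<^sup>*" "s \<in> K" for s t
    using that by (induction rule: rtrancl_induct) (use K' in \<open>auto simp: edges_iff\<close>)
  have rank: "r s < r t" if "(s, t) \<in> E\<^sup>+" "t \<notin> K" for s t
    using that
  proof (induction rule: trancl_induct)
    case (base t)
    then show ?case using r n by (auto simp: edges_iff)
  next
    case (step y t)
    then have "y \<notin> K" using closed[of y t] by blast
    moreover have "r y < r t" using step r n by (auto simp: edges_iff)
    ultimately show ?case using step by simp
  qed
  have "cyclic \<subseteq> K" using rank unfolding cyclic_def by blast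
  then show ?thesis
    using K' n by unfold_locales auto
qed

theorem theorem5p29:
  "\<exists>(P :: program) (c :: nat). \<forall>(b :: nat) (n :: nat) (A :: nat automaton).
     b > 1 \<and> base A = b \<and> states A = {..<n} \<and> minimal A \<longrightarrow>
     decides_within P (encode A) (c * (b * n)) (UP0 A \<and> UP1 A \<and> UP2 A \<and> UP3 A \<and> UP4 A)"
proof (intro exI allI impI)
  fix b n :: nat and A :: "nat automaton"
  assume *: "b > 1 \<and> base A = b \<and> states A = {..<n} \<and> minimal A"
  let ?P = "compile 0 main" and ?L = "length (encode A)" and ?UP = "UP0 A \<and> UP1 A \<and> UP2 A \<and> UP3 A \<and> UP4 A"
  have n: "states A = {..<n}" and minimal: "minimal A" using * by auto
  interpret dfa A b using * by unfold_locales (auto simp: minimal_def)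
  interpret table b n ?L d "finals A" "\<lambda>i. encode A ! i" using encode_table[OF dfa_axioms n] .
  have "initial A \<in> states A" using automaton by (simp add: automaton_def)
  then have "0 < n" using n by auto
  \<comment> \<open>The program only guarantees that it judged some kernel; since the equivalence
    holds for each one, the witness need not be known. (UP 1) is the promise on the input.\<close>
  have UP: "?UP \<longleftrightarrow> UP0_upto n \<and> coherent K" if K: "is_kernel K" for K
  proof -
    have ker: "kernel A b K" using kernel_of_table[OF dfa_axioms n K table_axioms] .
    interpret k: kernel A b K by (rule ker)
    have "UP0 A \<longleftrightarrow> UP0_upto n"
      using b n by (auto simp: UP0_def UP0_upto_def delta_eq)
    moreover have "UP1 A" using minimal by (simp add: UP1_def minimal_def)
    moreover have zero: "k.zero = z" by (simp add: fun_eq_iff k.zero_def z_def)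
    have "k.tau = tau K" by (simp add: fun_eq_iff k.tau_def tau_def zero)
    then have "k.coherent \<longleftrightarrow> coherent K"
      unfolding k.coherent_def coherent_def zero by simp
    ultimately show ?thesis using UP_iff_coherent[OF minimal _ ker] by blast
  qed
  have "wp ?L main (\<lambda>_ s. \<exists>K. is_kernel K \<and> fst s vRes = (if UP0_upto n \<and> coherent K then 1 else 0))
      (13 * (b * n)) (initial_store (encode A))"
    unfolding initial_store_def
  proof (rule main)
    \<comment> \<open>Turns 10 n into 10 b n, whence 13 = 3 + 10.\<close>
    have "1 * n \<le> b * n" using b by (intro mult_le_mono1) simp
    then show "3 * (n * b) + 10 * n \<le> 13 * (b * n)" by (simp add: mult.commute)
  qed auto
  then have "wp ?L main (\<lambda>_ s. fst s vRes = (if ?UP then 1 else 0)) (13 * (b * n)) (initial_store (encode A))"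
    by (rule wp_mono[where U = 0, simplified]) (elim exE conjE, frule UP, simp only:)
  then have "decides_within ?P (encode A) (length ?P * Suc (13 * (b * n))) ?UP"
    by (rule decides_within_compile)
  moreover have "length ?P * Suc (13 * (b * n)) \<le> (14 * length ?P) * (b * n)"
  proof -
    \<comment> \<open>The initial state makes n positive, so b n absorbs the additive 1.\<close>
    have "Suc (13 * (b * n)) \<le> 14 * (b * n)" using b \<open>0 < n\<close> by (simp add: Suc_le_eq)
    then have "length ?P * Suc (13 * (b * n)) \<le> length ?P * (14 * (b * n))" by (rule mult_le_mono2)
    then show ?thesis by (simp add: ac_simps)
  qed
  ultimately show "decides_within ?P (encode A) ((14 * length ?P) * (b * n)) ?UP"
    unfolding decides_within_def by (meson le_trans)
qed

end
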